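(* Consider the system $\dot x=Ax+Bf(x,u)$, $y=Cx+\nu(t)$, where the state is estimated by the multiple high-gain observer $$\dot{\hat x}_i=A\hat x_i+H(y-C\hat x_i),\quad i=1,\dots,N,\qquad \hat x_o=\sum_{i=1}^N\hat\beta_i\hat x_i,$$ with the weights $\hat\beta_i(t)$ generated by the recursive least squares law $$\dot{\hat{\bar\beta}}=-PE^TC^T(\tilde y_N+CE\hat{\bar\beta}),\ \ \hat{\bar\beta}(0)=\hat{\bar\beta}_0,\qquad \dot P=-PE^TC^TCEP,\ \ P(0)=\gamma I,$$ and the control input is the output feedback controller $u=g(\hat x_o,\theta)$, $\dot\theta=h(\hat x_o,\theta)$ (all objects and standing assumptions as in the context). Then for any compact set $\mathcal{S}_1\subseteq\mathcal{S}$ and any compact set $\mathcal{S}_2\subseteq\mathbb{R}^n$ there exist constants $\bar\nu^*>0$ and $0<\epsilon_1^*<\epsilon_2^*\le 1$ such that, for every noise $\nu$ with $\|\nu(t)\|\le\bar\nu^*$ and every $\epsilon\in[\epsilon_1^*,\epsilon_2^*]$, the solution $(x(t),\hat x_o(t))$ starting in $\mathcal{S}_1\times\mathcal{S}_2$ is bounded for all $t\ge 0$. Furthermore, the adaptive parameters $\hat{\bar\beta}(t)$ and the individual observer estimates $\hat x_i(t)$, $i=1,\dots,N$, are bounded as well.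
   Context: System: $\dot x_1=x_2,\dots,\dot x_{n-1}=x_n,\ \dot x_n=f(x,u)$, $y=x_1+\nu(t)$, with $x\in\mathbb{R}^n$, $u,y\in\mathbb{R}$, and bounded measurement noise $\nu(t)$. In compact form, $A$ is the $n\times n$ matrix with ones on the first superdiagonal and zeros elsewhere, $B=[0,\dots,0,1]^T\in\mathbb{R}^n$, $C=[1,0,\dots,0]\in\mathbb{R}^{1\times n}$. The (unknown) function $f(x,u)$ is locally Lipschitz in its arguments over the domain of interest and zero in a compact positively invariant set $\Sigma$. State feedback controller: $u=g(x,\theta)$, $\dot\theta=h(x,\theta)$, where $g$ and $h$ are locally Lipschitz in their arguments over the domain of interest and globally bounded functions of $x$. It is a standing assumption that, when the full state $x$ is available, this state feedback controller makes the closed-loop system uniformly asymptotically stable with respect to $\Sigma$. $\mathcal{S}$ denotes an open connected subset of the corresponding region of attraction. The output feedback controller is obtained by replacing $x$ by $\hat x_o$ in $g$ and $h$. Observers: $N\ge n+1$; $H=[\kappa_1/\epsilon,\ \kappa_2/\epsilon^2,\dots,\kappa_n/\epsilon^n]^T$ with $\epsilon\in(0,1]$ a design parameter and real numbers $\kappa_i$ such that all roots of $s^n+\kappa_1s^{n-1}+\cdots+\kappa_{n-1}s+\kappa_n$ have negative real part. Adaptive law: $\hat{\bar\beta}=[\hat\beta_1,\dots,\hat\beta_{N-1}]^T$, $\hat\beta_N=1-\sum_{i=1}^{N-1}\hat\beta_i$ (so $\sum_{i=1}^N\hat\beta_i=1$), $\tilde y_N=y-C\hat x_N$, $E(t)\in\mathbb{R}^{n\times(N-1)}$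 is the matrix whose $i$th column is $\hat x_N(t)-\hat x_i(t)$, $P(t)\in\mathbb{R}^{(N-1)\times(N-1)}$, $I$ is the identity matrix of size $N-1$, and $\gamma>0$ is a constant. *)

theory Defs
  imports "HOL-Analysis.Analysis"
begin

text \<open>Coordinates of the state are indexed by an arbitrary finite linearly ordered type; the
  function \<open>pos\<close> is its order isomorphism onto \<open>{1..n}\<close> with \<open>n = CARD('n)\<close>.\<close>

definition pos :: "'n::{finite,linorder} \<Rightarrow> nat" where
  "pos i = card {k. k \<le> i}"

definition chain_A :: "real ^ 'n::{finite,linorder} ^ 'n::{finite,linorder}" where
  "chain_A = (\<chi> i j. if pos j = pos i + 1 then 1 else 0)"

definition chain_B :: "real ^ 1 ^ 'n::{finite,linorder}" where
  "chain_B = (\<chi> i j. if pos i = CARD('n) then 1 else 0)"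

definition chain_C :: "real ^ 'n::{finite,linorder} ^ 1" where
  "chain_C = (\<chi> i j. if pos j = 1 then 1 else 0)"

definition gain_H :: "(nat \<Rightarrow> real) \<Rightarrow> real \<Rightarrow> real ^ 1 ^ 'n::{finite,linorder}" where
  "gain_H \<kappa> \<epsilon> = (\<chi> i j. \<kappa> (pos i) / \<epsilon> ^ pos i)"

definition hurwitz_coeffs :: "nat \<Rightarrow> (nat \<Rightarrow> real) \<Rightarrow> bool" where
  "hurwitz_coeffs n \<kappa> \<longleftrightarrow>
     (\<forall>s::complex. s ^ n + (\<Sum>i=1..n. of_real (\<kappa> i) * s ^ (n - i)) = 0 \<longrightarrow> Re s < 0)"

definition locally_lipschitz_on :: "'a::metric_space set \<Rightarrow> ('a \<Rightarrow> 'b::metric_space) \<Rightarrow> bool" where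
  "locally_lipschitz_on D F \<longleftrightarrow> local_lipschitz (UNIV :: real set) D (\<lambda>_. F)"

definition flow_solution ::
    "('a::euclidean_space \<Rightarrow> 'a) \<Rightarrow> 'a set \<Rightarrow> (real \<Rightarrow> 'a) \<Rightarrow> bool" where
  "flow_solution F D z \<longleftrightarrow>
     (\<forall>t\<ge>0. z t \<in> D \<and> (z has_vector_derivative F (z t)) (at t within {0..}))"

definition positively_invariant ::
    "('a::euclidean_space \<Rightarrow> 'a) \<Rightarrow> 'a set \<Rightarrow> 'a set \<Rightarrow> bool" where
  "positively_invariant F D K \<longleftrightarrow>
     (\<forall>z0\<in>K. (\<exists>z. flow_solution F D z \<and> z 0 = z0) \<and>
        (\<forall>z. flow_solution F D z \<and> z 0 = z0 \<longrightarrow> (\<forall>t\<ge>0. z t \<in> K)))"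

text \<open>\<open>infdist z K\<close> is the distance of \<open>z\<close> to \<open>K\<close>, provided \<open>K\<close> is nonempty
  (it is \<open>0\<close> for empty \<open>K\<close>). Since the system is autonomous, uniformity in the initial time is
  automatic; the time \<open>T\<close> is uniform in the initial state. The existence clause in the stability
  part says that solutions starting near \<open>K\<close> are defined for all \<open>t \<ge> 0\<close>.\<close>

definition uniformly_asymptotically_stable ::
    "('a::euclidean_space \<Rightarrow> 'a) \<Rightarrow> 'a set \<Rightarrow> 'a set \<Rightarrow> bool" where
  "uniformly_asymptotically_stable F D K \<longleftrightarrow>
     (\<forall>e>0. \<exists>d>0. \<forall>z0. infdist z0 K < d \<longrightarrow>
        (\<exists>z. flow_solution F D z \<and> z 0 = z0) \<and>
        (\<forall>z. flow_solution F D z \<and> z 0 = z0 \<longrightarrow> (\<forall>t\<ge>0. infdist (z t) K < e))) \<and>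
     (\<exists>c>0. \<forall>e>0. \<exists>T>0. \<forall>z. flow_solution F D z \<and> infdist (z 0) K < c \<longrightarrow>
        (\<forall>t\<ge>T. infdist (z t) K < e))"

definition region_of_attraction ::
    "('a::euclidean_space \<Rightarrow> 'a) \<Rightarrow> 'a set \<Rightarrow> 'a set \<Rightarrow> 'a set" where
  "region_of_attraction F D K =
     {z0. \<exists>z. flow_solution F D z \<and> z 0 = z0 \<and> ((\<lambda>t. infdist (z t) K) \<longlongrightarrow> 0) at_top}"

definition state_feedback_field ::
    "(real ^ 'n::{finite,linorder} \<Rightarrow> real \<Rightarrow> real) \<Rightarrow> (real ^ 'n::{finite,linorder} \<Rightarrow> 'p::euclidean_space \<Rightarrow> real) \<Rightarrow>
     (real ^ 'n::{finite,linorder} \<Rightarrow> 'p \<Rightarrow> 'p) \<Rightarrow> (real ^ 'n::{finite,linorder}) \<times> 'p \<Rightarrow> (real ^ 'n::{finite,linorder}) \<times> 'p" where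
  "state_feedback_field f g h =
     (\<lambda>(x, \<theta>). (chain_A *v x + chain_B *v vec (f x (g x \<theta>)), h x \<theta>))"

text \<open>Globally bounded function of \<open>x\<close> is read as: bounded over all \<open>x\<close>, uniformly for
  \<open>\<theta>\<close> in compact sets (a bound for each single \<open>\<theta>\<close> need not be locally uniform in \<open>\<theta>\<close>).\<close>

definition globally_bounded_in_state ::
    "'p::metric_space set \<Rightarrow> ('a \<Rightarrow> 'p \<Rightarrow> 'b::metric_space) \<Rightarrow> bool" where
  "globally_bounded_in_state \<Theta> g \<longleftrightarrow>
     (\<forall>K. compact K \<and> K \<subseteq> \<Theta> \<longrightarrow> bounded {g x \<theta> | x \<theta>. \<theta> \<in> K})"

text \<open>The \<open>N\<close> observers are indexed by \<open>'m option\<close>, where \<open>CARD('m) = N - 1\<close>: the indices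
  \<open>Some i\<close> stand for \<open>1, \<dots>, N - 1\<close> and \<open>None\<close> stands for \<open>N\<close>.\<close>

definition weight :: "real ^ 'm \<Rightarrow> 'm option \<Rightarrow> real" where
  "weight \<beta> i = (case i of Some j \<Rightarrow> \<beta> $ j | None \<Rightarrow> 1 - (\<Sum>j\<in>UNIV. \<beta> $ j))"

definition weighted_estimate :: "real ^ 'm \<Rightarrow> ('m option \<Rightarrow> real ^ 'n) \<Rightarrow> real ^ 'n" where
  "weighted_estimate \<beta> xh = (\<Sum>i\<in>UNIV. weight \<beta> i *\<^sub>R xh i)"

definition diff_matrix :: "('m option \<Rightarrow> real ^ 'n) \<Rightarrow> real ^ 'm ^ 'n" where
  "diff_matrix xh = (\<chi> r i. xh None $ r - xh (Some i) $ r)"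

text \<open>Caratheodory sense of \<open>z' = w\<close> on \<open>[0, \<infinity>)\<close>; the noise is only assumed measurable, so the
  right-hand sides below need not be continuous in time.\<close>

definition has_rate :: "(real \<Rightarrow> 'a::euclidean_space) \<Rightarrow> (real \<Rightarrow> 'a) \<Rightarrow> bool" where
  "has_rate z w \<longleftrightarrow> (\<forall>t\<ge>0. (w has_integral (z t - z 0)) {0..t})"

definition output_feedback_solution ::
    "(real ^ 'n::{finite,linorder} \<Rightarrow> real \<Rightarrow> real) \<Rightarrow> (real ^ 'n::{finite,linorder} \<Rightarrow> 'p::euclidean_space \<Rightarrow> real) \<Rightarrow>
     (real ^ 'n::{finite,linorder} \<Rightarrow> 'p \<Rightarrow> 'p) \<Rightarrow> (real ^ 'n::{finite,linorder}) set \<Rightarrow> 'p set \<Rightarrow>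
     (nat \<Rightarrow> real) \<Rightarrow> real \<Rightarrow> real ^ 'm \<Rightarrow> real \<Rightarrow> (real \<Rightarrow> real) \<Rightarrow>
     (real \<Rightarrow> real ^ 'n::{finite,linorder}) \<Rightarrow> (real \<Rightarrow> 'p) \<Rightarrow> (real \<Rightarrow> 'm option \<Rightarrow> real ^ 'n::{finite,linorder}) \<Rightarrow>
     (real \<Rightarrow> real ^ 'm) \<Rightarrow> (real \<Rightarrow> real ^ 'm ^ 'm) \<Rightarrow> bool" where
  "output_feedback_solution f g h X \<Theta> \<kappa> \<gamma> \<beta>\<^sub>0 \<epsilon> \<nu> x \<theta> xh \<beta> P \<longleftrightarrow>
     (let C = chain_C;
          xo = (\<lambda>t. weighted_estimate (\<beta> t) (xh t));
          u = (\<lambda>t. g (xo t) (\<theta> t));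
          y = (\<lambda>t. C *v x t + vec (\<nu> t));
          E = (\<lambda>t. diff_matrix (xh t));
          ytilde = (\<lambda>t. y t - C *v xh t None)
      in (\<forall>t\<ge>0. x t \<in> X \<and> \<theta> t \<in> \<Theta>) \<and>
         has_rate x (\<lambda>t. chain_A *v x t + chain_B *v vec (f (x t) (u t))) \<and>
         has_rate \<theta> (\<lambda>t. h (xo t) (\<theta> t)) \<and>
         (\<forall>i. has_rate (\<lambda>t. xh t i)
                (\<lambda>t. chain_A *v xh t i + gain_H \<kappa> \<epsilon> *v (y t - C *v xh t i))) \<and>
         has_rate \<beta> (\<lambda>t. - ((P t ** transpose (E t) ** transpose C)
                             *v (ytilde t + (C ** E t) *v \<beta> t))) \<and>
         \<beta> 0 = \<beta>\<^sub>0 \<and>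
         has_rate P (\<lambda>t. - (P t ** transpose (E t) ** transpose C ** C ** E t ** P t)) \<and>
         P 0 = \<gamma> *\<^sub>R mat 1)"

end

theory Submission
  imports Defs "HOL-Computational_Algebra.Fundamental_Theorem_Algebra"
begin

text \<open>All estimates obey the same linear observer equation, so the combined estimation error splits into
  the error of the combination with the initial weights \<open>\<beta>\<^sub>0\<close>, which starts in a compact set, and a
  correction \<open>E (\<beta> - \<beta>\<^sub>0)\<close>, where \<open>E\<close> evolves by the homogeneous observer equation. The least squares law
  minimises \<open>\<bar>\<beta> - \<beta>\<^sub>0\<bar>\<^sup>2 / \<gamma>\<close> plus the integrated squared output error, so the output of the correction
  is bounded in mean square by that of the first part; by observability the correction itself is
  bounded after time \<open>\<epsilon>\<close>, uniformly in the initial spread of the estimates. In scaled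
  coordinates the Hurwitz condition makes everything decay at rate \<open>1 / \<epsilon>\<close>. Before time \<open>\<epsilon>\<close> the estimate may
  peak, but \<open>g\<close> and \<open>h\<close> are globally bounded, so the plant state hardly moves; afterwards the output feedback
  loop is a small perturbation of the state feedback loop, whose stability is robust. These a priori
  bounds also show that the solution of a globally Lipschitz modification of the equations never
  leaves the compact set on which they are unmodified, which gives existence.\<close>

section \<open>Trajectories with integrable rate\<close>

text \<open>Measurable noise makes the right-hand sides discontinuous in time, so trajectories are
  treated as Lipschitz curves with a bounded integrable rate (\<open>rate_on\<close>), and the
  product rule and Gronwall's inequality are derived for such curves from integrals. The order of
  choices keeps the argument from being circular. The compact set \<open>K\<close> comes from the
  state feedback loop alone. Global boundedness of \<open>g\<close> and \<open>h\<close> then bounds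
  the speed on \<open>K\<close> whatever the estimate is, which fixes the admissible peaking time
  \<open>t0\<close> and the tolerated perturbation \<open>\<mu>\<close>. Only then is
  \<open>\<epsilon>2\<close> chosen, and last the noise level: the noise reaches the state estimate
  amplified by 1 / \<epsilon>^(n-1), which is why \<epsilon> has to stay above a positive
  \<open>\<epsilon>1\<close>. None of these constants may depend on the individual initial
  estimates, since \<open>S2\<close> constrains only their combination with the weights
  \<open>\<beta>0\<close>; the final bound \<open>R\<close> may.\<close>

definition rate_on :: "real \<Rightarrow> (real \<Rightarrow> 'a::euclidean_space) \<Rightarrow> (real \<Rightarrow> 'a) \<Rightarrow> bool" where
  "rate_on T z w \<longleftrightarrow> bounded (w ` {0..T}) \<and> (\<forall>t\<in>{0..T}. (w has_integral (z t - z 0)) {0..t})"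

lemma rate_on_bound:
  assumes "rate_on T z w"
  obtains M where "M > 0" "\<And>t. t \<in> {0..T} \<Longrightarrow> norm (w t) \<le> M"
  using assms unfolding rate_on_def bounded_pos by auto

lemma has_integral_diff_interval:
  fixes w :: "real \<Rightarrow> 'a::euclidean_space"
  assumes "(w has_integral a) {r..s}" "(w has_integral b) {r..t}" "r \<le> s" "s \<le> t"
  shows "(w has_integral (b - a)) {s..t}"
proof -
  have "w integrable_on {r..t}" using assms by blast
  then have "w integrable_on {s..t}"
    by (rule integrable_on_subinterval) (use assms in auto)
  then obtain c where c: "(w has_integral c) {s..t}" by blast
  have "(w has_integral (a + c)) {r..t}"
    by (rule has_integral_combine[OF assms(3,4,1) c])
  with assms(2) have "b = a + c" by (rule has_integral_unique)
  with c show ?thesis by simp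
qed

lemma rate_on_interval:
  assumes "rate_on T z w" "0 \<le> s" "s \<le> t" "t \<le> T"
  shows "(w has_integral (z t - z s)) {s..t}"
proof -
  have "(w has_integral (z t - z 0) - (z s - z 0)) {s..t}"
    by (rule has_integral_diff_interval) (use assms in \<open>auto simp: rate_on_def\<close>)
  then show ?thesis by simp
qed

lemma rate_on_subset: "rate_on T z w \<Longrightarrow> S \<le> T \<Longrightarrow> rate_on S z w"
  unfolding rate_on_def by (auto elim: bounded_subset)

lemma rate_on_cong:
  assumes "\<And>t. t \<in> {0..T} \<Longrightarrow> z t = z' t" "\<And>t. t \<in> {0..T} \<Longrightarrow> w t = w' t"
  shows "rate_on T z w \<longleftrightarrow> rate_on T z' w'"
proof -
  have "w ` {0..T} = w' ` {0..T}" using assms by (auto simp: image_iff)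
  moreover have "(w has_integral (z t - z 0)) {0..t} \<longleftrightarrow> (w' has_integral (z' t - z' 0)) {0..t}"
    if "t \<in> {0..T}" for t
  proof -
    have "(w has_integral (z t - z 0)) {0..t} \<longleftrightarrow> (w' has_integral (z t - z 0)) {0..t}"
      by (rule has_integral_cong) (use that assms in auto)
    then show ?thesis using assms(1)[of t] assms(1)[of 0] that by auto
  qed
  ultimately show ?thesis unfolding rate_on_def by auto
qed

lemma rate_on_increment_le:
  assumes r: "rate_on T z w" and b: "\<And>\<tau>. \<tau> \<in> {0..T} \<Longrightarrow> norm (w \<tau>) \<le> M"
    and st: "0 \<le> s" "s \<le> t" "t \<le> T"
  shows "norm (z t - z s) \<le> M * (t - s)"
proof -
  have "norm (z t - z s) \<le> M * measure lborel (cbox s t)"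
  proof (rule has_integral_bound)
    show "0 \<le> M" using order_trans[OF norm_ge_zero b[of s]] st by auto
    show "(w has_integral (z t - z s)) (cbox s t)"
      using rate_on_interval[OF r st] by simp
  qed (use b st in auto)
  then show ?thesis using st by simp
qed

lemma rate_on_continuous:
  assumes r: "rate_on T z w" shows "continuous_on {0..T} z"
proof -
  obtain M where M: "M > 0" "\<And>t. t \<in> {0..T} \<Longrightarrow> norm (w t) \<le> M" using rate_on_bound[OF r] by blast
  have "norm (z t - z s) \<le> M * \<bar>t - s\<bar>" if "t \<in> {0..T}" "s \<in> {0..T}" for s t
    using rate_on_increment_le[OF r M(2), of s t] rate_on_increment_le[OF r M(2), of t s] that
    by (cases "s \<le> t") (auto simp: norm_minus_commute)
  then have "M-lipschitz_on {0..T} z"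
    using M by (intro lipschitz_onI) (auto simp: dist_norm)
  then show ?thesis by (rule lipschitz_on_continuous_on)
qed

lemma rate_on_absolutely_integrable:
  assumes r: "rate_on T z w" and st: "0 \<le> s" "t \<le> T"
  shows "w absolutely_integrable_on {s..t}"
proof (cases "s \<le> t")
  case True
  obtain M where M: "M > 0" "\<And>t. t \<in> {0..T} \<Longrightarrow> norm (w t) \<le> M" using rate_on_bound[OF r] by blast
  show ?thesis
  proof (rule absolutely_integrable_integrable_bound[where g="\<lambda>_. M"])
    show "w integrable_on {s..t}" using rate_on_interval[OF r st(1) True st(2)] by blast
  qed (use M st True in auto)
qed auto

lemma rate_on_linear:
  assumes "rate_on T z w" "bounded_linear f"
  shows "rate_on T (\<lambda>t. f (z t)) (\<lambda>t. f (w t))"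
proof -
  interpret bounded_linear f by fact
  have "bounded ((f \<circ> w) ` {0..T})"
    using bounded_linear_image[OF _ assms(2)] assms(1) by (metis image_comp rate_on_def)
  moreover have "(f \<circ> w has_integral f (z t - z 0)) {0..t}" if "t \<in> {0..T}" for t
    by (rule has_integral_linear) (use that assms in \<open>auto simp: rate_on_def\<close>)
  ultimately show ?thesis unfolding rate_on_def by (auto simp: o_def diff)
qed

lemma rate_on_add:
  assumes "rate_on T z w" "rate_on T z' w'"
  shows "rate_on T (\<lambda>t. z t + z' t) (\<lambda>t. w t + w' t)"
  unfolding rate_on_def
proof (intro conjI ballI)
  show "bounded ((\<lambda>t. w t + w' t) ` {0..T})"
    using assms by (intro bounded_plus_comp) (auto simp: rate_on_def)
  fix t assume "t \<in> {0..T}"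
  then have "((\<lambda>t. w t + w' t) has_integral ((z t - z 0) + (z' t - z' 0))) {0..t}"
    by (intro has_integral_add) (use assms in \<open>auto simp: rate_on_def\<close>)
  then show "((\<lambda>t. w t + w' t) has_integral (z t + z' t - (z 0 + z' 0))) {0..t}"
    by (simp add: algebra_simps)
qed

lemma rate_on_const: "rate_on T (\<lambda>_. c) (\<lambda>_. 0)"
  unfolding rate_on_def by (auto simp: bounded_iff)

lemma rate_on_uminus: "rate_on T z w \<Longrightarrow> rate_on T (\<lambda>t. - z t) (\<lambda>t. - w t)"
  by (erule rate_on_linear) (rule bounded_linear_minus[OF bounded_linear_ident])

lemma rate_on_diff:
  assumes "rate_on T z w" "rate_on T z' w'"
  shows "rate_on T (\<lambda>t. z t - z' t) (\<lambda>t. w t - w' t)"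
  using rate_on_add[OF assms(1) rate_on_uminus[OF assms(2)]] by simp

lemma rate_on_scaleR: "rate_on T z w \<Longrightarrow> rate_on T (\<lambda>t. c *\<^sub>R z t) (\<lambda>t. c *\<^sub>R w t)"
  by (erule rate_on_linear) (auto intro: bounded_linear_intros)

lemma rate_on_sum:
  assumes "finite I" "\<And>i. i \<in> I \<Longrightarrow> rate_on T (z i) (w i)"
  shows "rate_on T (\<lambda>t. \<Sum>i\<in>I. z i t) (\<lambda>t. \<Sum>i\<in>I. w i t)"
  using assms by (induction I rule: finite_induct) (auto intro: rate_on_const rate_on_add)

lemma rate_on_antiderivative:
  assumes "bounded (w ` {0..T})" "w integrable_on {0..T}"
  shows "rate_on T (\<lambda>t. c + integral {0..t} w) w"
  unfolding rate_on_def
proof (intro conjI ballI)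
  fix t assume "t \<in> {0..T}"
  then have "w integrable_on {0..t}" using integrable_on_subinterval[OF assms(2), of 0 t] by auto
  then show "(w has_integral (c + integral {0..t} w - (c + integral {0..0} w))) {0..t}"
    by (simp add: integrable_integral)
qed fact

lemma rate_on_continuous_rate:
  assumes "continuous_on {0..T} w"
  shows "rate_on T (\<lambda>t. c + integral {0..t} w) w"
  by (rule rate_on_antiderivative)
    (use assms in \<open>auto intro: integrable_continuous_real compact_imp_bounded compact_continuous_image\<close>)

lemma rate_on_has_vector_derivative:
  assumes "continuous_on {0..T} w"
    "\<And>t. t \<in> {0..T} \<Longrightarrow> (z has_vector_derivative w t) (at t within {0..T})"
  shows "rate_on T z w"
  unfolding rate_on_def
proof (intro conjI ballI)
  show "bounded (w ` {0..T})"
    using assms(1) by (auto intro: compact_imp_bounded compact_continuous_image)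
  fix t assume t: "t \<in> {0..T}"
  show "(w has_integral (z t - z 0)) {0..t}"
    by (rule fundamental_theorem_of_calculus)
      (use t in \<open>auto intro: has_vector_derivative_within_subset[OF assms(2)]\<close>)
qed

lemma rate_on_zero_const:
  assumes "rate_on T z (\<lambda>_. 0)" "t \<in> {0..T}" shows "z t = z 0"
  using rate_on_interval[OF assms(1), of 0 t] assms(2) has_integral_unique[OF _ has_integral_0] by auto

lemma rate_on_shift:
  assumes r: "rate_on T z w" and s: "0 \<le> s" "s \<le> T"
  shows "rate_on (T - s) (\<lambda>t. z (s + t)) (\<lambda>t. w (s + t))"
  unfolding rate_on_def
proof (intro conjI ballI)
  have "(\<lambda>t. w (s + t)) ` {0..T - s} \<subseteq> w ` {0..T}" using s by (auto intro!: imageI)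
  then show "bounded ((\<lambda>t. w (s + t)) ` {0..T - s})"
    using r bounded_subset unfolding rate_on_def by blast
  fix t assume "t \<in> {0..T - s}"
  then have "(w has_integral (z (s + t) - z s)) {0 + s..t + s}"
    using rate_on_interval[OF r s(1), of "s + t"] by (auto simp: add.commute)
  then show "((\<lambda>t. w (s + t)) has_integral (z (s + t) - z (s + 0))) {0..t}"
    unfolding has_integral_shift_Icc_real[symmetric] by (simp add: o_def)
qed

text \<open>Change of time scale for the high-gain analysis: one unit of the new time is a time
  \<epsilon> of the plant, and the factor \<epsilon> in the new rate later cancels the powers of 1 /
  \<epsilon> in the gain.\<close>

lemma rate_on_rescale:
  assumes r: "rate_on T z w" and e: "\<epsilon> > 0"
  shows "rate_on (T / \<epsilon>) (\<lambda>s. z (\<epsilon> * s)) (\<lambda>s. \<epsilon> *\<^sub>R w (\<epsilon> * s))"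
  unfolding rate_on_def
proof (intro conjI ballI)
  obtain M where M: "M > 0" "\<And>t. t \<in> {0..T} \<Longrightarrow> norm (w t) \<le> M" using rate_on_bound[OF r] by blast
  show "bounded ((\<lambda>s. \<epsilon> *\<^sub>R w (\<epsilon> * s)) ` {0..T / \<epsilon>})"
    unfolding bounded_iff using M e by (intro exI[of _ "\<epsilon> * M"]) (auto simp: field_simps)
  fix t assume t: "t \<in> {0..T / \<epsilon>}"
  have "(w has_integral (z (\<epsilon> * t) - z 0)) {0..\<epsilon> * t}"
    using rate_on_interval[OF r, of 0 "\<epsilon> * t"] t e by (auto simp: field_simps)
  from has_integral_stretch_real[OF this, of \<epsilon>] e
  have "((\<lambda>x. w (\<epsilon> * x)) has_integral (1 / \<epsilon>) *\<^sub>R (z (\<epsilon> * t) - z 0)) ((\<lambda>x. x / \<epsilon>) ` {0..\<epsilon> * t})"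
    by simp
  moreover have "(\<lambda>x. x / \<epsilon>) ` {0..\<epsilon> * t} = {0..t}"
  proof (intro equalityI subsetI)
    fix y assume "y \<in> {0..t}"
    then have "y = (\<epsilon> * y) / \<epsilon>" "\<epsilon> * y \<in> {0..\<epsilon> * t}" using e by auto
    then show "y \<in> (\<lambda>x. x / \<epsilon>) ` {0..\<epsilon> * t}" by (rule image_eqI)
  qed (use e t in \<open>auto simp: field_simps\<close>)
  ultimately have "((\<lambda>x. w (\<epsilon> * x)) has_integral (1 / \<epsilon>) *\<^sub>R (z (\<epsilon> * t) - z 0)) {0..t}" by simp
  from has_integral_cmul[OF this, of \<epsilon>] e
  show "((\<lambda>s. \<epsilon> *\<^sub>R w (\<epsilon> * s)) has_integral (z (\<epsilon> * t) - z (\<epsilon> * 0))) {0..t}" by simp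
qed

text \<open>Gauge integrability alone does not survive multiplication by a continuous function, so
  the factor that carries the noise has to be absolutely integrable; the continuous one is
  measurable and bounded on the compact interval.\<close>

lemma absolutely_integrable_bilinear_continuous:
  fixes f :: "real \<Rightarrow> 'a::euclidean_space" and g :: "real \<Rightarrow> 'b::euclidean_space"
    and p :: "'a \<Rightarrow> 'b \<Rightarrow> 'c::euclidean_space"
  assumes "bounded_bilinear p" "f absolutely_integrable_on {a..b}" "continuous_on {a..b} g"
  shows "(\<lambda>t. p (f t) (g t)) absolutely_integrable_on {a..b}"
proof (rule absolutely_integrable_bounded_measurable_product[where h = "\<lambda>x y. p y x",
      where f = g and g = f and S = "{a..b}"])
  show "bilinear (\<lambda>x y. p y x)"
    by (simp add: bilinear_conv_bounded_bilinear bounded_bilinear.flip assms)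
  show "g \<in> borel_measurable (lebesgue_on {a..b})"
    by (rule continuous_imp_measurable_on_sets_lebesgue) (use assms in auto)
  show "bounded (g ` {a..b})"
    using assms by (auto intro: compact_imp_bounded compact_continuous_image)
qed (use assms in auto)

text \<open>The defect of the product formula over \<open>[s, t]\<close> is additive in the interval and
  quadratically small, hence zero.\<close>

lemma rate_on_bilinear:
  fixes p :: "'a::euclidean_space \<Rightarrow> 'b::euclidean_space \<Rightarrow> 'c::euclidean_space"
  assumes p: "bounded_bilinear p" and u: "rate_on T u u'" and v: "rate_on T v v'"
  shows "rate_on T (\<lambda>t. p (u t) (v t)) (\<lambda>t. p (u' t) (v t) + p (u t) (v' t))"
proof -
  interpret p: bounded_bilinear p by fact
  obtain K where K: "K > 0" "\<And>a b. norm (p a b) \<le> norm a * norm b * K" using p.pos_bounded by blast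
  obtain M where M: "M > 0" "\<And>t. t \<in> {0..T} \<Longrightarrow> norm (u' t) \<le> M" using rate_on_bound[OF u] by blast
  obtain N where N: "N > 0" "\<And>t. t \<in> {0..T} \<Longrightarrow> norm (v' t) \<le> N" using rate_on_bound[OF v] by blast
  define w where "w t = p (u' t) (v t) + p (u t) (v' t)" for t
  have pi1: "(\<lambda>t. p (u' t) (v t)) absolutely_integrable_on {0..T}"
    by (rule absolutely_integrable_bilinear_continuous[OF p])
      (use rate_on_continuous[OF v] rate_on_absolutely_integrable[OF u] in auto)
  have pi2: "(\<lambda>t. p (u t) (v' t)) absolutely_integrable_on {0..T}"
    by (rule absolutely_integrable_bilinear_continuous[OF p.flip])
      (use rate_on_continuous[OF u] rate_on_absolutely_integrable[OF v] in auto)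
  have wi: "w integrable_on {0..T}"
    unfolding w_def using pi1 pi2
    by (intro integrable_add) (auto simp: absolutely_integrable_on_def)
  have cu: "bounded (u ` {0..T})" and cv: "bounded (v ` {0..T})"
    using rate_on_continuous[OF u] rate_on_continuous[OF v]
    by (auto intro: compact_imp_bounded compact_continuous_image)
  obtain U where U: "U > 0" "\<And>t. t \<in> {0..T} \<Longrightarrow> norm (u t) \<le> U" using cu unfolding bounded_pos by auto
  obtain V where V: "V > 0" "\<And>t. t \<in> {0..T} \<Longrightarrow> norm (v t) \<le> V" using cv unfolding bounded_pos by auto
  have wb: "bounded (w ` {0..T})"
  proof (rule boundedI[of _ "M * V * K + U * N * K"], safe)
    fix t assume t: "t \<in> {0..T}"
    have "norm (w t) \<le> norm (u' t) * norm (v t) * K + norm (u t) * norm (v' t) * K"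
      unfolding w_def using K(2)[of "u' t" "v t"] K(2)[of "u t" "v' t"] norm_triangle_ineq[of "p (u' t) (v t)" "p (u t) (v' t)"] by linarith
    also have "\<dots> \<le> M * V * K + U * N * K"
      using t K(1) M N U V by (intro add_mono mult_right_mono mult_mono) (auto intro: less_imp_le)
    finally show "norm (w t) \<le> M * V * K + U * N * K" .
  qed
  define D where "D t = integral {0..t} w - p (u t) (v t)" for t
  have Dq: "norm (D t - D s) \<le> 2 * M * N * K * (t - s)\<^sup>2" if st: "0 \<le> s" "s \<le> t" "t \<le> T" for s t
  proof -
    have ws: "w integrable_on {0..t}" using integrable_on_subinterval[OF wi, of 0 t] st by auto
    have Iw: "(w has_integral (integral {0..t} w - integral {0..s} w)) {s..t}"
      by (rule has_integral_diff_interval[where r = 0])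
        (use st ws integrable_on_subinterval[OF wi, of 0 s] in \<open>auto intro: integrable_integral\<close>)
    \<comment> \<open>Freezing \<open>v\<close> at the right end and \<open>u\<close> at the left
      end gives two exact integrals whose sum telescopes to the increment of the product over the
      interval.\<close>
    have I1: "((\<lambda>\<tau>. p (u' \<tau>) (v t)) has_integral p (u t - u s) (v t)) {s..t}"
      using has_integral_linear[OF rate_on_interval[OF u st] p.bounded_linear_left[of "v t"]] by (simp add: o_def)
    have I2: "((\<lambda>\<tau>. p (u s) (v' \<tau>)) has_integral p (u s) (v t - v s)) {s..t}"
      using has_integral_linear[OF rate_on_interval[OF v st] p.bounded_linear_right[of "u s"]] by (simp add: o_def)
    have I: "((\<lambda>\<tau>. w \<tau> - (p (u' \<tau>) (v t) + p (u s) (v' \<tau>))) has_integral (D t - D s)) {s..t}"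
      using has_integral_diff[OF Iw has_integral_add[OF I1 I2]]
      by (simp add: D_def p.diff_left p.diff_right algebra_simps)
    have b: "norm (w \<tau> - (p (u' \<tau>) (v t) + p (u s) (v' \<tau>))) \<le> 2 * M * N * K * (t - s)" if \<tau>: "\<tau> \<in> {s..t}" for \<tau>
    proof -
      have tt: "\<tau> \<in> {0..T}" using \<tau> st by auto
      have "norm (w \<tau> - (p (u' \<tau>) (v t) + p (u s) (v' \<tau>))) = norm (p (u' \<tau>) (v \<tau> - v t) + p (u \<tau> - u s) (v' \<tau>))"
        by (simp add: w_def p.diff_left p.diff_right algebra_simps)
      also have "\<dots> \<le> norm (u' \<tau>) * norm (v \<tau> - v t) * K + norm (u \<tau> - u s) * norm (v' \<tau>) * K"
        using K(2)[of "u' \<tau>" "v \<tau> - v t"] K(2)[of "u \<tau> - u s" "v' \<tau>"]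
          norm_triangle_ineq[of "p (u' \<tau>) (v \<tau> - v t)" "p (u \<tau> - u s) (v' \<tau>)"] by linarith
      also have "\<dots> \<le> M * (N * (t - s)) * K + (M * (t - s)) * N * K"
      proof (intro add_mono mult_right_mono mult_mono)
        have "norm (v t - v \<tau>) \<le> N * (t - \<tau>)"
          by (rule rate_on_increment_le[OF v N(2)]) (use \<tau> st in auto)
        also have "\<dots> \<le> N * (t - s)" using \<tau> N(1) by simp
        finally show "norm (v \<tau> - v t) \<le> N * (t - s)" by (simp add: norm_minus_commute)
        have "norm (u \<tau> - u s) \<le> M * (\<tau> - s)"
          by (rule rate_on_increment_le[OF u M(2)]) (use \<tau> st in auto)
        also have "\<dots> \<le> M * (t - s)" using \<tau> M(1) by simp
        finally show "norm (u \<tau> - u s) \<le> M * (t - s)" .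
      qed (use tt M N K st in \<open>auto simp: less_imp_le\<close>)
      also have "\<dots> = 2 * M * N * K * (t - s)" by (simp add: algebra_simps)
      finally show ?thesis .
    qed
    have "norm (D t - D s) \<le> 2 * M * N * K * (t - s) * measure lborel (cbox s t)"
    proof (rule has_integral_bound)
      show "0 \<le> 2 * M * N * K * (t - s)" using M N K st by auto
    qed (use I b in auto)
    then show ?thesis using st by (simp add: power2_eq_square algebra_simps)
  qed
  define C where "C = 2 * M * N * K"
  have Dq': "norm (D t - D s) \<le> C * (t - s)\<^sup>2" if "s \<in> {0..T}" "t \<in> {0..T}" for s t
    using Dq[of s t] Dq[of t s] that unfolding C_def
    by (cases "s \<le> t") (auto simp: norm_minus_commute power2_commute)
  have C0: "C > 0" unfolding C_def using M N K by auto
  have Dd: "(D has_derivative (\<lambda>h. 0)) (at s within {0..T})" if s: "s \<in> {0..T}" for s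
    unfolding has_derivative_within_alt
  proof (intro conjI allI impI)
    show "bounded_linear (\<lambda>h. 0)" by (rule bounded_linear_zero)
    fix e :: real assume e: "e > 0"
    show "\<exists>d>0. \<forall>y\<in>{0..T}. norm (y - s) < d \<longrightarrow> norm (D y - D s - 0) \<le> e * norm (y - s)"
    proof (intro exI[of _ "e / C"] conjI ballI impI)
      fix y assume y: "y \<in> {0..T}" "norm (y - s) < e / C"
      have "norm (D y - D s) \<le> C * (y - s)\<^sup>2" using Dq' s y by auto
      also have "\<dots> = (C * \<bar>y - s\<bar>) * \<bar>y - s\<bar>" by (simp add: power2_eq_square abs_mult_self_eq)
      also have "\<dots> \<le> e * \<bar>y - s\<bar>" using y C0 by (intro mult_right_mono) (auto simp: field_simps)
      finally show "norm (D y - D s - 0) \<le> e * norm (y - s)" by simp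
    qed (use e C0 in auto)
  qed
  have Dc: "D t = D 0" if "t \<in> {0..T}" for t
    by (rule has_derivative_zero_unique[OF _ Dd]) (use that in auto)
  have "rate_on T (\<lambda>t. p (u 0) (v 0) + integral {0..t} w) w"
    by (rule rate_on_antiderivative[OF wb wi])
  moreover have "p (u 0) (v 0) + integral {0..t} w = p (u t) (v t)" if "t \<in> {0..T}" for t
    using Dc[OF that] by (simp add: D_def algebra_simps)
  ultimately show ?thesis
    by (subst rate_on_cong[where w' = w]) (auto simp: w_def)
qed

text \<open>The right-hand side of the hypothesis, multiplied by exp (- L t), is nonincreasing: its
  derivative is L exp (- L t) times \<phi> minus that right-hand side.\<close>

lemma integral_gronwall:
  fixes \<phi> :: "real \<Rightarrow> real"
  assumes cont: "continuous_on {0..T} \<phi>" and L: "L \<ge> 0"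
    and le: "\<And>t. t \<in> {0..T} \<Longrightarrow> \<phi> t \<le> c + L * integral {0..t} \<phi>"
    and t: "t \<in> {0..T}"
  shows "\<phi> t \<le> c * exp (L * t)"
proof -
  define q where "q t = exp (- L * t) * (c + L * integral {0..t} \<phi>)" for t
  have "q t \<le> q 0"
  proof (rule DERIV_nonpos_imp_decreasing_open[of 0 t q])
    have ci: "continuous_on {0..T} (\<lambda>t. integral {0..t} \<phi>)"
      by (rule indefinite_integral_continuous_1) (rule integrable_continuous_real[OF cont])
    show "continuous_on {0..t} q" unfolding q_def
      using t by (intro continuous_intros continuous_on_subset[OF ci]) auto
    fix s assume s: "0 < s" "s < t"
    have "((\<lambda>u. integral {0..u} \<phi>) has_vector_derivative \<phi> s) (at s within {0..T})"
      by (rule integral_has_vector_derivative[OF cont]) (use s t in auto)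
    then have d: "((\<lambda>u. integral {0..u} \<phi>) has_real_derivative \<phi> s) (at s)"
      using s t at_within_Icc_at[of 0 s T] by (simp add: has_real_derivative_iff_has_vector_derivative)
    have "(q has_real_derivative (exp (- L * s) * (L * \<phi> s) + exp (- L * s) * (- L) * (c + L * integral {0..s} \<phi>))) (at s)"
      unfolding q_def by (rule derivative_eq_intros d refl | simp)+
    moreover have "exp (- L * s) * (L * \<phi> s) + exp (- L * s) * (- L) * (c + L * integral {0..s} \<phi>)
      = exp (- L * s) * L * (\<phi> s - (c + L * integral {0..s} \<phi>))" by (simp add: algebra_simps)
    moreover have "\<dots> \<le> 0" using le[of s] s t L by (intro mult_nonneg_nonpos) auto
    ultimately show "\<exists>y. (q has_real_derivative y) (at s) \<and> y \<le> 0" by auto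
  qed (use t in auto)
  then have "exp (- L * t) * (c + L * integral {0..t} \<phi>) \<le> c" by (simp add: q_def)
  then have "c + L * integral {0..t} \<phi> \<le> c * exp (L * t)" by (simp add: exp_minus field_simps)
  then show ?thesis using le[OF t] by linarith
qed

text \<open>The norm of \<open>z\<close> need not be differentiable, so the integral form of
  Gronwall is used; the inhomogeneity is bounded crudely over the whole horizon by
  \<open>b * T\<close>.\<close>

lemma rate_on_gronwall:
  assumes r: "rate_on T z w" and L: "L \<ge> 0" and b: "b \<ge> 0"
    and le: "\<And>t. t \<in> {0..T} \<Longrightarrow> norm (w t) \<le> L * norm (z t) + b"
    and t: "t \<in> {0..T}"
  shows "norm (z t) \<le> (norm (z 0) + b * T) * exp (L * t)"
proof (rule integral_gronwall[of T "\<lambda>t. norm (z t)" L])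
  have cz: "continuous_on {0..T} (\<lambda>t. norm (z t))" by (intro continuous_intros rate_on_continuous[OF r])
  then show "continuous_on {0..T} (\<lambda>t. norm (z t))" .
  fix s assume s: "s \<in> {0..T}"
  have ig: "(\<lambda>t. norm (z t)) integrable_on {0..s}"
    by (rule integrable_continuous_real) (rule continuous_on_subset[OF cz], use s in auto)
  have i: "w integrable_on {0..s}" "integral {0..s} w = z s - z 0"
    using rate_on_interval[OF r, of 0 s] s by (auto simp: has_integral_iff)
  have "norm (integral {0..s} w) \<le> integral {0..s} (\<lambda>t. L * norm (z t) + b)"
    by (rule integral_norm_bound_integral)
      (use i s le in \<open>auto intro!: integrable_add integrable_on_mult_right ig\<close>)
  also have "\<dots> = L * integral {0..s} (\<lambda>t. norm (z t)) + b * s"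
    by (subst integral_add) (use ig s in \<open>auto intro!: integrable_on_mult_right\<close>)
  finally have "norm (z s - z 0) \<le> L * integral {0..s} (\<lambda>t. norm (z t)) + b * s" by (simp add: i)
  moreover have "b * s \<le> b * T" using s b by (intro mult_left_mono) auto
  moreover have "norm (z s) \<le> norm (z 0) + norm (z s - z 0)" by (metis norm_triangle_sub)
  ultimately show "norm (z s) \<le> norm (z 0) + b * T + L * integral {0..s} (\<lambda>t. norm (z t))" by linarith
qed (use assms in auto)

text \<open>Turns a priori estimates that presuppose confinement into confinement. At the first time
  outside the interior, the earlier values lie in the interior, so by continuity the curve has been
  in \<open>K\<close> up to and including that time, and \<open>step\<close> contradicts the
  exit.\<close>

lemma stays_in_interior:
  fixes z :: "real \<Rightarrow> 'a::euclidean_space"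
  assumes cont: "continuous_on {0..T} z" and K: "closed K" and z0: "z 0 \<in> K"
    and step: "\<And>\<tau>. \<tau> \<in> {0..T} \<Longrightarrow> (\<And>t. t \<in> {0..\<tau>} \<Longrightarrow> z t \<in> K) \<Longrightarrow> z \<tau> \<in> interior K"
    and t: "t \<in> {0..T}"
  shows "z t \<in> interior K"
proof (rule ccontr)
  assume nt: "z t \<notin> interior K"
  define B where "B = {s \<in> {0..T}. z s \<in> - interior K}"
  have "closed ({0..T} \<inter> z -` (- interior K))"
    by (rule continuous_closed_preimage[OF cont]) auto
  moreover have "{0..T} \<inter> z -` (- interior K) = B" by (auto simp: B_def)
  ultimately have "closed B" by simp
  moreover have "B \<noteq> {}" "bdd_below B" using t nt by (auto simp: B_def intro: bdd_belowI[of _ 0])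
  ultimately have iB: "Inf B \<in> B" by (intro closed_contains_Inf)
  define \<tau> where "\<tau> = Inf B"
  have \<tau>: "\<tau> \<in> {0..T}" "z \<tau> \<notin> interior K" using iB by (auto simp: B_def \<tau>_def)
  have before: "z s \<in> interior K" if "s \<in> {0..<\<tau>}" for s
  proof (rule ccontr)
    assume "z s \<notin> interior K"
    then have "s \<in> B" using that \<tau> by (auto simp: B_def)
    then have "\<tau> \<le> s" unfolding \<tau>_def using \<open>bdd_below B\<close> by (rule cInf_lower)
    then show False using that by auto
  qed
  have "z s \<in> K" if s: "s \<in> {0..\<tau>}" for s
  proof (cases "\<tau> = 0")
    \<comment> \<open>At \<tau> = 0 there is no earlier time to take limits from; here the initial
      condition has to help.\<close>
    case True then show ?thesis using z0 s by auto
  next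
    case False
    then have cl: "closure {0..<\<tau>} = {0..\<tau>}" using \<tau> by (intro closure_atLeastLessThan) auto
    have "z ` closure {0..<\<tau>} \<subseteq> K"
      by (rule image_closure_subset[OF _ K])
        (use before interior_subset[of K] cl \<tau> in \<open>auto intro: continuous_on_subset[OF cont]\<close>)
    then show ?thesis using s cl by auto
  qed
  then show False using step[OF \<tau>(1)] \<tau>(2) by blast
qed

section \<open>Global solutions driven by measurable noise\<close>

text \<open>McShane's extension: \<open>g x = inf\<^sub>y (f y + L dist x y)\<close>.\<close>

lemma lipschitz_extension_real:
  fixes f :: "'a::metric_space \<Rightarrow> real"
  assumes f: "L-lipschitz_on Z f"
  shows "\<exists>g. L-lipschitz_on UNIV g \<and> (\<forall>x\<in>Z. g x = f x)"
proof (cases "Z = {}")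
  case True
  then show ?thesis using lipschitz_on_nonneg[OF f] by (auto intro!: exI[of _ "\<lambda>_. 0"] lipschitz_onI)
next
  case False
  then obtain y0 where y0: "y0 \<in> Z" by blast
  have L: "L \<ge> 0" using lipschitz_on_nonneg[OF f] .
  have fL: "f x - f y \<le> L * dist x y" if "x \<in> Z" "y \<in> Z" for x y
    using lipschitz_onD[OF f that] by (simp add: dist_real_def)
  have bd: "bdd_below ((\<lambda>y. f y + L * dist x y) ` Z)" for x
  proof (rule bdd_belowI2[where m = "f y0 - L * dist x y0"])
    fix y assume "y \<in> Z"
    have "L * dist y0 y \<le> L * (dist x y0 + dist x y)"
      using L by (intro mult_left_mono) (auto intro: dist_triangle3)
    then show "f y0 - L * dist x y0 \<le> f y + L * dist x y"
      using fL[OF y0 \<open>y \<in> Z\<close>] by (simp add: algebra_simps)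
  qed
  define g where "g x = (INF y\<in>Z. f y + L * dist x y)" for x
  have g1: "g x \<le> g x' + L * dist x x'" for x x'
  proof -
    have "g x - L * dist x x' \<le> g x'"
      unfolding g_def[of x']
    proof (rule cINF_greatest[OF False])
      fix y assume y: "y \<in> Z"
      have "g x \<le> f y + L * dist x y" unfolding g_def by (rule cINF_lower[OF bd y])
      also have "\<dots> \<le> f y + L * (dist x x' + dist x' y)"
        using L by (intro add_left_mono mult_left_mono dist_triangle)
      finally show "g x - L * dist x x' \<le> f y + L * dist x' y" by (simp add: algebra_simps)
    qed
    then show ?thesis by simp
  qed
  have "L-lipschitz_on UNIV g"
  proof (rule lipschitz_onI)
    fix x y show "dist (g x) (g y) \<le> L * dist x y"
      using g1[of x y] g1[of y x] by (simp add: dist_real_def dist_commute abs_le_iff)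
  qed (rule L)
  moreover have "g x = f x" if x: "x \<in> Z" for x
  proof (rule antisym)
    show "g x \<le> f x" unfolding g_def using cINF_lower[OF bd x, of x] by simp
    show "f x \<le> g x" unfolding g_def
      by (rule cINF_greatest[OF False]) (use fL[OF x] in \<open>simp add: algebra_simps\<close>)
  qed
  ultimately show ?thesis by blast
qed

text \<open>The real extension is applied to each component. The constant grows by the dimension,
  which is harmless because only some global constant is wanted.\<close>

lemma lipschitz_extension:
  fixes f :: "'a::metric_space \<Rightarrow> 'b::euclidean_space"
  assumes f: "L-lipschitz_on Z f"
  obtains g M where "M-lipschitz_on UNIV g" "\<And>x. x \<in> Z \<Longrightarrow> g x = f x"
proof -
  have L: "L \<ge> 0" using lipschitz_on_nonneg[OF f] .
  have "\<exists>g. L-lipschitz_on UNIV g \<and> (\<forall>x\<in>Z. g x = f x \<bullet> b)" if b: "b \<in> Basis" for b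
  proof (rule lipschitz_extension_real, rule lipschitz_onI)
    fix x y assume "x \<in> Z" "y \<in> Z"
    then have "\<bar>(f x - f y) \<bullet> b\<bar> \<le> L * dist x y"
      using Basis_le_norm[OF b, of "f x - f y"] lipschitz_onD[OF f, of x y] by (auto simp: dist_norm)
    then show "dist (f x \<bullet> b) (f y \<bullet> b) \<le> L * dist x y" by (simp add: dist_real_def inner_diff_left)
  qed (rule L)
  then obtain g where g: "\<And>b. b \<in> Basis \<Longrightarrow> L-lipschitz_on UNIV (g b)"
    "\<And>b x. b \<in> Basis \<Longrightarrow> x \<in> Z \<Longrightarrow> g b x = f x \<bullet> b" by metis
  show ?thesis
  proof (rule that[of "real DIM('b) * L" "\<lambda>x. \<Sum>b\<in>Basis. g b x *\<^sub>R b"])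
    show "(real DIM('b) * L)-lipschitz_on UNIV (\<lambda>x. \<Sum>b\<in>Basis. g b x *\<^sub>R b)"
    proof (rule lipschitz_onI)
      fix x y :: 'a
      have "norm (\<Sum>b\<in>Basis. (g b x - g b y) *\<^sub>R (b::'b)) \<le> (\<Sum>b\<in>(Basis::'b set). L * dist x y)"
        by (rule sum_norm_le) (use lipschitz_onD[OF g(1)] in \<open>auto simp: dist_real_def\<close>)
      then show "dist (\<Sum>b\<in>Basis. g b x *\<^sub>R (b::'b)) (\<Sum>b\<in>Basis. g b y *\<^sub>R b) \<le> real DIM('b) * L * dist x y"
        by (simp add: dist_norm scaleR_diff_left sum_subtractf)
    qed (use L in auto)
    fix x assume "x \<in> Z"
    then have "(\<Sum>b\<in>Basis. g b x *\<^sub>R b) = (\<Sum>b\<in>Basis. (f x \<bullet> b) *\<^sub>R b)" using g(2) by auto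
    then show "(\<Sum>b\<in>Basis. g b x *\<^sub>R b) = f x" by (simp add: euclidean_representation)
  qed
qed

text \<open>Bounded continuous functions live on the whole line, so the Picard integral is continued
  to negative times as a constant.\<close>

lemma continuous_on_integral_max:
  fixes F :: "real \<Rightarrow> 'a::euclidean_space"
  assumes "\<And>t. t \<ge> 0 \<Longrightarrow> F integrable_on {0..t}"
  shows "continuous_on UNIV (\<lambda>t. integral {0..max 0 t} F)"
  unfolding continuous_on_eq_continuous_within
proof
  fix t :: real
  have "continuous_on {..\<bar>t\<bar> + 1} (\<lambda>t. integral {0..max 0 t} F)"
    by (rule continuous_on_compose2[of "{0..\<bar>t\<bar> + 1}" "\<lambda>t. integral {0..t} F"])
      (auto intro!: indefinite_integral_continuous_1 assms continuous_intros)
  then show "continuous (at t) (\<lambda>t. integral {0..max 0 t} F)"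
    by (rule continuous_on_interior) auto
qed

lemma integral_exp_mult:
  fixes c :: real assumes "c \<noteq> 0" "t \<ge> 0"
  shows "((\<lambda>s. exp (c * s)) has_integral (exp (c * t) - 1) / c) {0..t}"
proof -
  have "((\<lambda>s. exp (c * s)) has_integral (exp (c * t) / c - exp (c * 0) / c)) {0..t}"
    by (rule fundamental_theorem_of_calculus)
      (use assms in \<open>auto intro!: derivative_eq_intros simp: has_real_derivative_iff_has_vector_derivative[symmetric]\<close>)
  then show ?thesis by (simp add: diff_divide_distrib)
qed

text \<open>In the norm weighted by \<open>exp (- 2 L t)\<close> the Picard operator is a contraction on the
  whole half line.\<close>

lemma picard_global:
  fixes G :: "real \<Rightarrow> 'a::euclidean_space \<Rightarrow> 'a"
  assumes L: "L > 0" and lip: "\<And>t x y. t \<ge> 0 \<Longrightarrow> norm (G t x - G t y) \<le> L * norm (x - y)"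
    and int: "\<And>z t. continuous_on UNIV z \<Longrightarrow> t \<ge> 0 \<Longrightarrow> (\<lambda>s. G s (z s)) integrable_on {0..t}"
    and M: "M \<ge> 0" and bd: "\<And>t. t \<ge> 0 \<Longrightarrow> norm (G t 0) \<le> M"
  obtains z where "continuous_on UNIV z" "\<And>t. t \<ge> 0 \<Longrightarrow> z t = z0 + integral {0..t} (\<lambda>s. G s (z s))"
proof -
  \<comment> \<open>With twice the Lipschitz constant in the exponent the contraction factor is L /
    (2 L) = 1/2.\<close>
  define c where "c = 2 * L"
  have c: "c > 0" using L by (simp add: c_def)
  define ex where "ex t = exp (c * max 0 t)" for t
  have cex: "continuous_on UNIV ex" unfolding ex_def by (intro continuous_intros)
  \<comment> \<open>The unknown \<open>w\<close> is the curve divided by the weight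
    \<open>ex\<close>; this places the fixed point problem among bounded continuous
    functions.\<close>
  define W where "W w t = ex t *\<^sub>R apply_bcontfun w t" for w :: "real \<Rightarrow>\<^sub>C 'a" and t
  have cW: "continuous_on UNIV (W w)" for w
    unfolding W_def by (intro continuous_intros cex) auto
  define I where "I w t = integral {0..max 0 t} (\<lambda>s. G s (W w s))" for w t
  have Ib: "norm (I w t - I w' t) \<le> dist w w' / 2 * ex t" for w w' t
  proof -
    define u where "u = max 0 t"
    have u: "u \<ge> 0" by (simp add: u_def)
    have e: "((\<lambda>s. L * dist w w' * exp (c * s)) has_integral L * dist w w' * ((exp (c * u) - 1) / c)) {0..u}"
      by (intro has_integral_mult_right integral_exp_mult) (use c u in auto)
    have "norm (integral {0..u} (\<lambda>s. G s (W w s) - G s (W w' s))) \<le> integral {0..u} (\<lambda>s. L * dist w w' * exp (c * s))"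
    proof (rule integral_norm_bound_integral)
      fix s assume s: "s \<in> {0..u}"
      have "norm (G s (W w s) - G s (W w' s)) \<le> L * norm (W w s - W w' s)" using s by (intro lip) auto
      also have "\<dots> = L * (dist (apply_bcontfun w s) (apply_bcontfun w' s) * exp (c * s))"
        using s by (simp add: W_def ex_def scaleR_diff_right[symmetric] dist_norm mult.commute)
      also have "\<dots> \<le> L * (dist w w' * exp (c * s))"
        using L by (intro mult_left_mono mult_right_mono dist_bounded) auto
      finally show "norm (G s (W w s) - G s (W w' s)) \<le> L * dist w w' * exp (c * s)" by simp
    qed (use e in \<open>auto intro!: integrable_diff int cW u\<close>)
    also have "\<dots> = dist w w' / 2 * (exp (c * u) - 1)" using L by (subst integral_unique[OF e]) (simp add: c_def)
    also have "\<dots> \<le> dist w w' / 2 * exp (c * u)" by (intro mult_left_mono) auto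
    finally show ?thesis unfolding I_def ex_def u_def[symmetric]
      by (subst (asm) integral_diff) (auto intro!: int cW u)
  qed
  define S where "S w t = (z0 + I w t) /\<^sub>R ex t" for w t
  have ex0: "ex t > 0" for t by (simp add: ex_def)
  \<comment> \<open>The image of zero grows at most linearly, which the weight absorbs. With
    \<open>Ib\<close> this shows that the operator maps into bounded functions.\<close>
  have I0: "norm (I 0 t) \<le> M / c * ex t" for t
  proof -
    define u where "u = max 0 t"
    have u: "u \<ge> 0" by (simp add: u_def)
    have "norm (integral {0..u} (\<lambda>s. G s (W 0 s))) \<le> integral {0..u} (\<lambda>s. M)"
      by (rule integral_norm_bound_integral) (auto intro!: int cW u simp: W_def bd)
    also have "\<dots> = M * u" using u by simp
    also have "\<dots> = M / c * (c * u)" using c by simp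
    also have "\<dots> \<le> M / c * exp (c * u)"
    proof (intro mult_left_mono)
      show "c * u \<le> exp (c * u)" using exp_ge_add_one_self[of "c * u"] by linarith
    qed (use c M in auto)
    finally show ?thesis by (simp add: I_def ex_def u_def)
  qed
  have Sb: "S w \<in> bcontfun" for w
  proof (rule bcontfun_normI)
    show "continuous_on UNIV (S w)"
      unfolding S_def I_def using ex0
      by (intro continuous_intros continuous_on_integral_max int cW cex) (auto simp: less_imp_neq[symmetric])
    fix t
    have "norm (z0 + I w t) \<le> norm z0 + (norm (I 0 t) + norm (I w t - I 0 t))"
      by (metis (no_types, opaque_lifting) add.commute diff_add_cancel norm_triangle_mono order_refl norm_triangle_ineq)
    also have "\<dots> \<le> norm z0 * ex t + (M / c * ex t + dist w 0 / 2 * ex t)"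
    proof (intro add_mono I0 Ib)
      have "ex t \<ge> 1" by (simp add: ex_def c less_imp_le)
      then show "norm z0 \<le> norm z0 * ex t" by (simp add: mult_le_cancel_left1)
    qed
    also have "\<dots> = (norm z0 + M / c + dist w 0 / 2) * ex t" by (simp add: algebra_simps)
    finally show "norm (S w t) \<le> norm z0 + M / c + dist w 0 / 2"
      using ex0[of t] unfolding S_def norm_scaleR
      by (simp add: divide_inverse[symmetric] pos_divide_le_eq mult.commute[of "inverse (ex t)"] del: scaleR_add_right)
  qed
  have Sa: "apply_bcontfun (Bcontfun (S w)) t = S w t" for w t
    using Bcontfun_inverse[OF Sb] by simp
  have "\<exists>!w. Bcontfun (S w) = w"
  proof (rule banach_fix_type)
    show "\<forall>x y. dist (Bcontfun (S x)) (Bcontfun (S y)) \<le> (1/2) * dist x y"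
    proof (intro allI dist_bound)
      fix x y t
      have "dist (S x t) (S y t) = norm (I x t - I y t) / ex t"
        using ex0[of t] unfolding S_def dist_norm scaleR_diff_right[symmetric] norm_scaleR
        by (simp add: divide_inverse mult.commute)
      also have "\<dots> \<le> 1/2 * dist x y" using Ib[of x t y] ex0[of t] by (simp add: field_simps)
      finally show "dist (apply_bcontfun (Bcontfun (S x)) t) (apply_bcontfun (Bcontfun (S y)) t) \<le> 1/2 * dist x y"
        by (simp add: Sa)
    qed
  qed auto
  then obtain w where w: "Bcontfun (S w) = w" by blast
  show ?thesis
  proof (rule that[of "W w"])
    show "continuous_on UNIV (W w)" by (rule cW)
    fix t :: real assume t: "t \<ge> 0"
    have "W w t = ex t *\<^sub>R S w t" using Sa[of w t] w by (simp add: W_def)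
    also have "\<dots> = z0 + I w t" using ex0[of t] by (simp add: S_def)
    finally show "W w t = z0 + integral {0..t} (\<lambda>s. G s (W w s))" using t by (simp add: I_def)
  qed
qed

lemma noise_absolutely_integrable:
  fixes \<nu> :: "real \<Rightarrow> real"
  assumes "\<nu> \<in> borel_measurable (lebesgue_on {0..})" "\<And>t. t \<ge> 0 \<Longrightarrow> \<bar>\<nu> t\<bar> \<le> N"
  shows "\<nu> absolutely_integrable_on {0..t}"
proof (rule measurable_bounded_by_integrable_imp_absolutely_integrable[where g = "\<lambda>_. N"])
  show "\<nu> \<in> borel_measurable (lebesgue_on {0..t})"
    by (rule measurable_restrict_mono[OF assms(1)]) auto
qed (use assms in auto)

text \<open>The noise enters affinely: along a continuous curve a measurable bounded function is
  then multiplied by a continuous one, so the rate stays integrable, as the Picard iteration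
  requires.\<close>

lemma noise_driven_solution:
  fixes G0 G1 :: "'a::euclidean_space \<Rightarrow> 'a"
  assumes l0: "L0-lipschitz_on UNIV G0" and l1: "L1-lipschitz_on UNIV G1"
    and \<nu>: "\<nu> \<in> borel_measurable (lebesgue_on {0..})" "\<And>t. t \<ge> 0 \<Longrightarrow> \<bar>\<nu> t\<bar> \<le> N"
  obtains z where "z 0 = z0" "\<And>T. rate_on T z (\<lambda>t. G0 (z t) + \<nu> t *\<^sub>R G1 (z t))"
proof -
  define G where "G t x = G0 x + \<nu> t *\<^sub>R G1 x" for t x
  have N: "N \<ge> 0" using \<nu>(2)[of 0] by linarith
  have L0: "L0 \<ge> 0" and L1: "L1 \<ge> 0" using l0 l1 lipschitz_on_nonneg by blast+
  \<comment> \<open>The summand 1 makes the constant strictly positive, so that it can be passed to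
    \<open>picard_global\<close>.\<close>
  have Glip: "norm (G t x - G t y) \<le> (L0 + N * L1 + 1) * norm (x - y)" if "t \<ge> 0" for t x y
  proof -
    have "norm (G t x - G t y) = norm ((G0 x - G0 y) + \<nu> t *\<^sub>R (G1 x - G1 y))"
      by (simp add: G_def algebra_simps)
    also have "\<dots> \<le> norm (G0 x - G0 y) + \<bar>\<nu> t\<bar> * norm (G1 x - G1 y)"
      by (metis norm_scaleR norm_triangle_ineq)
    also have "\<dots> \<le> L0 * norm (x - y) + N * (L1 * norm (x - y))"
      using lipschitz_onD[OF l0, of x y] lipschitz_onD[OF l1, of x y] \<nu>(2)[OF that] N
      by (intro add_mono mult_mono) (auto simp: dist_norm)
    also have "\<dots> \<le> (L0 + N * L1 + 1) * norm (x - y)" by (simp add: algebra_simps)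
    finally show ?thesis .
  qed
  have c0: "continuous_on S (\<lambda>s. G0 (z s))" "continuous_on S (\<lambda>s. G1 (z s))" if "continuous_on S z" for S z
    using continuous_on_compose2[OF lipschitz_on_continuous_on[OF l0] that]
      continuous_on_compose2[OF lipschitz_on_continuous_on[OF l1] that] by auto
  have Gint: "(\<lambda>s. G s (z s)) integrable_on {0..t}" if "continuous_on {0..t} z" for z t
    unfolding G_def
  proof (rule integrable_add)
    show "(\<lambda>s. G0 (z s)) integrable_on {0..t}"
      by (rule integrable_continuous_real) (rule c0[OF that])
    have "(\<lambda>s. \<nu> s *\<^sub>R G1 (z s)) absolutely_integrable_on {0..t}"
      by (rule absolutely_integrable_bilinear_continuous[OF bounded_bilinear_scaleR])
        (use noise_absolutely_integrable[OF \<nu>] c0[OF that] in auto)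
    then show "(\<lambda>s. \<nu> s *\<^sub>R G1 (z s)) integrable_on {0..t}" by (simp add: absolutely_integrable_on_def)
  qed
  obtain z where z: "continuous_on UNIV z" "\<And>t. t \<ge> 0 \<Longrightarrow> z t = z0 + integral {0..t} (\<lambda>s. G s (z s))"
  proof (rule picard_global[of "L0 + N * L1 + 1" G "norm (G0 0) + N * norm (G1 0)" z0])
    show "norm (G t 0) \<le> norm (G0 0) + N * norm (G1 0)" if "t \<ge> 0" for t
    proof -
      have "norm (G t 0) \<le> norm (G0 0) + \<bar>\<nu> t\<bar> * norm (G1 0)"
        unfolding G_def by (metis norm_scaleR norm_triangle_ineq)
      also have "\<dots> \<le> norm (G0 0) + N * norm (G1 0)" using \<nu>(2)[OF that] by (simp add: mult_right_mono)
      finally show ?thesis .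
    qed
    show "(\<lambda>s. G s (z s)) integrable_on {0..t}" if "continuous_on UNIV z" for z t
      by (rule Gint) (use that continuous_on_subset in blast)
  qed (use Glip L0 L1 N in \<open>auto intro!: add_nonneg_pos add_nonneg_nonneg\<close>)
  show ?thesis
  proof (rule that[of z])
    show z0: "z 0 = z0" using z(2)[of 0] by simp
    fix T
    have "rate_on T (\<lambda>t. z0 + integral {0..t} (\<lambda>s. G s (z s))) (\<lambda>s. G s (z s))"
    proof (rule rate_on_antiderivative)
      show "(\<lambda>s. G s (z s)) integrable_on {0..T}"
        by (rule Gint) (use z(1) continuous_on_subset in blast)
      have cz: "continuous_on {0..T} z" using z(1) continuous_on_subset by blast
      have "bounded ((\<lambda>s. \<nu> s *\<^sub>R G1 (z s)) ` {0..T})"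
      proof -
        obtain B where B: "B > 0" "\<And>s. s \<in> {0..T} \<Longrightarrow> norm (G1 (z s)) \<le> B"
          using compact_imp_bounded[OF compact_continuous_image[OF c0(2)[OF cz]]] unfolding bounded_pos by auto
        show ?thesis
          by (rule boundedI[of _ "N * B"]) (use B \<nu>(2) N in \<open>auto intro!: mult_mono\<close>)
      qed
      moreover have "bounded ((\<lambda>s. G0 (z s)) ` {0..T})"
        by (intro compact_imp_bounded compact_continuous_image c0[OF cz]) auto
      ultimately show "bounded ((\<lambda>s. G s (z s)) ` {0..T})" unfolding G_def by (intro bounded_plus_comp)
    qed
    then show "rate_on T z (\<lambda>t. G0 (z t) + \<nu> t *\<^sub>R G1 (z t))"
      by (subst rate_on_cong[where z' = "\<lambda>t. z0 + integral {0..t} (\<lambda>s. G s (z s))" and w' = "\<lambda>s. G s (z s)"])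
        (use z(2) in \<open>auto simp: G_def\<close>)
  qed
qed

text \<open>The hypothesis \<open>apriori\<close> speaks of the original fields: on any initial
  interval spent in \<open>Z\<close> they agree with their global extensions, so the estimate
  applies to the solution of the extended equation.\<close>

lemma noise_driven_solution_in_compact:
  fixes G0 G1 :: "'a::euclidean_space \<Rightarrow> 'a"
  assumes Z: "compact Z" "z0 \<in> Z"
    and l0: "L0-lipschitz_on Z G0" and l1: "L1-lipschitz_on Z G1"
    and \<nu>: "\<nu> \<in> borel_measurable (lebesgue_on {0..})" "\<And>t. t \<ge> 0 \<Longrightarrow> \<bar>\<nu> t\<bar> \<le> N"
    and apriori: "\<And>T z. T \<ge> 0 \<Longrightarrow> z 0 = z0 \<Longrightarrow> rate_on T z (\<lambda>t. G0 (z t) + \<nu> t *\<^sub>R G1 (z t)) \<Longrightarrow>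
       (\<And>t. t \<in> {0..T} \<Longrightarrow> z t \<in> Z) \<Longrightarrow> z T \<in> interior Z"
  obtains z where "z 0 = z0" "\<And>t. t \<ge> 0 \<Longrightarrow> z t \<in> Z" "\<And>T. rate_on T z (\<lambda>t. G0 (z t) + \<nu> t *\<^sub>R G1 (z t))"
proof -
  obtain H0 M0 where H0: "M0-lipschitz_on UNIV H0" "\<And>x. x \<in> Z \<Longrightarrow> H0 x = G0 x" using lipschitz_extension[OF l0] by blast
  obtain H1 M1 where H1: "M1-lipschitz_on UNIV H1" "\<And>x. x \<in> Z \<Longrightarrow> H1 x = G1 x" using lipschitz_extension[OF l1] by blast
  obtain z where z: "z 0 = z0" "\<And>T. rate_on T z (\<lambda>t. H0 (z t) + \<nu> t *\<^sub>R H1 (z t))"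
    using noise_driven_solution[OF H0(1) H1(1) \<nu>] by blast
  have eq: "rate_on T z (\<lambda>t. G0 (z t) + \<nu> t *\<^sub>R G1 (z t))" if "\<And>t. t \<in> {0..T} \<Longrightarrow> z t \<in> Z" for T
    by (rule iffD1[OF rate_on_cong z(2)[of T]]) (use that H0(2) H1(2) in auto)
  have inZ: "z t \<in> Z" if "t \<ge> 0" for t
  proof -
    have "z t \<in> interior Z"
    proof (rule stays_in_interior[of t z])
      show "continuous_on {0..t} z" by (rule rate_on_continuous[OF z(2)])
      show "z \<tau> \<in> interior Z" if "\<tau> \<in> {0..t}" "\<And>s. s \<in> {0..\<tau>} \<Longrightarrow> z s \<in> Z" for \<tau>
        by (rule apriori[OF _ z(1) eq]) (use that in auto)
    qed (use Z z that in \<open>auto intro: compact_imp_closed\<close>)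
    then show ?thesis using interior_subset by blast
  qed
  show ?thesis by (rule that[OF z(1) inZ eq]) (use inZ in auto)
qed

section \<open>Decay of Hurwitz chains\<close>

text \<open>Variation of constants with the factor exp (- l t). At resonance the convolution of two
  exponentials would carry a factor t, so the rate is capped at half of \<open>- Re l\<close>; the
  exponent that is integrated is then at least half of \<open>- Re l\<close>, which yields the
  factor \<open>2 / (- Re l)\<close>.\<close>

lemma scalar_decay:
  fixes v r :: "real \<Rightarrow> complex"
  assumes r: "rate_on T v (\<lambda>t. l * v t + r t)" and l: "Re l < 0" and a0: "a0 > 0"
    and W: "W \<ge> 0" and \<delta>: "\<delta> \<ge> 0"
    and rb: "\<And>t. t \<in> {0..T} \<Longrightarrow> norm (r t) \<le> W * exp (- a0 * t) + \<delta>"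
    and v0: "norm (v 0) \<le> W" and t: "t \<in> {0..T}"
  shows "norm (v t) \<le> (1 + 2 / (- Re l)) * (W * exp (- min a0 (- Re l / 2) * t) + \<delta>)"
proof -
  define \<rho> where "\<rho> = - Re l"
  define a where "a = min a0 (\<rho> / 2)"
  have \<rho>: "\<rho> > 0" using l by (simp add: \<rho>_def)
  have a: "a > 0" "a \<le> a0" "a \<le> \<rho> / 2" using a0 \<rho> by (auto simp: a_def)
  define E where "E t = exp (- l * complex_of_real t)" for t
  have nE: "norm (E s) = exp (\<rho> * s)" for s by (simp add: E_def \<rho>_def norm_exp_eq_Re)
  have rE: "rate_on T E (\<lambda>t. - l * E t)"
  proof (rule rate_on_has_vector_derivative)
    show "continuous_on {0..T} (\<lambda>t. - l * E t)" unfolding E_def by (intro continuous_intros)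
    fix s assume "s \<in> {0..T}"
    have "((\<lambda>z. exp (- l * z)) has_field_derivative (- l * E s)) (at (complex_of_real s))"
      unfolding E_def by (auto intro!: derivative_eq_intros)
    then have "((\<lambda>z. exp (- l * complex_of_real z)) has_vector_derivative (- l * E s)) (at s)"
      by (rule has_vector_derivative_real_field)
    then show "(E has_vector_derivative - l * E s) (at s within {0..T})"
      unfolding E_def by (rule has_vector_derivative_at_within)
  qed
  define u where "u t = E t * v t" for t
  have "rate_on T u (\<lambda>t. (- l * E t) * v t + E t * (l * v t + r t))"
    unfolding u_def by (rule rate_on_bilinear[OF bounded_bilinear_mult rE r])
  then have ru: "rate_on T u (\<lambda>t. E t * r t)" by (simp add: algebra_simps)
  have Iu: "((\<lambda>t. E t * r t) has_integral (u t - u 0)) {0..t}"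
    using rate_on_interval[OF ru, of 0 t] t by auto
  have I: "((\<lambda>s. W * exp ((\<rho> - a) * s) + \<delta> * exp (\<rho> * s)) has_integral
      (W * ((exp ((\<rho> - a) * t) - 1) / (\<rho> - a)) + \<delta> * ((exp (\<rho> * t) - 1) / \<rho>))) {0..t}"
    by (intro has_integral_add has_integral_mult_right integral_exp_mult) (use a \<rho> t in auto)
  have "norm (integral {0..t} (\<lambda>t. E t * r t)) \<le> integral {0..t} (\<lambda>s. W * exp ((\<rho> - a) * s) + \<delta> * exp (\<rho> * s))"
  proof (rule integral_norm_bound_integral)
    fix s assume s: "s \<in> {0..t}"
    have "norm (E s * r s) \<le> exp (\<rho> * s) * (W * exp (- a0 * s) + \<delta>)"
      unfolding norm_mult nE using rb[of s] s t by (intro mult_left_mono) auto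
    also have "\<dots> \<le> exp (\<rho> * s) * (W * exp (- a * s) + \<delta>)"
      using a W s by (intro mult_left_mono add_right_mono) (auto intro!: mult_right_mono)
    also have "\<dots> = W * exp ((\<rho> - a) * s) + \<delta> * exp (\<rho> * s)"
      by (simp add: algebra_simps exp_diff exp_minus divide_inverse)
    finally show "norm (E s * r s) \<le> W * exp ((\<rho> - a) * s) + \<delta> * exp (\<rho> * s)" .
  qed (use Iu I in auto)
  then have "norm (u t - u 0) \<le> W * ((exp ((\<rho> - a) * t) - 1) / (\<rho> - a)) + \<delta> * ((exp (\<rho> * t) - 1) / \<rho>)"
    using integral_unique[OF Iu] integral_unique[OF I] by simp
  also have "\<dots> \<le> W * (exp ((\<rho> - a) * t) * (2 / \<rho>)) + \<delta> * (exp (\<rho> * t) * (2 / \<rho>))"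
  proof (intro add_mono mult_left_mono W \<delta>)
    have "(exp ((\<rho> - a) * t) - 1) / (\<rho> - a) \<le> exp ((\<rho> - a) * t) / (\<rho> - a)"
      using a \<rho> by (intro divide_right_mono) auto
    also have "\<dots> \<le> exp ((\<rho> - a) * t) / (\<rho> / 2)"
      using a \<rho> by (intro divide_left_mono) auto
    finally show "(exp ((\<rho> - a) * t) - 1) / (\<rho> - a) \<le> exp ((\<rho> - a) * t) * (2 / \<rho>)" by simp
    have "exp (\<rho> * t) - 1 \<le> exp (\<rho> * t) * 2"
      using exp_ge_zero[of "\<rho> * t"] by linarith
    then show "(exp (\<rho> * t) - 1) / \<rho> \<le> exp (\<rho> * t) * (2 / \<rho>)"
      using \<rho> by (simp add: field_simps)
  qed
  finally have d: "norm (u t - u 0) \<le> W * (exp ((\<rho> - a) * t) * (2 / \<rho>)) + \<delta> * (exp (\<rho> * t) * (2 / \<rho>))" .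
  have u0: "norm (u 0) \<le> W" using v0 by (simp add: u_def E_def)
  have "exp (\<rho> * t) * norm (v t) = norm (u t)" by (simp add: u_def norm_mult nE)
  also have "\<dots> \<le> norm (u 0) + norm (u t - u 0)" by (metis norm_triangle_sub)
  also have "\<dots> \<le> W * exp ((\<rho> - a) * t) + (W * (exp ((\<rho> - a) * t) * (2 / \<rho>)) + \<delta> * (exp (\<rho> * t) * (2 / \<rho>)))"
  proof (intro add_mono d order_trans[OF u0])
    show "W \<le> W * exp ((\<rho> - a) * t)" using W a \<rho> t by (intro mult_le_cancel_left1[THEN iffD2]) auto
  qed
  also have "\<dots> \<le> W * exp ((\<rho> - a) * t) * (1 + 2 / \<rho>) + \<delta> * exp (\<rho> * t) * (1 + 2 / \<rho>)"
    using \<delta> by (simp add: algebra_simps)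
  also have "\<dots> = exp (\<rho> * t) * ((1 + 2 / \<rho>) * (W * exp (- a * t) + \<delta>))"
    by (simp add: algebra_simps exp_diff exp_minus divide_inverse)
  finally have "norm (v t) \<le> (1 + 2 / \<rho>) * (W * exp (- a * t) + \<delta>)" by simp
  then show ?thesis by (simp add: \<rho>_def a_def)
qed

text \<open>The monic polynomial of degree n with coefficient \<open>c i\<close> at degree n - i.
  Numbering the coefficients from the top makes the values for growing n at a fixed point the
  successive stages of Horner's scheme.\<close>

definition horner :: "(nat \<Rightarrow> 'a::comm_ring_1) \<Rightarrow> nat \<Rightarrow> 'a \<Rightarrow> 'a" where
  "horner c n s = s ^ n + (\<Sum>i=1..n. c i * s ^ (n - i))"

lemma horner_0: "horner c 0 s = 1"
  and horner_Suc: "horner c (Suc n) s = s * horner c n s + c (Suc n)"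
proof -
  show "horner c 0 s = 1" by (simp add: horner_def)
  have "(\<Sum>i=1..n. c i * s ^ (Suc n - i)) = s * (\<Sum>i=1..n. c i * s ^ (n - i))"
    unfolding sum_distrib_left by (rule sum.cong) (auto simp: Suc_diff_le)
  then show "horner c (Suc n) s = s * horner c n s + c (Suc n)"
    by (simp add: horner_def algebra_simps)
qed

text \<open>Synthetic division: the intermediate Horner values at \<open>l\<close> are the
  coefficients of the quotient by s - l, and the last one is the remainder.\<close>

lemma horner_divide: "horner c (Suc n) s = (s - l) * horner (\<lambda>k. horner c k l) n s + horner c (Suc n) l"
proof (induction n)
  case (Suc n)
  have "horner c (Suc (Suc n)) s =
      s * ((s - l) * horner (\<lambda>k. horner c k l) n s + horner c (Suc n) l) + c (Suc (Suc n))"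
    unfolding horner_Suc[of c "Suc n" s] Suc.IH ..
  also have "\<dots> = (s - l) * horner (\<lambda>k. horner c k l) (Suc n) s + horner c (Suc (Suc n)) l"
    unfolding horner_Suc[of "\<lambda>k. horner c k l" n s] horner_Suc[of c "Suc n" l]
    by (simp add: algebra_simps)
  finally show ?case .
qed (simp add: horner_0 horner_Suc)

lemma horner_root:
  fixes c :: "nat \<Rightarrow> complex"
  shows "\<exists>l. horner c (Suc n) l = 0"
proof -
  define r where "r = (\<Sum>i=1..Suc n. monom (c i) (Suc n - i))"
  define p where "p = monom 1 (Suc n) + r"
  have "degree r \<le> n" unfolding r_def
    by (rule degree_sum_le) (auto intro: order_trans[OF degree_monom_le])
  then have "degree p = Suc n" unfolding p_def
    by (subst degree_add_eq_left) (auto simp: degree_monom_eq)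
  then have "\<not> constant (poly p)" by (simp add: constant_degree)
  then obtain l where "poly p l = 0" using fundamental_theorem_of_algebra by blast
  moreover have "poly p l = horner c (Suc n) l"
    by (simp add: p_def r_def horner_def poly_sum poly_monom)
  ultimately show ?thesis by auto
qed

text \<open>The chain is in observer form, with feedback from \<open>w 1\<close> into every
  equation. Its upper end \<open>w (Suc n)\<close> is a free input, because in the induction it is
  the combination split off by a root. Forcing may contain a decaying part besides the constant
  \<delta>, since the split-off combination itself decays only exponentially.\<close>

definition chain_decay :: "nat \<Rightarrow> (nat \<Rightarrow> complex) \<Rightarrow> real \<Rightarrow> real \<Rightarrow> real \<Rightarrow> bool" where
  "chain_decay n \<kappa> a0 C a \<longleftrightarrow> (\<forall>T w d W \<delta>. W \<ge> 0 \<longrightarrow> \<delta> \<ge> 0 \<longrightarrow>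
     (\<forall>k\<in>{1..n}. rate_on T (w k) (\<lambda>t. w (Suc k) t - \<kappa> k * w 1 t + d k t)) \<longrightarrow>
     (\<forall>k\<in>{1..n}. \<forall>t\<in>{0..T}. norm (d k t) \<le> W * exp (- a0 * t) + \<delta>) \<longrightarrow>
     (\<forall>t\<in>{0..T}. norm (w (Suc n) t) \<le> W * exp (- a0 * t) + \<delta>) \<longrightarrow>
     (\<forall>k\<in>{1..n}. norm (w k 0) \<le> W) \<longrightarrow>
     (\<forall>k\<in>{1..n}. \<forall>t\<in>{0..T}. norm (w k t) \<le> C * (W * exp (- a * t) + \<delta>)))"

lemma chain_decayD:
  assumes "chain_decay n \<kappa> a0 C a" "W \<ge> 0" "\<delta> \<ge> 0"
    "\<forall>k\<in>{1..n}. rate_on T (w k) (\<lambda>t. w (Suc k) t - \<kappa> k * w 1 t + d k t)"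
    "\<forall>k\<in>{1..n}. \<forall>t\<in>{0..T}. norm (d k t) \<le> W * exp (- a0 * t) + \<delta>"
    "\<forall>t\<in>{0..T}. norm (w (Suc n) t) \<le> W * exp (- a0 * t) + \<delta>"
    "\<forall>k\<in>{1..n}. norm (w k 0) \<le> W"
  shows "\<forall>k\<in>{1..n}. \<forall>t\<in>{0..T}. norm (w k t) \<le> C * (W * exp (- a * t) + \<delta>)"
  by (rule assms(1)[unfolded chain_decay_def, THEN spec, THEN spec, THEN spec, THEN spec, THEN spec,
        THEN mp, THEN mp, THEN mp, THEN mp, THEN mp, THEN mp, OF assms(2-7)])

text \<open>Each root \<open>l\<close> of the characteristic polynomial splits off the combination
  \<open>\<Sum>\<^sub>j l\<^sup>k\<^sup>-\<^sup>j w\<^sub>j\<close>: for \<open>k = n\<close> it satisfies a scalar equation with rate \<open>l\<close>, and for \<open>k < n\<close> these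
  combinations form a chain whose characteristic polynomial is the quotient by \<open>s - l\<close>.\<close>

lemma hurwitz_chain_decay:
  fixes \<kappa> :: "nat \<Rightarrow> complex"
  assumes "\<And>s. horner \<kappa> n s = 0 \<Longrightarrow> Re s < 0" "a0 > 0"
  shows "\<exists>C a. C \<ge> 0 \<and> a > 0 \<and> a \<le> a0 \<and> chain_decay n \<kappa> a0 C a"
  using assms
proof (induction n arbitrary: \<kappa> a0)
  case 0
  then show ?case by (intro exI[of _ 0] exI[of _ a0]) (auto simp: chain_decay_def)
next
  case (Suc n)
  obtain l where l: "horner \<kappa> (Suc n) l = 0" using horner_root by blast
  have Rl: "Re l < 0" using Suc.prems(1)[OF l] .
  define \<rho> where "\<rho> = - Re l"
  have \<rho>: "\<rho> > 0" using Rl by (simp add: \<rho>_def)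
  define \<kappa>h where "\<kappa>h k = horner \<kappa> k l" for k
  define a1 where "a1 = min a0 (\<rho> / 2)"
  have a1: "a1 > 0" "a1 \<le> a0" using \<rho> Suc.prems by (auto simp: a1_def)
  have "Re s < 0" if "horner \<kappa>h n s = 0" for s
    using Suc.prems(1)[of s] that horner_divide[of \<kappa> n s l] l by (simp add: \<kappa>h_def[abs_def])
  from Suc.IH[of \<kappa>h a1, OF this a1(1)] obtain C a where C: "C \<ge> 0" and a: "a > 0" "a \<le> a1"
    and IH: "chain_decay n \<kappa>h a1 C a" by blast
  define \<Lambda> where "\<Lambda> = (1 + norm l) ^ Suc n"
  define C1 where "C1 = (1 + 2 / \<rho>) * (1 + \<Lambda>)"
  have \<Lambda>1: "\<Lambda> \<ge> 1" unfolding \<Lambda>_def by (rule one_le_power) simp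
  have C1: "C1 \<ge> 1 + \<Lambda>" using \<rho> \<Lambda>1 by (simp add: C1_def algebra_simps)
  show ?case
  proof (rule exI[of _ "(1 + norm l) * (C + 1) * C1"], rule exI[of _ a], intro conjI)
    show "0 \<le> (1 + norm l) * (C + 1) * C1" using C C1 \<Lambda>1 by simp
    show "a > 0" "a \<le> a0" using a a1 by auto
    show "chain_decay (Suc n) \<kappa> a0 ((1 + norm l) * (C + 1) * C1) a" unfolding chain_decay_def
    proof (intro allI impI)
      fix T :: real and w d :: "nat \<Rightarrow> real \<Rightarrow> complex" and W \<delta> :: real
      assume W: "W \<ge> 0" and \<delta>: "\<delta> \<ge> 0"
        and r: "\<forall>k\<in>{1..Suc n}. rate_on T (w k) (\<lambda>t. w (Suc k) t - \<kappa> k * w 1 t + d k t)"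
        and d: "\<forall>k\<in>{1..Suc n}. \<forall>t\<in>{0..T}. norm (d k t) \<le> W * exp (- a0 * t) + \<delta>"
        and wn: "\<forall>t\<in>{0..T}. norm (w (Suc (Suc n)) t) \<le> W * exp (- a0 * t) + \<delta>"
        and w0: "\<forall>k\<in>{1..Suc n}. norm (w k 0) \<le> W"
      define wh where "wh k t = rec_nat 0 (\<lambda>k x. w (Suc k) t + l * x) k" for k t
      define dh where "dh k t = rec_nat 0 (\<lambda>k x. d (Suc k) t + l * x) k" for k t
      have wh: "wh 0 t = 0" "wh (Suc k) t = w (Suc k) t + l * wh k t" for k t by (simp_all add: wh_def)
      have dh: "dh 0 t = 0" "dh (Suc k) t = d (Suc k) t + l * dh k t" for k t by (simp_all add: dh_def)
      have wh1: "wh 1 t = w 1 t" "wh (Suc 0) t = w (Suc 0) t" for t using wh by simp_all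
      \<comment> \<open>The recursion for \<open>wh\<close> repeats Horner's rule in the coefficient
        of \<open>w 1\<close>, namely
        \<open>\<kappa>h (Suc k) = l * \<kappa>h k + \<kappa> (Suc k)\<close>. At k = 0 the value
        \<open>\<kappa>h 0 = 1\<close> makes the two occurrences of \<open>w 1\<close>
        cancel.\<close>
      have rwh: "rate_on T (wh k) (\<lambda>t. wh (Suc k) t - \<kappa>h k * w 1 t + dh k t)" if "k \<le> Suc n" for k
        using that
      proof (induction k)
        case 0
        have "rate_on T (\<lambda>t. 0::complex) (\<lambda>t. 0)" by (rule rate_on_const)
        then show ?case by (simp add: wh dh \<kappa>h_def horner_0)
      next
        case (Suc k)
        have "rate_on T (\<lambda>t. l * wh k t) (\<lambda>t. l * (wh (Suc k) t - \<kappa>h k * w 1 t + dh k t))"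
          by (rule rate_on_linear[OF Suc.IH]) (use Suc.prems in \<open>auto intro: bounded_linear_mult_right\<close>)
        from rate_on_add[OF bspec[OF r, of "Suc k"] this] Suc.prems
        show ?case by (simp add: wh dh \<kappa>h_def horner_Suc algebra_simps)
      qed
      have pw: "1 \<le> (1 + norm l) ^ k" for k by (rule one_le_power) simp
      \<comment> \<open>Unrolled, \<open>x k\<close> is the sum of l^(k-j) times \<open>y j\<close>
        for j = 1, ..., k, and (1 + |l|)^k dominates the sum of the absolute values of these
        powers.\<close>
      have rec_bound: "norm (x (k::nat)) \<le> (1 + norm l) ^ k * m"
        if "m \<ge> 0" "x 0 = 0" "\<And>k. x (Suc k) = y (Suc k) + l * x k" "\<And>k. k \<in> {1..Suc n} \<Longrightarrow> norm (y k) \<le> m"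
          "k \<le> Suc n" for x y m k
        using that(5)
      proof (induction k)
        case 0 then show ?case using that by simp
      next
        case (Suc k)
        have "norm (x (Suc k)) \<le> norm (y (Suc k)) + norm l * norm (x k)"
          unfolding that(3) by (metis norm_mult norm_triangle_ineq)
        also have "\<dots> \<le> (1 + norm l) ^ k * m + norm l * ((1 + norm l) ^ k * m)"
          using that(4)[of "Suc k"] Suc pw[of k] \<open>m \<ge> 0\<close> mult_right_mono[OF pw[of k] \<open>m \<ge> 0\<close>]
          by (intro add_mono mult_left_mono) auto
        finally show ?case by (simp add: algebra_simps)
      qed
      have rec_bound': "norm (x k) \<le> \<Lambda> * m"
        if "m \<ge> 0" "x 0 = 0" "\<And>k. x (Suc k) = y (Suc k) + l * x k" "\<And>k. k \<in> {1..Suc n} \<Longrightarrow> norm (y k) \<le> m"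
          "k \<le> Suc n" for x y m k
      proof -
        have "(1 + norm l) ^ k \<le> \<Lambda>" unfolding \<Lambda>_def using that(5) by (intro power_increasing) auto
        then have "(1 + norm l) ^ k * m \<le> \<Lambda> * m" using that(1) by (rule mult_right_mono)
        with rec_bound[OF that] show ?thesis by (rule order_trans)
      qed
      have mnn: "0 \<le> W * exp (- b * t) + \<delta>" for b t using W \<delta> by simp
      have dhb: "norm (dh k t) \<le> \<Lambda> * (W * exp (- a0 * t) + \<delta>)" if "k \<le> Suc n" "t \<in> {0..T}" for k t
        by (rule rec_bound'[of _ "\<lambda>k. dh k t" "\<lambda>k. d k t", OF mnn]) (use dh d that in auto)
      have wh0: "norm (wh k 0) \<le> \<Lambda> * W" if "k \<le> Suc n" for k
        by (rule rec_bound'[of _ "\<lambda>k. wh k 0" "\<lambda>k. w k 0", OF W]) (use wh w0 that in auto)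
      define v where "v = wh (Suc n)"
      \<comment> \<open>Since \<open>l\<close> is a root, the feedback from \<open>w 1\<close> drops
        out of the last combination, which becomes a scalar equation of its own.\<close>
      have "\<kappa>h (Suc n) = 0" using l by (simp add: \<kappa>h_def)
      then have rv: "rate_on T v (\<lambda>t. l * v t + (w (Suc (Suc n)) t + dh (Suc n) t))"
        using rwh[of "Suc n"] by (simp add: v_def wh algebra_simps)
      have vb: "norm (v t) \<le> C1 * (W * exp (- a1 * t) + \<delta>)" if t: "t \<in> {0..T}" for t
      proof -
        have "norm (v t) \<le> (1 + 2 / (- Re l)) * (((1 + \<Lambda>) * W) * exp (- min a0 (- Re l / 2) * t) + (1 + \<Lambda>) * \<delta>)"
        proof (rule scalar_decay[OF rv Rl Suc.prems(2) _ _ _ _ t])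
          fix s assume s: "s \<in> {0..T}"
          have "norm (w (Suc (Suc n)) s + dh (Suc n) s) \<le> (W * exp (- a0 * s) + \<delta>) + \<Lambda> * (W * exp (- a0 * s) + \<delta>)"
            using wn s dhb[of "Suc n" s] by (intro norm_triangle_mono) auto
          then show "norm (w (Suc (Suc n)) s + dh (Suc n) s) \<le> (1 + \<Lambda>) * W * exp (- a0 * s) + (1 + \<Lambda>) * \<delta>"
            by (simp add: algebra_simps)
        next
          show "norm (v 0) \<le> (1 + \<Lambda>) * W" using wh0[of "Suc n"] W by (simp add: v_def algebra_simps)
        qed (use W \<delta> \<Lambda>1 in auto)
        also have "\<dots> = C1 * (W * exp (- a1 * t) + \<delta>)"
          by (simp add: C1_def a1_def \<rho>_def algebra_simps add_divide_distrib)
        finally show ?thesis .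
      qed
      have C1p: "C1 \<ge> 0" using C1 \<Lambda>1 by linarith
      have ea: "W * exp (- b * t) \<le> W * exp (- b' * t)" if "b' \<le> b" "t \<in> {0..T}" for b b' t
        using that W by (intro mult_left_mono) (auto intro: mult_right_mono)
      \<comment> \<open>The shorter chain is driven at its end by \<open>v\<close>, which decays
        only at the rate \<open>a1\<close>; hence the induction hypothesis for \<open>a1\<close>,
        with the data enlarged by \<open>C1\<close>.\<close>
      have whb: "\<forall>k\<in>{1..n}. \<forall>t\<in>{0..T}. norm (wh k t) \<le> C * ((C1 * W) * exp (- a * t) + C1 * \<delta>)"
      proof (rule chain_decayD[OF IH, where d = dh])
        show "\<forall>k\<in>{1..n}. rate_on T (wh k) (\<lambda>t. wh (Suc k) t - \<kappa>h k * wh 1 t + dh k t)"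
          using rwh by (simp add: wh1)
        show "\<forall>k\<in>{1..n}. \<forall>t\<in>{0..T}. norm (dh k t) \<le> C1 * W * exp (- a1 * t) + C1 * \<delta>"
        proof (intro ballI)
          fix k t assume k: "k \<in> {1..n}" and t: "t \<in> {0..T}"
          have "norm (dh k t) \<le> \<Lambda> * (W * exp (- a0 * t) + \<delta>)" using dhb k t by auto
          also have "\<dots> \<le> C1 * (W * exp (- a1 * t) + \<delta>)"
            using C1 \<Lambda>1 ea[OF a1(2) t] mnn by (intro mult_mono) auto
          finally show "norm (dh k t) \<le> C1 * W * exp (- a1 * t) + C1 * \<delta>" by (simp add: algebra_simps)
        qed
        show "\<forall>t\<in>{0..T}. norm (wh (Suc n) t) \<le> C1 * W * exp (- a1 * t) + C1 * \<delta>"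
          using vb by (simp add: v_def algebra_simps)
        show "\<forall>k\<in>{1..n}. norm (wh k 0) \<le> C1 * W"
        proof
          fix k assume "k \<in> {1..n}"
          then have "norm (wh k 0) \<le> \<Lambda> * W" using wh0 by auto
          also have "\<dots> \<le> C1 * W" using C1 W by (intro mult_right_mono) auto
          finally show "norm (wh k 0) \<le> C1 * W" .
        qed
      qed (use W \<delta> C1p in auto)
      have whb': "norm (wh k t) \<le> (C + 1) * C1 * (W * exp (- a * t) + \<delta>)" if "k \<le> Suc n" "t \<in> {0..T}" for k t
      proof -
        have "k = 0 \<or> k \<in> {1..n} \<or> k = Suc n" using that(1) by (auto simp: le_Suc_eq)
        then consider "k = 0" | "k \<in> {1..n}" | "k = Suc n" by blast
        then show ?thesis
        proof cases
          case 1 then show ?thesis using C C1p mnn by (simp add: wh)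
        next
          case 2
          then have "norm (wh k t) \<le> C * C1 * (W * exp (- a * t) + \<delta>)" using bspec[OF bspec[OF whb 2], of t] that by (simp add: algebra_simps)
          also have "\<dots> \<le> (C + 1) * C1 * (W * exp (- a * t) + \<delta>)"
            using C C1p mnn by (intro mult_right_mono) auto
          finally show ?thesis .
        next
          case 3
          then have "norm (wh k t) \<le> C1 * (W * exp (- a1 * t) + \<delta>)" using vb that by (simp add: v_def)
          also have "\<dots> \<le> (C + 1) * C1 * (W * exp (- a * t) + \<delta>)"
            using C C1p mnn ea[OF a(2) that(2)] by (intro mult_mono) (auto simp: algebra_simps)
          finally show ?thesis .
        qed
      qed
      show "\<forall>k\<in>{1..Suc n}. \<forall>t\<in>{0..T}. norm (w k t) \<le> (1 + norm l) * (C + 1) * C1 * (W * exp (- a * t) + \<delta>)"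
      proof (intro ballI)
        fix k t assume k: "k \<in> {1..Suc n}" and t: "t \<in> {0..T}"
        then obtain j where j: "k = Suc j" "j \<le> n" by (cases k) auto
        \<comment> \<open>Inverting the recursion recovers each original variable from two
          neighbouring combinations.\<close>
        have "norm (w k t) = norm (wh (Suc j) t - l * wh j t)" by (simp add: wh j)
        also have "\<dots> \<le> norm (wh (Suc j) t) + norm l * norm (wh j t)"
          by (metis norm_mult norm_triangle_ineq4)
        also have "\<dots> \<le> (C + 1) * C1 * (W * exp (- a * t) + \<delta>) + norm l * ((C + 1) * C1 * (W * exp (- a * t) + \<delta>))"
          using j t by (intro add_mono mult_left_mono whb') auto
        finally show "norm (w k t) \<le> (1 + norm l) * (C + 1) * C1 * (W * exp (- a * t) + \<delta>)"
          by (simp add: algebra_simps)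
      qed
    qed
  qed
qed

section \<open>Coordinates of the integrator chain\<close>

definition coord :: "nat \<Rightarrow> 'n::{finite,linorder}" where
  "coord k = inv_into UNIV pos k"

lemma strict_mono_pos: "strict_mono (pos :: 'n::{finite,linorder} \<Rightarrow> nat)"
proof (rule strict_monoI)
  fix x y :: 'n assume xy: "x < y"
  then have "y \<in> {k. k \<le> y}" "y \<notin> {k. k \<le> x}" "{k. k \<le> x} \<subseteq> {k. k \<le> y}" by auto
  then have "{k. k \<le> x} \<subset> {k. k \<le> y}" by blast
  then show "pos x < pos y" unfolding pos_def by (intro psubset_card_mono) auto
qed

lemma bij_betw_pos: "bij_betw pos (UNIV :: 'n::{finite,linorder} set) {1..CARD('n)}"
proof -
  have inj: "inj (pos :: 'n \<Rightarrow> nat)" by (rule strict_mono_imp_inj_on[OF strict_mono_pos])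
  have "pos i \<in> {1..CARD('n)}" for i :: 'n
  proof -
    have "card {i} \<le> pos i" unfolding pos_def by (rule card_mono) auto
    moreover have "pos i \<le> CARD('n)" unfolding pos_def by (rule card_mono) auto
    ultimately show ?thesis by simp
  qed
  then have "range (pos :: 'n \<Rightarrow> nat) = {1..CARD('n)}"
    by (intro card_subset_eq) (auto simp: card_image inj)
  then show ?thesis using inj by (simp add: bij_betw_def)
qed

lemma pos_range: "pos (i::'n::{finite,linorder}) \<in> {1..CARD('n)}"
  using bij_betw_pos[where 'n='n] by (auto simp: bij_betw_def)

lemma coord_pos [simp]: "coord (pos i) = i"
  unfolding coord_def using bij_betw_pos by (intro inv_into_f_f) (auto simp: bij_betw_def)

lemma pos_coord: "k \<in> {1..CARD('n)} \<Longrightarrow> pos (coord k :: 'n::{finite,linorder}) = k"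
  unfolding coord_def using bij_betw_pos[where 'n='n] by (intro f_inv_into_f) (auto simp: bij_betw_def)

lemma pos_eq_iff: "k \<in> {1..CARD('n)} \<Longrightarrow> pos (i::'n::{finite,linorder}) = k \<longleftrightarrow> i = coord k"
  using pos_coord coord_pos by metis

lemma pos_coord_1 [simp]: "pos (coord 1 :: 'n::{finite,linorder}) = 1" "pos (coord (Suc 0) :: 'n::{finite,linorder}) = 1"
  using pos_coord[of 1, where 'n='n] by (auto simp: Suc_leI)

lemma chain_A_nth:
  "(chain_A *v (z :: real^'n::{finite,linorder})) $ i = (if pos i < CARD('n) then z $ coord (Suc (pos i)) else 0)"
proof -
  have "(chain_A *v z) $ i = (\<Sum>j\<in>UNIV. (if pos j = Suc (pos i) then z $ j else 0))"
    by (auto simp: matrix_vector_mult_def chain_A_def intro!: sum.cong)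
  also have "\<dots> = (if pos i < CARD('n) then z $ coord (Suc (pos i)) else 0)"
  proof (cases "pos i < CARD('n)")
    case True
    then have "pos j = Suc (pos i) \<longleftrightarrow> j = coord (Suc (pos i))" for j :: 'n by (intro pos_eq_iff) auto
    then show ?thesis using True by (simp add: sum.delta)
  next
    case False
    then have "pos j \<noteq> Suc (pos i)" for j :: 'n using pos_range[of j] by auto
    then show ?thesis using False by simp
  qed
  finally show ?thesis .
qed

lemma chain_C_mult: "(chain_C :: real^'n::{finite,linorder}^1) *v z = vec (z $ coord 1)"
  unfolding vec_eq_iff
proof
  fix i :: 1
  have "pos j = Suc 0 \<longleftrightarrow> j = coord (Suc 0)" for j :: 'n by (rule pos_eq_iff) (auto simp: Suc_leI)
  then have "(chain_C *v z) $ i = (\<Sum>j\<in>UNIV. (if j = coord 1 then 1 else 0) * z $ j)"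
    by (simp add: matrix_vector_mult_def chain_C_def)
  also have "\<dots> = (\<Sum>j\<in>UNIV. if j = coord 1 then z $ j else 0)" by (rule sum.cong) auto
  finally show "(chain_C *v z) $ i = vec (z $ coord 1) $ i" by simp
qed

text \<open>The observer error operator A - H C at \<epsilon> = 1. It is a companion form whose
  characteristic polynomial has the coefficients \<open>\<kappa>\<close>.\<close>

definition chain_op :: "(nat \<Rightarrow> real) \<Rightarrow> real^'n::{finite,linorder} \<Rightarrow> real^'n::{finite,linorder}" where
  "chain_op \<kappa> z = chain_A *v z - (z $ coord 1) *\<^sub>R (\<chi> i. \<kappa> (pos i))"

lemma linear_chain_op: "linear (chain_op \<kappa>)"
  unfolding chain_op_def
  by (rule linearI) (simp_all add: matrix_vector_right_distrib matrix_vector_mult_scaleR algebra_simps)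

text \<open>The coordinates, embedded in the complex numbers because the roots need not be real,
  form a chain as in \<open>chain_decay\<close>; summing the componentwise bounds costs a factor
  n.\<close>

lemma hurwitz_chain_iss:
  assumes "hurwitz_coeffs CARD('n) \<kappa>"
  obtains C a where "C \<ge> 1" "a > 0"
    "\<And>T (z :: real \<Rightarrow> real^'n::{finite,linorder}) d \<delta>. rate_on T z (\<lambda>t. chain_op \<kappa> (z t) + d t) \<Longrightarrow>
      (\<And>t. t \<in> {0..T} \<Longrightarrow> norm (d t) \<le> \<delta>) \<Longrightarrow>
      (\<And>t. t \<in> {0..T} \<Longrightarrow> norm (z t) \<le> C * (exp (- a * t) * norm (z 0) + \<delta>))"
proof -
  define kc where "kc k = complex_of_real (\<kappa> k)" for k
  have "\<And>s. horner kc CARD('n) s = 0 \<Longrightarrow> Re s < 0"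
    using assms by (simp add: hurwitz_coeffs_def horner_def kc_def)
  \<comment> \<open>The disturbance is bounded by \<delta> alone, so the assumed decay rate of its
    other part is arbitrary; it is set to 1.\<close>
  from hurwitz_chain_decay[OF this zero_less_one]
  obtain C a where C: "C \<ge> 0" and a: "a > 0" and dec: "chain_decay CARD('n) kc 1 C a" by blast
  show ?thesis
  proof (rule that[of "1 + real CARD('n) * C" a])
    show "1 + real CARD('n) * C \<ge> 1" using C by simp
    fix T and z :: "real \<Rightarrow> (real, 'n) vec" and d \<delta> t
    assume r: "rate_on T z (\<lambda>t. chain_op \<kappa> (z t) + d t)"
      and d: "\<And>t. t \<in> {0..T} \<Longrightarrow> norm (d t) \<le> \<delta>" and t: "t \<in> {0..T}"
    have \<delta>: "\<delta> \<ge> 0" using d[of t] t norm_ge_zero[of "d t"] by linarith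
    \<comment> \<open>The value 0 beyond index n closes the chain: its last equation contains no
      successor.\<close>
    define w where "w k t = (if k \<le> CARD('n) then complex_of_real (z t $ coord k) else 0)" for k t
    define W where "W = norm (z 0)"
    have bl: "bounded_linear (\<lambda>v :: (real, 'n) vec. complex_of_real (v $ i))" for i
      by (rule bounded_linear_compose[OF bounded_linear_of_real bounded_linear_vec_nth])
    have "\<forall>k\<in>{1..CARD('n)}. \<forall>t\<in>{0..T}. norm (w k t) \<le> C * (W * exp (- a * t) + \<delta>)"
    proof (rule chain_decayD[OF dec, where d = "\<lambda>k t. complex_of_real (d t $ coord k)"])
      show "\<forall>k\<in>{1..CARD('n)}. rate_on T (w k) (\<lambda>t. w (Suc k) t - kc k * w 1 t + complex_of_real (d t $ coord k))"
      proof
        fix k assume k: "k \<in> {1..CARD('n)}"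
        have "rate_on T (\<lambda>t. complex_of_real (z t $ coord k)) (\<lambda>t. complex_of_real ((chain_op \<kappa> (z t) + d t) $ coord k))"
          by (rule rate_on_linear[OF r bl])
        moreover have "w k = (\<lambda>t. complex_of_real (z t $ coord k))" using k by (auto simp: w_def)
        moreover have "complex_of_real ((chain_op \<kappa> (z t) + d t) $ coord k) =
            w (Suc k) t - kc k * w 1 t + complex_of_real (d t $ coord k)" for t
          using k by (auto simp: w_def chain_op_def chain_A_nth pos_coord kc_def Suc_le_eq mult.commute)
        ultimately show "rate_on T (w k) (\<lambda>t. w (Suc k) t - kc k * w 1 t + complex_of_real (d t $ coord k))"
          by simp
      qed
      show "\<forall>k\<in>{1..CARD('n)}. \<forall>t\<in>{0..T}. norm (complex_of_real (d t $ coord k)) \<le> W * exp (- 1 * t) + \<delta>"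
      proof (intro ballI)
        fix k s assume s: "s \<in> {0..T}"
        have "\<bar>d s $ coord k\<bar> \<le> \<delta>" using d[OF s] component_le_norm_cart[of "d s" "coord k"] by linarith
        moreover have "0 \<le> W * exp (- 1 * s)" by (simp add: W_def)
        ultimately show "norm (complex_of_real (d s $ coord k)) \<le> W * exp (- 1 * s) + \<delta>" by simp
      qed
    qed (use \<delta> component_le_norm_cart in \<open>auto simp: w_def W_def\<close>)
    then have comp: "\<bar>z t $ i\<bar> \<le> C * (W * exp (- a * t) + \<delta>)" for i
      using t pos_range[of i] by (auto simp: w_def dest: bspec[of _ _ "pos i"])
    have "norm (z t) \<le> (\<Sum>i\<in>UNIV. \<bar>z t $ i\<bar>)" by (rule norm_le_l1_cart)
    also have "\<dots> \<le> real CARD('n) * (C * (W * exp (- a * t) + \<delta>))"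
      using sum_bounded_above[of UNIV "\<lambda>i. \<bar>z t $ i\<bar>"] comp by simp
    also have "\<dots> \<le> (1 + real CARD('n) * C) * (exp (- a * t) * norm (z 0) + \<delta>)"
      using \<delta> C by (simp add: W_def algebra_simps)
    finally show "norm (z t) \<le> (1 + real CARD('n) * C) * (exp (- a * t) * norm (z 0) + \<delta>)" .
  qed (rule a)
qed

section \<open>Observability and high-gain scaling\<close>

text \<open>All integrals of \<open>w\<close> from 0 vanish, and a continuous integrand is the
  derivative of its indefinite integral, one-sided at the end points.\<close>

lemma rate_on_zero_imp_rate_zero:
  fixes w :: "real \<Rightarrow> 'a::euclidean_space"
  assumes r: "rate_on T z w" and w: "continuous_on {0..T} w" and T: "T > 0"
    and z: "\<And>t. t \<in> {0..T} \<Longrightarrow> z t = 0" and t: "t \<in> {0..T}"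
  shows "w t = 0"
proof -
  have i: "integral {0..s} w = 0" if "s \<in> {0..T}" for s
    using rate_on_interval[OF r, of 0 s] z[of s] z[of 0] that by (auto simp: has_integral_iff)
  have "((\<lambda>u. integral {0..u} w) has_vector_derivative w t) (at t within {0..T})"
    by (rule integral_has_vector_derivative[OF w t])
  then have "((\<lambda>u. 0) has_vector_derivative w t) (at t within {0..T})"
    by (rule has_vector_derivative_transform[OF t _, rotated]) (use i in auto)
  then show ?thesis
    using vector_derivative_unique_within_closed_interval[of 0 T t "\<lambda>u. 0" "w t" 0] T t
    by (auto simp: has_vector_derivative_const)
qed

text \<open>The output energy over [0, 1] is a quadratic form in the initial value. Observability
  makes it positive on the compact unit sphere; the reciprocal of its minimum there is the constant,
  and homogeneity extends the estimate to all initial values.\<close>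

lemma observability_estimate:
  fixes A :: "'a::euclidean_space \<Rightarrow> 'a" and c :: "'a \<Rightarrow> real"
  assumes A: "linear A" and c: "linear c"
    and obs: "\<And>z. rate_on 1 z (\<lambda>t. A (z t)) \<Longrightarrow> (\<And>t. t \<in> {0..1} \<Longrightarrow> c (z t) = 0) \<Longrightarrow> z 0 = 0"
  obtains C where "C > 0"
    "\<And>z. rate_on 1 z (\<lambda>t. A (z t)) \<Longrightarrow> (norm (z 0))\<^sup>2 \<le> C * integral {0..1} (\<lambda>t. (c (z t))\<^sup>2)"
proof -
  interpret A: bounded_linear A using A by (rule linear_conv_bounded_linear[THEN iffD1])
  interpret c: bounded_linear c using c by (rule linear_conv_bounded_linear[THEN iffD1])
  obtain L where L: "L-lipschitz_on UNIV A" by (rule A.lipschitz_boundE)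
  have L0: "L \<ge> 0" using L by (rule lipschitz_on_nonneg)
  have "\<exists>z. z 0 = b \<and> rate_on 1 z (\<lambda>t. A (z t))" for b
  proof -
    obtain z where "z 0 = b" "\<And>T. rate_on T z (\<lambda>t. A (z t) + (\<lambda>_. 0) t *\<^sub>R (\<lambda>_. 0) (z t))"
      by (rule noise_driven_solution[OF L, of 0 "\<lambda>_. 0" "\<lambda>_. 0" 0 b]) (auto simp: lipschitz_on_constant)
    then show ?thesis by auto
  qed
  then obtain \<phi> where \<phi>: "\<And>b. \<phi> b 0 = b" "\<And>b. rate_on 1 (\<phi> b) (\<lambda>t. A (\<phi> b t))" by metis
  define comb where "comb u t = (\<Sum>b\<in>Basis. (u \<bullet> b) *\<^sub>R \<phi> b t)" for u t
  have comb0: "comb u 0 = u" for u by (simp add: comb_def \<phi> euclidean_representation)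
  have rc: "rate_on 1 (comb u) (\<lambda>t. A (comb u t))" for u
  proof -
    have "rate_on 1 (\<lambda>t. \<Sum>b\<in>Basis. (u \<bullet> b) *\<^sub>R \<phi> b t) (\<lambda>t. \<Sum>b\<in>Basis. (u \<bullet> b) *\<^sub>R A (\<phi> b t))"
      by (intro rate_on_sum rate_on_scaleR \<phi>) auto
    then show ?thesis unfolding comb_def by (simp add: A.sum A.scaleR)
  qed
  have uniq: "z t = comb (z 0) t" if z: "rate_on 1 z (\<lambda>t. A (z t))" and t: "t \<in> {0..1}" for z t
  proof -
    have "rate_on 1 (\<lambda>t. z t - comb (z 0) t) (\<lambda>t. A (z t - comb (z 0) t))"
      using rate_on_diff[OF z rc] by (simp add: A.diff)
    from rate_on_gronwall[OF this L0 order_refl _ t] lipschitz_onD[OF L, of _ 0]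
    show ?thesis by (simp add: comb0 A.zero)
  qed
  have cc: "continuous_on {0..1} (\<lambda>t. c (\<phi> b t))" for b
    by (rule c.continuous_on) (rule rate_on_continuous[OF \<phi>(2)])
  \<comment> \<open>Written through the Gram matrix of the outputs of the basis solutions, the
    energy is visibly continuous and homogeneous of degree two in \<open>u\<close>.\<close>
  define Q where "Q u = (\<Sum>b\<in>Basis. \<Sum>b'\<in>Basis. (u \<bullet> b) * (u \<bullet> b') * integral {0..1} (\<lambda>t. c (\<phi> b t) * c (\<phi> b' t)))" for u
  have Qc: "integral {0..1} (\<lambda>t. (c (comb u t))\<^sup>2) = Q u" for u
  proof -
    have "(c (comb u t))\<^sup>2 = (\<Sum>b\<in>Basis. \<Sum>b'\<in>Basis. (u \<bullet> b) * (u \<bullet> b') * (c (\<phi> b t) * c (\<phi> b' t)))" for t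
      by (simp add: comb_def c.sum c.scaleR power2_eq_square sum_product algebra_simps)
    moreover have "integral {0..1} (\<lambda>t. \<Sum>b\<in>Basis. \<Sum>b'\<in>Basis. (u \<bullet> b) * (u \<bullet> b') * (c (\<phi> b t) * c (\<phi> b' t))) = Q u"
      unfolding Q_def
      by (subst integral_sum; (intro integrable_sum integrable_continuous_real continuous_intros cc finite_Basis sum.cong refl)?)
        (subst integral_sum; (intro integrable_continuous_real continuous_intros cc finite_Basis)?; simp)
    ultimately show ?thesis by simp
  qed
  have Qcont: "continuous_on S Q" for S unfolding Q_def by (intro continuous_intros)
  have Qpos: "Q u > 0" if "u \<noteq> 0" for u
  proof -
    have ct: "continuous_on {0..1} (\<lambda>t. (c (comb u t))\<^sup>2)"
      by (intro continuous_intros c.continuous_on rate_on_continuous[OF rc])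
    have "integral {0..1} (\<lambda>t. (c (comb u t))\<^sup>2) \<noteq> 0"
    proof
      assume "integral {0..1} (\<lambda>t. (c (comb u t))\<^sup>2) = 0"
      then have "\<forall>t\<in>{0..1}. (c (comb u t))\<^sup>2 = 0"
        using integral_eq_0_iff[OF ct] by auto
      then have "comb u 0 = 0" by (intro obs[OF rc]) auto
      then show False using that comb0 by simp
    qed
    moreover have "integral {0..1} (\<lambda>t. (c (comb u t))\<^sup>2) \<ge> 0"
      by (intro integral_nonneg integrable_continuous_real ct) auto
    ultimately show ?thesis using Qc[of u] by simp
  qed
  obtain v where v: "v \<in> sphere 0 1" "\<And>u. u \<in> sphere 0 1 \<Longrightarrow> Q v \<le> Q u"
    using continuous_attains_inf[OF compact_sphere[of "0::'a" 1] _ Qcont] by (auto simp: sphere_eq_empty)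
  have m: "Q v > 0" by (rule Qpos) (use v in auto)
  show ?thesis
  proof (rule that[of "1 / Q v"])
    show "1 / Q v > 0" using m by simp
    fix z assume z: "rate_on 1 z (\<lambda>t. A (z t))"
    define u where "u = z 0"
    have "integral {0..1} (\<lambda>t. (c (z t))\<^sup>2) = integral {0..1} (\<lambda>t. (c (comb u t))\<^sup>2)"
    proof (rule integral_cong)
      fix t :: real assume "t \<in> {0..1}"
      then have "z t = comb u t" unfolding u_def by (rule uniq[OF z])
      then show "(c (z t))\<^sup>2 = (c (comb u t))\<^sup>2" by simp
    qed
    then have I: "integral {0..1} (\<lambda>t. (c (z t))\<^sup>2) = Q u" by (simp add: Qc)
    have "(norm u)\<^sup>2 * Q v \<le> Q u"
    proof (cases "u = 0")
      case True then show ?thesis by (simp add: Q_def)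
    next
      case False
      have "Q v \<le> Q (u /\<^sub>R norm u)" by (rule v(2)) (use False in simp)
      then have "(norm u)\<^sup>2 * Q v \<le> (norm u)\<^sup>2 * Q (u /\<^sub>R norm u)" by (intro mult_left_mono) auto
      also have "\<dots> = Q u"
        unfolding Q_def sum_distrib_left inner_scaleR_left
      proof (intro sum.cong refl)
        have "s\<^sup>2 * ((inverse s * x) * (inverse s * y) * X) = x * y * X" if "s \<noteq> 0" for s x y X :: real
          using that by (simp add: power2_eq_square field_simps)
        then show "(norm u)\<^sup>2 * ((inverse (norm u) * (u \<bullet> b)) * (inverse (norm u) * (u \<bullet> b')) * X) = (u \<bullet> b) * (u \<bullet> b') * X"
          for b b' X using False by simp
      qed
      finally show ?thesis .
    qed
    then show "(norm (z 0))\<^sup>2 \<le> 1 / Q v * integral {0..1} (\<lambda>t. (c (z t))\<^sup>2)"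
      using m by (simp add: I u_def[symmetric] field_simps)
  qed
qed

text \<open>While the first coordinate vanishes the feedback is off and each coordinate is the rate
  of its predecessor, so zero propagates along the chain.\<close>

lemma chain_op_observable:
  fixes z :: "real \<Rightarrow> real^'n::{finite,linorder}"
  assumes r: "rate_on 1 z (\<lambda>t. chain_op \<kappa> (z t))" and z: "\<And>t. t \<in> {0..1} \<Longrightarrow> z t $ coord 1 = 0"
  shows "z 0 = 0"
proof -
  have cz: "continuous_on {0..1} z" by (rule rate_on_continuous[OF r])
  have *: "Suc k \<le> CARD('n) \<Longrightarrow> \<forall>t\<in>{0..1}. z t $ coord (Suc k) = 0" for k
  proof (induction k)
    case 0 then show ?case using z by simp
  next
    case (Suc k)
    have "rate_on 1 (\<lambda>t. z t $ coord (Suc k)) (\<lambda>t. chain_op \<kappa> (z t) $ coord (Suc k))"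
      by (rule rate_on_linear[OF r bounded_linear_vec_nth])
    then have "rate_on 1 (\<lambda>t. z t $ coord (Suc k)) (\<lambda>t. z t $ coord (Suc (Suc k)))"
      by (rule iffD1[OF rate_on_cong, rotated -1]) (use z Suc.prems in \<open>auto simp: chain_op_def chain_A_nth pos_coord\<close>)
    then show ?case
      using rate_on_zero_imp_rate_zero[of 1 _ "\<lambda>t. z t $ coord (Suc (Suc k))"] Suc bounded_linear.continuous_on[OF bounded_linear_vec_nth cz] by auto
  qed
  have "z 0 $ i = 0" for i
    using *[of "pos i - 1"] pos_range[of i] by auto
  then show ?thesis by (simp add: vec_eq_iff)
qed

text \<open>The exponents start at 0: the measured coordinate is left unscaled, so neither the noise
  nor the output energy is distorted. The price is a factor 1 / \<epsilon>^(n-1) when scaling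
  back.\<close>

definition gain_scale :: "real \<Rightarrow> real^'n::{finite,linorder} \<Rightarrow> real^'n::{finite,linorder}" where
  "gain_scale \<epsilon> z = (\<chi> i. \<epsilon> ^ (pos i - 1) * z $ i)"

lemma linear_gain_scale: "linear (gain_scale \<epsilon>)"
  unfolding gain_scale_def by (rule linearI) (simp_all add: vec_eq_iff algebra_simps)

lemma gain_scale_coord_1 [simp]: "gain_scale \<epsilon> z $ coord 1 = z $ coord 1"
  "gain_scale \<epsilon> z $ coord (Suc 0) = z $ coord (Suc 0)"
  by (simp_all add: gain_scale_def)

lemma norm_gain_scale_le:
  fixes z :: "real^'n::{finite,linorder}"
  assumes "0 < \<epsilon>" "\<epsilon> \<le> 1" shows "norm (gain_scale \<epsilon> z) \<le> norm z"
proof (rule norm_le_componentwise_cart)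
  fix i :: 'n
  have "\<epsilon> ^ (pos i - 1) \<le> 1" using assms by (intro power_le_one) auto
  then show "norm (gain_scale \<epsilon> z $ i) \<le> norm (z $ i)"
    using assms mult_right_mono[of "\<epsilon> ^ (pos i - 1)" 1 "\<bar>z $ i\<bar>"] by (simp add: gain_scale_def abs_mult)
qed

lemma norm_le_gain_scale:
  fixes z :: "real^'n::{finite,linorder}"
  assumes "0 < \<epsilon>" "\<epsilon> \<le> 1" shows "norm z \<le> norm (gain_scale \<epsilon> z) / \<epsilon> ^ (CARD('n) - 1)"
proof -
  have "norm z \<le> norm ((1 / \<epsilon> ^ (CARD('n) - 1)) *\<^sub>R gain_scale \<epsilon> z)"
  proof (rule norm_le_componentwise_cart)
    fix i :: 'n
    have "\<epsilon> ^ (CARD('n) - 1) \<le> \<epsilon> ^ (pos i - 1)"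
      using assms pos_range[of i] by (intro power_decreasing diff_le_mono) auto
    then have "\<epsilon> ^ (CARD('n) - 1) * \<bar>z $ i\<bar> \<le> \<epsilon> ^ (pos i - 1) * \<bar>z $ i\<bar>" by (rule mult_right_mono) simp
    then show "norm (z $ i) \<le> norm (((1 / \<epsilon> ^ (CARD('n) - 1)) *\<^sub>R gain_scale \<epsilon> z) $ i)"
      using assms by (simp add: gain_scale_def abs_mult field_simps)
  qed
  then show ?thesis using assms by simp
qed

text \<open>Conjugation by the scaling turns A into A / \<epsilon>, the gain into
  \<open>\<kappa>\<close> / \<epsilon> and the input direction into \<epsilon>^(n-1) times itself.
  The factor \<epsilon> from the change of time leaves a linear part free of \<epsilon>, a
  nonlinearity damped by \<epsilon>^n, and noise with weight 1.\<close>

lemma observer_error_rescaled: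
  fixes e :: "real \<Rightarrow> real^'n::{finite,linorder}"
  assumes r: "rate_on T e (\<lambda>t. chain_A *v e t + \<phi> t *\<^sub>R axis (coord CARD('n)) 1
      - (e t $ coord 1 + \<nu> t) *\<^sub>R (\<chi> i. \<kappa> (pos i) / \<epsilon> ^ pos i))" and \<epsilon>: "\<epsilon> > 0"
  shows "rate_on (T / \<epsilon>) (\<lambda>s. gain_scale \<epsilon> (e (\<epsilon> * s)))
    (\<lambda>s. chain_op \<kappa> (gain_scale \<epsilon> (e (\<epsilon> * s))) + ((\<epsilon> ^ CARD('n) * \<phi> (\<epsilon> * s)) *\<^sub>R axis (coord CARD('n)) 1
      - \<nu> (\<epsilon> * s) *\<^sub>R (\<chi> i. \<kappa> (pos i))))"
proof -
  have p: "\<epsilon> * \<epsilon> ^ (pos i - 1) = \<epsilon> ^ pos i" for i :: 'n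
    using pos_range[of i] by (cases "pos i") auto
  have eq: "\<epsilon> *\<^sub>R gain_scale \<epsilon> (chain_A *v z + f *\<^sub>R axis (coord CARD('n)) 1
      - (z $ coord 1 + n) *\<^sub>R (\<chi> i. \<kappa> (pos i) / \<epsilon> ^ pos i)) =
      chain_op \<kappa> (gain_scale \<epsilon> z) + ((\<epsilon> ^ CARD('n) * f) *\<^sub>R axis (coord CARD('n)) 1 - n *\<^sub>R (\<chi> i. \<kappa> (pos i)))"
    (is "?l = ?r") for z :: "(real, 'n) vec" and f n
  proof -
    have "?l $ i = ?r $ i" for i
    proof -
      have "?l $ i = \<epsilon> ^ pos i * ((chain_A *v z) $ i + f * axis (coord CARD('n)) 1 $ i - (z $ coord 1 + n) * (\<kappa> (pos i) / \<epsilon> ^ pos i))"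
        (is "_ = _ * ?X")
      proof -
        have "?l $ i = \<epsilon> * (\<epsilon> ^ (pos i - 1) * ?X)" by (simp add: gain_scale_def)
        also have "\<dots> = \<epsilon> * \<epsilon> ^ (pos i - 1) * ?X" by (rule mult.assoc[symmetric])
        also have "\<dots> = \<epsilon> ^ pos i * ?X" unfolding p ..
        finally show ?thesis .
      qed
      also have "\<dots> = \<epsilon> ^ pos i * (chain_A *v z) $ i + \<epsilon> ^ pos i * f * axis (coord CARD('n)) 1 $ i - (z $ coord 1 + n) * \<kappa> (pos i)"
        using \<epsilon> by (simp add: field_simps)
      also have "\<epsilon> ^ pos i * (chain_A *v z) $ i = (chain_A *v gain_scale \<epsilon> z) $ i"
        by (auto simp: chain_A_nth gain_scale_def pos_coord Suc_leI)
      also have "\<epsilon> ^ pos i * f * axis (coord CARD('n)) 1 $ i = \<epsilon> ^ CARD('n) * f * axis (coord CARD('n)) 1 $ i"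
        by (auto simp: axis_def pos_coord)
      finally show ?thesis by (simp add: chain_op_def algebra_simps)
    qed
    then show ?thesis by (simp add: vec_eq_iff)
  qed
  have bl: "bounded_linear (gain_scale \<epsilon>)"
    using linear_gain_scale by (rule linear_conv_bounded_linear[THEN iffD1])
  have "rate_on (T / \<epsilon>) (\<lambda>s. gain_scale \<epsilon> (e (\<epsilon> * s))) (\<lambda>s. gain_scale \<epsilon> (\<epsilon> *\<^sub>R (chain_A *v e (\<epsilon> * s) + \<phi> (\<epsilon> * s) *\<^sub>R axis (coord CARD('n)) 1
      - (e (\<epsilon> * s) $ coord 1 + \<nu> (\<epsilon> * s)) *\<^sub>R (\<chi> i. \<kappa> (pos i) / \<epsilon> ^ pos i))))"
    by (rule rate_on_linear[OF rate_on_rescale[OF r \<epsilon>] bl])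
  then show ?thesis unfolding linear_cmul[OF linear_gain_scale] eq .
qed

section \<open>Recursive least squares\<close>

definition outer :: "real^'m \<Rightarrow> real^'m^'m" where
  "outer v = (\<chi> i j. v $ i * v $ j)"

lemma outer_mult: "outer v *v u = (v \<bullet> u) *\<^sub>R v"
  by (simp add: vec_eq_iff outer_def matrix_vector_mult_def inner_vec_def sum_distrib_right sum_distrib_left mult_ac)

lemma continuous_on_outer: "continuous_on S v \<Longrightarrow> continuous_on S (\<lambda>t. outer (v t))"
  unfolding outer_def by (intro continuous_intros bounded_linear.continuous_on[OF bounded_linear_vec_nth])

lemma bounded_bilinear_matrix_mult:
  "bounded_bilinear (\<lambda>(A::real^'b::finite^'a::finite) (B::real^'c::finite^'b). A ** B)"
  unfolding bilinear_conv_bounded_bilinear[symmetric] bilinear_def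
  by (intro conjI allI linearI)
    (simp_all add: matrix_matrix_mult_def vec_eq_iff algebra_simps sum.distrib sum_distrib_left)

lemma bounded_bilinear_matrix_vector_mult:
  "bounded_bilinear (\<lambda>(A::real^'b::finite^'a::finite) (x::real^'b). A *v x)"
  unfolding bilinear_conv_bounded_bilinear[symmetric] bilinear_def
  by (intro conjI allI linearI)
    (simp_all add: matrix_vector_mult_def vec_eq_iff algebra_simps sum.distrib sum_distrib_left)

text \<open>The least squares law in closed form: \<open>R = P\<^sup>-\<^sup>1 = I / \<gamma> + \<integral> m m\<^sup>T\<close> and \<open>R \<delta> = - r\<close>, where
  \<open>r = \<integral> w m\<close>. Testing the last identity with \<open>\<delta>\<close> gives all bounds.\<close>

lemma recursive_least_squares:
  fixes m :: "real \<Rightarrow> real^'m" and P :: "real \<Rightarrow> real^'m^'m" and \<delta> r :: "real \<Rightarrow> real^'m" and w :: "real \<Rightarrow> real"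
  assumes \<gamma>: "\<gamma> > 0" and m: "continuous_on {0..T} m"
    and rP: "rate_on T P (\<lambda>t. - (P t ** outer (m t) ** P t))" and P0: "P 0 = \<gamma> *\<^sub>R mat 1"
    and r\<delta>: "rate_on T \<delta> (\<lambda>t. - ((w t + m t \<bullet> \<delta> t) *\<^sub>R (P t *v m t)))" and \<delta>0: "\<delta> 0 = 0"
    and rr: "rate_on T r (\<lambda>t. w t *\<^sub>R m t)" and r0: "r 0 = 0"
    and w: "\<And>t. t \<in> {0..T} \<Longrightarrow> \<bar>w t\<bar> \<le> \<omega>" and t: "t \<in> {0..T}"
  shows "norm (P t *v u) \<le> \<gamma> * norm u"
    and "norm (\<delta> t) \<le> \<gamma> * norm (r t)"
    and "integral {0..t} (\<lambda>s. (m s \<bullet> \<delta> t)\<^sup>2) \<le> t * \<omega>\<^sup>2"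
proof -
  interpret mm: bounded_bilinear "\<lambda>(A::real^'m^'m) (B::real^'m^'m). A ** B"
    by (rule bounded_bilinear_matrix_mult)
  interpret mv: bounded_bilinear "\<lambda>(A::real^'m^'m) (x::real^'m). A *v x"
    by (rule bounded_bilinear_matrix_vector_mult)
  define R where "R t = (1 / \<gamma>) *\<^sub>R mat 1 + integral {0..t} (\<lambda>s. outer (m s))" for t
  have co: "continuous_on {0..T} (\<lambda>t. outer (m t))" by (rule continuous_on_outer[OF m])
  have rR: "rate_on T R (\<lambda>t. outer (m t))" unfolding R_def by (rule rate_on_continuous_rate[OF co])
  have cP: "continuous_on {0..T} P" by (rule rate_on_continuous[OF rP])
  \<comment> \<open>The defect of \<open>R\<close> as an inverse of \<open>P\<close>. It solves a
    linear homogeneous equation with initial value zero, so Gronwall makes it vanish.\<close>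
  define Q where "Q t = mat 1 - R t ** P t" for t
  have "rate_on T Q (\<lambda>t. 0 - (outer (m t) ** P t + R t ** - (P t ** outer (m t) ** P t)))"
    unfolding Q_def by (intro rate_on_diff rate_on_const rate_on_bilinear[OF bounded_bilinear_matrix_mult rR rP])
  moreover have "0 - (outer (m t) ** P t + R t ** - (P t ** outer (m t) ** P t)) = - (Q t ** (outer (m t) ** P t))" for t
    by (simp add: Q_def mm.diff_left mm.minus_right matrix_mul_assoc)
  ultimately have rQ: "rate_on T Q (\<lambda>t. - (Q t ** (outer (m t) ** P t)))" by simp
  have "continuous_on {0..T} (\<lambda>t. outer (m t) ** P t)" by (rule mm.continuous_on[OF co cP])
  then have "bounded ((\<lambda>t. outer (m t) ** P t) ` {0..T})"
    by (intro compact_imp_bounded compact_continuous_image) auto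
  then obtain B where B: "B > 0" "\<And>t. t \<in> {0..T} \<Longrightarrow> norm (outer (m t) ** P t) \<le> B"
    unfolding bounded_pos by auto
  obtain K where K: "K > 0" "\<And>a b. norm ((a::real^'m^'m) ** (b::real^'m^'m)) \<le> norm a * norm b * K"
    using mm.pos_bounded by blast
  have Q0: "Q 0 = 0" using \<gamma> by (simp add: Q_def R_def P0 mm.scaleR_left mm.scaleR_right)
  have Qz: "Q s = 0" if s: "s \<in> {0..T}" for s
  proof -
    have "norm (Q s) \<le> (norm (Q 0) + 0 * T) * exp ((K * B) * s)"
    proof (rule rate_on_gronwall[OF rQ _ order_refl _ s])
      fix t assume t: "t \<in> {0..T}"
      have "norm (Q t ** (outer (m t) ** P t)) \<le> norm (Q t) * norm (outer (m t) ** P t) * K" by (rule K)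
      also have "\<dots> \<le> norm (Q t) * B * K" using B(2)[OF t] K by (intro mult_right_mono mult_left_mono) auto
      finally show "norm (- (Q t ** (outer (m t) ** P t))) \<le> K * B * norm (Q t) + 0" by (simp add: mult_ac)
    qed (use K B in auto)
    then show ?thesis by (simp add: Q0)
  qed
  then have RP: "R s ** P s = mat 1" if "s \<in> {0..T}" for s using that by (simp add: Q_def)
  have RPv: "R s *v (P s *v v) = v" if "s \<in> {0..T}" for s v
    using RP[OF that] by (simp add: matrix_vector_mul_assoc)
  have Rquad: "v \<bullet> (R s *v v) = (norm v)\<^sup>2 / \<gamma> + integral {0..s} (\<lambda>\<tau>. (m \<tau> \<bullet> v)\<^sup>2)"
    and quad_nonneg: "integral {0..s} (\<lambda>\<tau>. (m \<tau> \<bullet> v)\<^sup>2) \<ge> 0" if s: "s \<in> {0..T}" for s v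
  proof -
    have bl: "bounded_linear (\<lambda>A :: real^'m^'m. v \<bullet> (A *v v))"
      by (rule bounded_linear_compose[OF bounded_linear_inner_right mv.bounded_linear_left])
    have cs: "continuous_on {0..s} (\<lambda>t. outer (m t))" by (rule continuous_on_subset[OF co]) (use s in auto)
    have "v \<bullet> (integral {0..s} (\<lambda>\<tau>. outer (m \<tau>)) *v v) = integral {0..s} (\<lambda>\<tau>. v \<bullet> (outer (m \<tau>) *v v))"
      using integral_linear[OF integrable_continuous_real[OF cs] bl] by (simp add: o_def)
    also have "\<dots> = integral {0..s} (\<lambda>\<tau>. (m \<tau> \<bullet> v)\<^sup>2)"
      by (simp add: outer_mult power2_eq_square inner_commute)
    finally show "v \<bullet> (R s *v v) = (norm v)\<^sup>2 / \<gamma> + integral {0..s} (\<lambda>\<tau>. (m \<tau> \<bullet> v)\<^sup>2)"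
      by (simp add: R_def mv.add_left mv.scaleR_left inner_add_right power2_norm_eq_inner)
    show "integral {0..s} (\<lambda>\<tau>. (m \<tau> \<bullet> v)\<^sup>2) \<ge> 0"
      by (intro integral_nonneg integrable_continuous_real continuous_intros continuous_on_subset[OF m]) (use s in auto)
  qed
  have norm_cancel: "x \<le> \<gamma> * y" if "x\<^sup>2 / \<gamma> \<le> x * y" "x \<ge> 0" "y \<ge> 0" for x y :: real
  proof (cases "x = 0")
    case False
    then have "x * x \<le> x * (\<gamma> * y)" using that \<gamma> by (simp add: power2_eq_square field_simps)
    then show ?thesis using False that by (simp add: mult_le_cancel_left)
  qed (use that \<gamma> in auto)
  show "norm (P t *v u) \<le> \<gamma> * norm u"
  proof (rule norm_cancel)
    define v where "v = P t *v u"
    have "(norm v)\<^sup>2 / \<gamma> \<le> v \<bullet> (R t *v v)" using Rquad[OF t, of v] quad_nonneg[OF t, of v] by linarith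
    also have "\<dots> = v \<bullet> u" using RPv[OF t] by (simp add: v_def)
    also have "\<dots> \<le> norm v * norm u" by (rule norm_cauchy_schwarz)
    finally show "(norm (P t *v u))\<^sup>2 / \<gamma> \<le> norm (P t *v u) * norm u" by (simp add: v_def)
  qed auto
  \<comment> \<open>A conserved quantity: its rate vanishes once \<open>R ** P\<close> is replaced
    by the identity, and it starts at zero.\<close>
  define D where "D t = R t *v \<delta> t + r t" for t
  have "rate_on T D (\<lambda>t. outer (m t) *v \<delta> t + R t *v - ((w t + m t \<bullet> \<delta> t) *\<^sub>R (P t *v m t)) + w t *\<^sub>R m t)"
    unfolding D_def by (intro rate_on_add rr rate_on_bilinear[OF bounded_bilinear_matrix_vector_mult rR r\<delta>])
  then have rD: "rate_on T D (\<lambda>t. 0)"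
    by (rule iffD1[OF rate_on_cong, rotated -1])
      (simp_all add: outer_mult mv.minus_right mv.scaleR_right RPv algebra_simps)
  have "D t = 0" using rate_on_zero_const[OF rD t] by (simp add: D_def \<delta>0 r0 mv.zero_right)
  then have R\<delta>: "R t *v \<delta> t = - r t" by (simp add: D_def eq_neg_iff_add_eq_0)
  have en: "(norm (\<delta> t))\<^sup>2 / \<gamma> + integral {0..t} (\<lambda>\<tau>. (m \<tau> \<bullet> \<delta> t)\<^sup>2) = - (\<delta> t \<bullet> r t)"
    using Rquad[OF t, of "\<delta> t"] by (simp add: R\<delta>)
  show "norm (\<delta> t) \<le> \<gamma> * norm (r t)"
  proof (rule norm_cancel)
    have "(norm (\<delta> t))\<^sup>2 / \<gamma> \<le> - (\<delta> t \<bullet> r t)" using en quad_nonneg[OF t, of "\<delta> t"] by linarith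
    also have "\<dots> \<le> norm (\<delta> t) * norm (r t)" using norm_cauchy_schwarz[of "\<delta> t" "- r t"] by simp
    finally show "(norm (\<delta> t))\<^sup>2 / \<gamma> \<le> norm (\<delta> t) * norm (r t)" .
  qed auto
  define x where "x s = m s \<bullet> \<delta> t" for s
  have cx: "continuous_on {0..t} (\<lambda>s. (x s)\<^sup>2)"
    unfolding x_def by (intro continuous_intros continuous_on_subset[OF m]) (use t in auto)
  have "((\<lambda>s. \<delta> t \<bullet> (w s *\<^sub>R m s)) has_integral \<delta> t \<bullet> (r t - r 0)) {0..t}"
    using has_integral_linear[OF rate_on_interval[OF rr, of 0 t] bounded_linear_inner_right[of "\<delta> t"]] t
    by (simp add: o_def)
  then have "((\<lambda>s. - (w s * x s)) has_integral - (\<delta> t \<bullet> r t)) {0..t}"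
    by (auto simp: r0 x_def inner_commute dest: has_integral_neg)
  moreover have "((\<lambda>s. \<omega>\<^sup>2 / 2 + (x s)\<^sup>2 / 2) has_integral (\<omega>\<^sup>2 / 2 * t + integral {0..t} (\<lambda>s. (x s)\<^sup>2) / 2)) {0..t}"
  proof (rule has_integral_add)
    show "((\<lambda>s. \<omega>\<^sup>2 / 2) has_integral \<omega>\<^sup>2 / 2 * t) {0..t}"
      using has_integral_const_real[of "\<omega>\<^sup>2 / 2" 0 t] t by (simp add: mult.commute)
    show "((\<lambda>s. (x s)\<^sup>2 / 2) has_integral integral {0..t} (\<lambda>s. (x s)\<^sup>2) / 2) {0..t}"
      by (intro has_integral_divide integrable_integral integrable_continuous_real cx)
  qed
  \<comment> \<open>Young's inequality; half of the integral of \<open>(x s)\<^sup>2\<close> is then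
    absorbed by the left-hand side of \<open>en\<close>.\<close>
  ultimately have "- (\<delta> t \<bullet> r t) \<le> \<omega>\<^sup>2 / 2 * t + integral {0..t} (\<lambda>s. (x s)\<^sup>2) / 2"
  proof (rule has_integral_le)
    fix s assume s: "s \<in> {0..t}"
    have "(w s)\<^sup>2 \<le> \<omega>\<^sup>2" using w[of s] s t by (intro power2_le_iff_abs_le[THEN iffD2]) (auto intro: order_trans[OF abs_ge_zero])
    moreover have "0 \<le> (w s + x s)\<^sup>2" by simp
    ultimately show "- (w s * x s) \<le> \<omega>\<^sup>2 / 2 + (x s)\<^sup>2 / 2" by (simp add: power2_sum)
  qed
  moreover have "(norm (\<delta> t))\<^sup>2 / \<gamma> \<ge> 0" using \<gamma> by simp
  ultimately show "integral {0..t} (\<lambda>s. (m s \<bullet> \<delta> t)\<^sup>2) \<le> t * \<omega>\<^sup>2"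
    using en by (simp add: x_def[symmetric] algebra_simps)
qed

section \<open>Robustness of asymptotic stability\<close>

text \<open>Gronwall for the distance to the exact solution, available while \<open>z\<close> stays
  in the set \<open>U\<close> on which \<open>F\<close> is Lipschitz;
  \<open>stays_in_interior\<close> discharges that proviso. The smallness condition refers to the
  full horizon \<open>T0\<close>, so it serves every shorter \<open>T\<close> at once.\<close>

lemma solution_tube:
  fixes F :: "'a::euclidean_space \<Rightarrow> 'a"
  assumes \<zeta>: "flow_solution F D \<zeta>" and z: "rate_on T z v" and T: "T \<le> T0"
    and L: "L-lipschitz_on U F" and U: "\<And>t x. t \<in> {0..T0} \<Longrightarrow> norm (x - \<zeta> t) \<le> r \<Longrightarrow> x \<in> U"
    and \<mu>: "\<mu> \<ge> 0" "\<And>t. t \<in> {0..T} \<Longrightarrow> norm (v t - F (z t)) \<le> \<mu>"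
    and small: "(norm (z 0 - \<zeta> 0) + \<mu> * T0) * exp (L * T0) < r" and t: "t \<in> {0..T}"
  shows "norm (z t - \<zeta> t) < r"
proof -
  have L0: "L \<ge> 0" using L by (rule lipschitz_on_nonneg)
  have T0: "T0 \<ge> 0" using t T by auto
  have r: "norm (z 0 - \<zeta> 0) < r"
  proof -
    have "norm (z 0 - \<zeta> 0) + \<mu> * T0 \<le> (norm (z 0 - \<zeta> 0) + \<mu> * T0) * exp (L * T0)"
      using mult_left_mono[of 1 "exp (L * T0)" "norm (z 0 - \<zeta> 0) + \<mu> * T0"] L0 T0 \<mu>(1) by simp
    moreover have "\<mu> * T0 \<ge> 0" using \<mu> T0 by simp
    ultimately show ?thesis using small by linarith
  qed
  then have \<zeta>U: "\<zeta> t \<in> U" if "t \<in> {0..T0}" for t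
    using U[OF that, of "\<zeta> t"] norm_ge_zero[of "z 0 - \<zeta> 0"] by simp
  have d\<zeta>: "(\<zeta> has_vector_derivative F (\<zeta> t)) (at t within {0..T})" if "t \<in> {0..T}" for t
    using \<zeta> that unfolding flow_solution_def by (auto intro: has_vector_derivative_within_subset)
  have c\<zeta>: "continuous_on {0..T} \<zeta>"
    unfolding continuous_on_eq_continuous_within using d\<zeta> has_vector_derivative_continuous by blast
  have r\<zeta>: "rate_on T \<zeta> (\<lambda>t. F (\<zeta> t))"
  proof (rule rate_on_has_vector_derivative[OF _ d\<zeta>])
    show "continuous_on {0..T} (\<lambda>t. F (\<zeta> t))"
      by (rule continuous_on_compose2[OF lipschitz_on_continuous_on[OF L] c\<zeta>]) (use \<zeta>U T in auto)
  qed
  define w where "w t = z t - \<zeta> t" for t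
  have rw: "rate_on T w (\<lambda>t. v t - F (\<zeta> t))" unfolding w_def by (rule rate_on_diff[OF z r\<zeta>])
  have "w t \<in> interior (cball 0 r)"
  proof (rule stays_in_interior[OF rate_on_continuous[OF rw] closed_cball _ _ t])
    show "w 0 \<in> cball 0 r" using r by (simp add: w_def)
    fix \<tau> assume \<tau>: "\<tau> \<in> {0..T}" and wb: "\<And>t. t \<in> {0..\<tau>} \<Longrightarrow> w t \<in> cball 0 r"
    have "norm (w \<tau>) \<le> (norm (w 0) + \<mu> * \<tau>) * exp (L * \<tau>)"
    proof (rule rate_on_gronwall[OF rate_on_subset[OF rw] L0 \<mu>(1)])
      fix s assume s: "s \<in> {0..\<tau>}"
      have sT: "s \<in> {0..T}" "s \<in> {0..T0}" using s \<tau> T by auto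
      have "z s \<in> U" by (rule U[OF sT(2)]) (use wb[OF s] in \<open>simp add: w_def\<close>)
      then have "norm (F (z s) - F (\<zeta> s)) \<le> L * norm (w s)"
        using lipschitz_onD[OF L _ \<zeta>U[OF sT(2)], of "z s"] by (simp add: dist_norm w_def)
      moreover have "norm (v s - F (\<zeta> s)) \<le> norm (v s - F (z s)) + norm (F (z s) - F (\<zeta> s))"
        using norm_triangle_ineq[of "v s - F (z s)" "F (z s) - F (\<zeta> s)"] by simp
      ultimately show "norm (v s - F (\<zeta> s)) \<le> L * norm (w s) + \<mu>" using \<mu>(2)[OF sT(1)] by linarith
    qed (use \<tau> in auto)
    also have "\<dots> \<le> (norm (w 0) + \<mu> * T0) * exp (L * T0)"
      using \<tau> T L0 \<mu> T0 by (intro mult_mono add_left_mono mult_left_mono) (auto intro: mult_left_mono)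
    also have "\<dots> < r" using small by (simp add: w_def)
    finally show "w \<tau> \<in> interior (cball 0 r)" by simp
  qed
  then show ?thesis by (simp add: w_def)
qed

lemma finite_positive_lower_bound:
  fixes g :: "'a \<Rightarrow> real"
  assumes "finite C" "\<And>v. v \<in> C \<Longrightarrow> g v > 0"
  obtains m where "m > 0" "\<And>v. v \<in> C \<Longrightarrow> m \<le> g v"
\<comment> \<open>The inserted 1 keeps the minimum meaningful for an empty set.\<close>
proof (rule that[of "Min (insert 1 (g ` C))"])
  show "Min (insert 1 (g ` C)) > 0" using assms by (subst Min_gr_iff) auto
  show "Min (insert 1 (g ` C)) \<le> g v" if "v \<in> C" for v using assms that by (intro Min_le) auto
qed

text \<open>Robustness without a converse Lyapunov theorem: perturbed trajectories are compared with exact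
  solutions over finite horizons only. A finite cover of the initial set brings them near the
  attractor, and there the uniform attraction time \<open>T2\<close> allows restarting the comparison every \<open>T2\<close>.\<close>

lemma total_stability:
  fixes F :: "'a::euclidean_space \<Rightarrow> 'a"
  assumes D: "open D" and lip: "\<And>K. compact K \<Longrightarrow> K \<subseteq> D \<Longrightarrow> \<exists>L. L-lipschitz_on K F"
    and Sig: "compact Sig" "Sig \<noteq> {}" "Sig \<subseteq> D"
    and uas: "uniformly_asymptotically_stable F D Sig"
    and S1: "compact S1" "S1 \<subseteq> region_of_attraction F D Sig"
  obtains K where "compact K" "K \<subseteq> D" "S1 \<subseteq> K"
    "\<And>M. M \<ge> 0 \<Longrightarrow> \<exists>t0>0. \<exists>\<mu>>0. \<forall>T z v. T \<ge> 0 \<longrightarrow> rate_on T z v \<longrightarrow> z 0 \<in> S1 \<longrightarrow>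
      (\<forall>t\<in>{0..T}. norm (v t) \<le> M) \<longrightarrow> (\<forall>t\<in>{0..T}. t0 \<le> t \<longrightarrow> norm (v t - F (z t)) \<le> \<mu>) \<longrightarrow>
      z T \<in> interior K"
proof -
  obtain e1 where e1: "e1 > 0" "{x. infdist x Sig \<le> e1} \<subseteq> D"
    using compact_in_open_separated[OF Sig(2,1) D Sig(3)] by blast
  define N where "N = {x. infdist x Sig \<le> e1}"
  have N: "compact N" unfolding N_def by (rule compact_infdist_le[OF Sig(2,1) e1(1)])
  obtain L2 where L2: "L2-lipschitz_on N F" using lip[OF N] e1(2) unfolding N_def by blast
  have L20: "L2 \<ge> 0" using L2 by (rule lipschitz_on_nonneg)
  have near_int: "x \<in> interior N" if "infdist x Sig < e1" for x
  proof -
    have "open {x. infdist x Sig < e1}"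
      by (intro open_Collect_less continuous_intros)
    then have "{x. infdist x Sig < e1} \<subseteq> interior N" by (rule interior_maximal[rotated]) (auto simp: N_def)
    then show ?thesis using that by blast
  qed
  have "e1 / 2 > 0" using e1 by simp
  with uas[unfolded uniformly_asymptotically_stable_def, THEN conjunct1, THEN spec, of "e1 / 2"]
  obtain d where d: "d > 0" and d': "\<forall>z0. infdist z0 Sig < d \<longrightarrow>
        (\<exists>z. flow_solution F D z \<and> z 0 = z0) \<and>
        (\<forall>z. flow_solution F D z \<and> z 0 = z0 \<longrightarrow> (\<forall>t\<ge>0. infdist (z t) Sig < e1 / 2))" by blast
  have dex: "\<exists>z. flow_solution F D z \<and> z 0 = z0" if "infdist z0 Sig < d" for z0
    using d' that by blast
  have dst: "infdist (z t) Sig < e1 / 2" if "infdist (z 0) Sig < d" "flow_solution F D z" "t \<ge> 0" for z t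
    using d' that by blast
  from uas[unfolded uniformly_asymptotically_stable_def] obtain c where c: "c > 0"
    "\<And>e. e > 0 \<Longrightarrow> \<exists>T>0. \<forall>z. flow_solution F D z \<and> infdist (z 0) Sig < c \<longrightarrow> (\<forall>t\<ge>T. infdist (z t) Sig < e)"
    by blast
  \<comment> \<open>Within distance \<open>d1\<close> both halves of the stability definition apply:
    exact solutions exist and stay within \<open>e1 / 2\<close>, and they are attracted
    uniformly.\<close>
  define d1 where "d1 = min d c"
  have d1: "d1 > 0" "d1 \<le> d" "d1 \<le> c" using d c by (auto simp: d1_def)
  have "d1 / 2 > 0" using d1 by simp
  from c(2)[OF this] obtain T2 where T2: "T2 > 0" and T2': "\<forall>z. flow_solution F D z \<and> infdist (z 0) Sig < c \<longrightarrow>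
      (\<forall>t\<ge>T2. infdist (z t) Sig < d1 / 2)" by blast
  have near: "infdist x Sig < e1 / 2" if x: "infdist x Sig < d1" for x
  proof -
    obtain z where "flow_solution F D z" "z 0 = x" using dex[of x] x d1 by auto
    then show ?thesis using dst[of z 0] x d1 by auto
  qed
  \<comment> \<open>The tracking tolerance near the attractor: added to \<open>e1 / 2\<close> it
    keeps the trajectory in \<open>N\<close>, and added to \<open>d1 / 2\<close> it leaves the
    distance below \<open>d1\<close>, so that the comparison can restart.\<close>
  define r2 where "r2 = min (e1 / 2) (d1 / 2)"
  have r2: "r2 > 0" "r2 \<le> e1 / 2" "r2 \<le> d1 / 2" using e1 d1 by (auto simp: r2_def)
  have "\<exists>\<zeta> Tv r L U. flow_solution F D \<zeta> \<and> \<zeta> 0 = v \<and> Tv \<ge> 0 \<and> infdist (\<zeta> Tv) Sig < d1 / 2 \<and>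
      0 < r \<and> r \<le> d1 / 2 \<and> compact U \<and> U \<subseteq> D \<and> (\<forall>t\<in>{0..Tv}. \<forall>x. norm (x - \<zeta> t) \<le> r \<longrightarrow> x \<in> U) \<and>
      L-lipschitz_on U F" if v: "v \<in> S1" for v
  proof -
    obtain \<zeta> where \<zeta>: "flow_solution F D \<zeta>" "\<zeta> 0 = v" "((\<lambda>t. infdist (\<zeta> t) Sig) \<longlongrightarrow> 0) at_top"
      using v S1(2) unfolding region_of_attraction_def by blast
    have "eventually (\<lambda>t. infdist (\<zeta> t) Sig < d1 / 2) at_top"
      by (rule order_tendstoD(2)[OF \<zeta>(3)]) (use d1 in simp)
    then have "eventually (\<lambda>t. infdist (\<zeta> t) Sig < d1 / 2 \<and> t \<ge> 0) at_top"
      using eventually_ge_at_top[of 0] by (rule eventually_conj)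
    then obtain Tv where Tv: "Tv \<ge> 0" "infdist (\<zeta> Tv) Sig < d1 / 2"
      using eventually_happens by fastforce
    have "continuous_on {0..Tv} \<zeta>"
      unfolding continuous_on_eq_continuous_within
    proof
      fix t assume "t \<in> {0..Tv}"
      then have "(\<zeta> has_vector_derivative F (\<zeta> t)) (at t within {0..Tv})"
        using \<zeta>(1) unfolding flow_solution_def by (auto intro: has_vector_derivative_within_subset)
      then show "continuous (at t within {0..Tv}) \<zeta>" by (rule has_vector_derivative_continuous)
    qed
    then have comp: "compact (\<zeta> ` {0..Tv})" by (rule compact_continuous_image) simp
    have ne: "\<zeta> ` {0..Tv} \<noteq> {}" using Tv by simp
    have sub: "\<zeta> ` {0..Tv} \<subseteq> D" using \<zeta>(1) by (auto simp: flow_solution_def)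
    obtain r where r: "r > 0" "{x. infdist x (\<zeta> ` {0..Tv}) \<le> r} \<subseteq> D"
      using compact_in_open_separated[OF ne comp D sub] by blast
    define r' where "r' = min r (d1 / 2)"
    define U where "U = {x. infdist x (\<zeta> ` {0..Tv}) \<le> r}"
    have U: "compact U" unfolding U_def by (rule compact_infdist_le[OF ne comp r(1)])
    obtain L where "L-lipschitz_on U F" using lip[OF U] r(2) unfolding U_def by blast
    moreover have "\<forall>t\<in>{0..Tv}. \<forall>x. norm (x - \<zeta> t) \<le> r' \<longrightarrow> x \<in> U"
    proof (intro ballI allI impI)
      fix t x assume t: "t \<in> {0..Tv}" and x: "norm (x - \<zeta> t) \<le> r'"
      have "infdist x (\<zeta> ` {0..Tv}) \<le> dist x (\<zeta> t)" using t by (intro infdist_le) auto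
      then show "x \<in> U" using x by (simp add: U_def r'_def dist_norm)
    qed
    ultimately show ?thesis
      using \<zeta> Tv U r d1 unfolding U_def[symmetric]
      by (intro exI[of _ \<zeta>] exI[of _ Tv] exI[of _ r'] exI[of _ L] exI[of _ U]) (auto simp: r'_def)
  qed
  then obtain \<zeta> Tv r L U where tube: "\<And>v. v \<in> S1 \<Longrightarrow> flow_solution F D (\<zeta> v) \<and> \<zeta> v 0 = v \<and> Tv v \<ge> 0 \<and>
      infdist (\<zeta> v (Tv v)) Sig < d1 / 2 \<and>
      0 < r v \<and> r v \<le> d1 / 2 \<and> compact (U v) \<and> U v \<subseteq> D \<and> (\<forall>t\<in>{0..Tv v}. \<forall>x. norm (x - \<zeta> v t) \<le> r v \<longrightarrow> x \<in> U v) \<and>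
      (L v)-lipschitz_on (U v) F" by metis
  \<comment> \<open>The radius \<open>r v\<close> pulled back by the Gronwall factor and divided
    into four shares: one for the covering ball, one for the drift before \<open>t0\<close>, one for
    the accumulated perturbation, and one as slack.\<close>
  define \<rho> where "\<rho> v = r v * exp (- (L v * Tv v)) / 4" for v
  have \<rho>: "\<rho> v > 0" "4 * \<rho> v \<le> r v" "4 * \<rho> v * exp (L v * Tv v) = r v" if "v \<in> S1" for v
  proof -
    have "L v \<ge> 0" using tube[OF that] lipschitz_on_nonneg by blast
    then show "\<rho> v > 0" "4 * \<rho> v \<le> r v" "4 * \<rho> v * exp (L v * Tv v) = r v"
      using tube[OF that] by (auto simp: \<rho>_def exp_minus field_simps mult_le_cancel_left1)
  qed
  obtain C where C: "C \<subseteq> S1" "finite C" "S1 \<subseteq> (\<Union>v\<in>C. ball v (\<rho> v))"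
    by (rule compactE_image[OF S1(1), of S1 "\<lambda>v. ball v (\<rho> v)"]) (use \<rho> in auto)
  define K where "K = N \<union> (\<Union>v\<in>C. U v)"
  have UK: "x \<in> interior K" if "v \<in> C" "t \<in> {0..Tv v}" "norm (x - \<zeta> v t) < r v" for v t x
  proof -
    have "ball (\<zeta> v t) (r v) \<subseteq> K"
      using tube[of v] that C(1) unfolding K_def by (force simp: dist_norm norm_minus_commute)
    then have "ball (\<zeta> v t) (r v) \<subseteq> interior K" by (rule interior_maximal) simp
    then show ?thesis using that by (auto simp: dist_norm norm_minus_commute)
  qed
  have NK: "interior N \<subseteq> interior K" unfolding K_def by (intro interior_mono) auto
  show ?thesis
  proof (rule that[of K])
    show "compact K" unfolding K_def using N C tube by (intro compact_Un compact_UN) auto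
    show "K \<subseteq> D" unfolding K_def N_def using e1 tube C by blast
    show "S1 \<subseteq> K"
    proof
      fix x assume "x \<in> S1"
      then obtain v where v: "v \<in> C" "x \<in> ball v (\<rho> v)" using C by blast
      then have "norm (x - \<zeta> v 0) < r v"
        using \<rho>[of v] tube[of v] C(1) by (auto simp: dist_norm norm_minus_commute)
      then have "x \<in> interior K" using UK[OF v(1), of 0 x] tube[of v] v(1) C(1) by auto
      then show "x \<in> K" using interior_subset by blast
    qed
    \<comment> \<open>The set \<open>K\<close> is fixed before the speed bound, so that the speed
      bound may later be computed from \<open>K\<close>.\<close>
    fix M :: real assume M: "M \<ge> 0"
    \<comment> \<open>At speed at most M a trajectory drifts no more than one share
      \<open>\<rho> v\<close> until \<open>t0\<close>, whatever the field does; the summand 1 avoids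
      division by zero.\<close>
    obtain t0 where t0: "t0 > 0" "\<And>v. v \<in> C \<Longrightarrow> t0 \<le> \<rho> v / (M + 1)"
      by (rule finite_positive_lower_bound[OF C(2), of "\<lambda>v. \<rho> v / (M + 1)"]) (use \<rho> C M in auto)
    obtain \<mu>1 where \<mu>1: "\<mu>1 > 0" "\<And>v. v \<in> C \<Longrightarrow> \<mu>1 \<le> \<rho> v / (Tv v + 1)"
      by (rule finite_positive_lower_bound[OF C(2), of "\<lambda>v. \<rho> v / (Tv v + 1)"])
        (use \<rho> C tube in \<open>auto intro!: divide_pos_pos add_nonneg_pos\<close>)
    \<comment> \<open>The first term limits the perturbation accumulated on the way from
      \<open>S1\<close> to one share \<open>\<rho> v\<close>; the second keeps a comparison over one
      period \<open>T2\<close> that starts without error below \<open>r2 / 2\<close>.\<close>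
    define \<mu> where "\<mu> = min \<mu>1 (r2 * exp (- (L2 * T2)) / (2 * T2))"
    have \<mu>: "\<mu> > 0" using \<mu>1 r2 T2 by (simp add: \<mu>_def)
    have \<mu>2: "(\<mu> * T2) * exp (L2 * T2) < r2"
    proof -
      have "\<mu> \<le> r2 * exp (- (L2 * T2)) / (2 * T2)" by (simp add: \<mu>_def)
      then have "\<mu> * T2 \<le> r2 * exp (- (L2 * T2)) / 2" using T2 by (simp add: field_simps)
      then have "\<mu> * T2 * exp (L2 * T2) \<le> r2 * exp (- (L2 * T2)) / 2 * exp (L2 * T2)"
        by (rule mult_right_mono) simp
      also have "\<dots> = r2 / 2" by (simp add: exp_minus)
      finally show ?thesis using r2 by linarith
    qed
    show "\<exists>t0>0. \<exists>\<mu>>0. \<forall>T z v. T \<ge> 0 \<longrightarrow> rate_on T z v \<longrightarrow> z 0 \<in> S1 \<longrightarrow>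
      (\<forall>t\<in>{0..T}. norm (v t) \<le> M) \<longrightarrow> (\<forall>t\<in>{0..T}. t0 \<le> t \<longrightarrow> norm (v t - F (z t)) \<le> \<mu>) \<longrightarrow>
      z T \<in> interior K"
    proof (rule exI[of _ t0], rule conjI[OF t0(1)], rule exI[of _ \<mu>], rule conjI[OF \<mu>], intro allI impI)
      fix T z v
      assume T: "T \<ge> 0" and rz: "rate_on T z v" and z0: "z 0 \<in> S1"
        and vM: "\<forall>t\<in>{0..T}. norm (v t) \<le> M" and v\<mu>: "\<forall>t\<in>{0..T}. t0 \<le> t \<longrightarrow> norm (v t - F (z t)) \<le> \<mu>"
      \<comment> \<open>Induction on the number of remaining periods. Each period is compared with a
        new exact solution that starts at the current state of \<open>z\<close>, so errors do not
        accumulate over time.\<close>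
      have restart: "z T \<in> interior K" if "t0 \<le> s" "s \<le> T" "infdist (z s) Sig < d1" "T - s \<le> real n * T2" for n s
        using that
      proof (induction n arbitrary: s)
        case 0
        then have "s = T" by simp
        then have "infdist (z T) Sig < e1" using near[of "z s"] 0 e1 by auto
        then show ?case using near_int NK by blast
      next
        case (Suc n)
        obtain \<xi> where \<xi>: "flow_solution F D \<xi>" "\<xi> 0 = z s" using dex[of "z s"] Suc.prems d1 by auto
        have \<xi>e: "infdist (\<xi> t) Sig < e1 / 2" if "t \<ge> 0" for t
          using dst[of \<xi> t] \<xi> Suc.prems d1 that by auto
        have s0: "0 \<le> s" using Suc.prems t0 by simp
        have clos: "norm (z (s + t) - \<xi> t) < r2" if t: "t \<in> {0..min (T - s) T2}" for t
        proof (rule solution_tube[where z = "\<lambda>t. z (s + t)" and \<zeta> = \<xi> and T = "min (T - s) T2"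
              and ?T0.0 = T2 and L = L2 and \<mu> = \<mu>, OF \<xi>(1) _ _ L2])
          show "rate_on (min (T - s) T2) (\<lambda>t. z (s + t)) (\<lambda>t. v (s + t))"
            by (rule rate_on_subset[OF rate_on_shift[OF rz s0 Suc.prems(2)]]) simp
        next
          fix t x assume t: "t \<in> {0..T2}" and x: "norm (x - \<xi> t) \<le> r2"
          have "infdist x Sig \<le> infdist (\<xi> t) Sig + dist x (\<xi> t)" by (rule infdist_triangle)
          then show "x \<in> N" using \<xi>e[of t] t x r2 by (simp add: N_def dist_norm)
        next
          fix t assume "t \<in> {0..min (T - s) T2}"
          then show "norm (v (s + t) - F (z (s + t))) \<le> \<mu>" using v\<mu> Suc.prems s0 by auto
        qed (use \<mu> \<mu>2 \<xi>(2) t in auto)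
        show ?case
        proof (cases "T - s \<le> T2")
          case True
          have "infdist (z T) Sig \<le> infdist (\<xi> (T - s)) Sig + dist (z T) (\<xi> (T - s))" by (rule infdist_triangle)
          then have "infdist (z T) Sig < e1"
            using clos[of "T - s"] True Suc.prems \<xi>e[of "T - s"] r2 by (simp add: dist_norm)
          then show ?thesis using near_int NK by blast
        next
          case False
          have "infdist (z (s + T2)) Sig \<le> infdist (\<xi> T2) Sig + dist (z (s + T2)) (\<xi> T2)" by (rule infdist_triangle)
          moreover have "infdist (\<xi> T2) Sig < d1 / 2" using T2' \<xi> Suc.prems d1 by auto
          moreover have "dist (z (s + T2)) (\<xi> T2) < d1 / 2"
            using clos[of T2] False T2 r2 by (simp add: dist_norm)
          ultimately have "infdist (z (s + T2)) Sig < d1" by linarith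
          then show ?thesis
            by (intro Suc.IH[of "s + T2"]) (use False Suc.prems T2 in \<open>auto simp: algebra_simps\<close>)
        qed
      qed
      obtain q where q: "q \<in> C" "z 0 \<in> ball q (\<rho> q)" using z0 C by blast
      then have qS: "q \<in> S1" using C by blast
      note tq = tube[OF qS] and \<rho>q = \<rho>[OF qS]
      have start: "norm (z t - q) < 2 * \<rho> q" if t: "0 \<le> t" "t \<le> t0" "t \<le> T" for t
      proof -
        have "norm (z t - z 0) \<le> M * (t - 0)"
          by (rule rate_on_increment_le[OF rz]) (use vM t in auto)
        also have "\<dots> \<le> (M + 1) * t0" using M t t0 by (intro mult_mono) auto
        also have "\<dots> \<le> \<rho> q" using t0(2)[OF q(1)] M by (simp add: field_simps)
        finally have "norm (z t - z 0) \<le> \<rho> q" .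
        moreover have "norm (z 0 - q) < \<rho> q" using q(2) by (simp add: dist_norm norm_minus_commute)
        ultimately show ?thesis using norm_triangle_ineq[of "z t - z 0" "z 0 - q"] by simp
      qed
      show "z T \<in> interior K"
      proof (cases "T \<le> t0")
        case True
        then have "norm (z T - \<zeta> q 0) < r q" using start[of T] T tq \<rho>q by simp
        then show ?thesis using UK[OF q(1), of 0] tq by simp
      next
        case False
        then have tT: "t0 \<le> T" by simp
        have \<mu>T: "\<mu> * Tv q \<le> \<rho> q"
        proof -
          have "\<mu> \<le> \<rho> q / (Tv q + 1)" using \<mu>1(2)[OF q(1)] by (simp add: \<mu>_def)
          then have "\<mu> * (Tv q + 1) \<le> \<rho> q" using tq by (simp add: field_simps)
          then show ?thesis using \<mu> by (simp add: algebra_simps)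
        qed
        have small: "(norm (z (t0 + 0) - \<zeta> q 0) + \<mu> * Tv q) * exp (L q * Tv q) < r q"
        proof -
          have "norm (z (t0 + 0) - \<zeta> q 0) + \<mu> * Tv q < 4 * \<rho> q"
            using start[of t0] t0 tT tq \<mu>T \<rho>q(1) by simp
          then have "(norm (z (t0 + 0) - \<zeta> q 0) + \<mu> * Tv q) * exp (L q * Tv q) < 4 * \<rho> q * exp (L q * Tv q)"
            by (rule mult_strict_right_mono) simp
          then show ?thesis using \<rho>q(3) by simp
        qed
        have clos: "norm (z (t0 + t) - \<zeta> q t) < r q" if t: "t \<in> {0..min (T - t0) (Tv q)}" for t
        proof (rule solution_tube[where z = "\<lambda>t. z (t0 + t)" and \<zeta> = "\<zeta> q" and T = "min (T - t0) (Tv q)"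
              and ?T0.0 = "Tv q" and L = "L q" and \<mu> = \<mu>])
          show "rate_on (min (T - t0) (Tv q)) (\<lambda>t. z (t0 + t)) (\<lambda>t. v (t0 + t))"
            by (rule rate_on_subset[OF rate_on_shift[OF rz less_imp_le[OF t0(1)] tT]]) simp
          show "flow_solution F D (\<zeta> q)" "(L q)-lipschitz_on (U q) F" using tq by auto
          show "x \<in> U q" if "t \<in> {0..Tv q}" "norm (x - \<zeta> q t) \<le> r q" for t x using tq that by blast
          fix t assume "t \<in> {0..min (T - t0) (Tv q)}"
          then show "norm (v (t0 + t) - F (z (t0 + t))) \<le> \<mu>" using v\<mu> t0 by auto
        qed (use \<mu> small t in auto)
        show ?thesis
        proof (cases "T - t0 \<le> Tv q")
          case True
          then have "norm (z T - \<zeta> q (T - t0)) < r q" using clos[of "T - t0"] tT by simp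
          then show ?thesis using UK[OF q(1), of "T - t0"] True tT by simp
        next
          case F2: False
          have "infdist (z (t0 + Tv q)) Sig \<le> infdist (\<zeta> q (Tv q)) Sig + dist (z (t0 + Tv q)) (\<zeta> q (Tv q))"
            by (rule infdist_triangle)
          moreover have "dist (z (t0 + Tv q)) (\<zeta> q (Tv q)) < d1 / 2"
            using clos[of "Tv q"] F2 tq by (simp add: dist_norm)
          ultimately have near1: "infdist (z (t0 + Tv q)) Sig < d1" using tq by linarith
          obtain n :: nat where "(T - (t0 + Tv q)) / T2 \<le> real n" using real_arch_simple by blast
          then have "T - (t0 + Tv q) \<le> real n * T2" using T2 by (simp add: field_simps)
          then show ?thesis using restart[OF _ _ near1, of n] tq F2 by simp
        qed
      qed
    qed
  qed
qed

section \<open>The adaptive observer\<close>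

definition gain_vec :: "(nat \<Rightarrow> real) \<Rightarrow> real \<Rightarrow> real^'n::{finite,linorder}" where
  "gain_vec \<kappa> \<epsilon> = (\<chi> i. \<kappa> (pos i) / \<epsilon> ^ pos i)"

text \<open>The regressor of the least squares law: the single row of C E, stored as a
  vector.\<close>

definition innov :: "('m option \<Rightarrow> real^'n::{finite,linorder}) \<Rightarrow> real^'m" where
  "innov xh = (\<chi> j. (xh None - xh (Some j)) $ coord 1)"

lemma sum_option: "(\<Sum>i\<in>(UNIV :: 'm::finite option set). f i) = f None + (\<Sum>j\<in>UNIV. f (Some j))"
  by (simp add: UNIV_option_conv sum.reindex)

text \<open>Because the weights sum to one, the combined estimate is the last estimate minus E
  \<beta>; in this form its dependence on \<beta> is explicit.\<close>

lemma weighted_estimate_alt: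
  "weighted_estimate \<beta> xh = xh None - (\<Sum>j\<in>UNIV. \<beta> $ j *\<^sub>R (xh None - xh (Some j)))"
  unfolding weighted_estimate_def sum_option
  by (simp add: weight_def algebra_simps sum.distrib sum_subtractf scaleR_sum_left)

lemma inner_innov: "innov xh \<bullet> b = (\<Sum>j\<in>UNIV. b $ j *\<^sub>R (xh None - xh (Some j))) $ coord 1"
  by (simp add: innov_def inner_vec_def mult.commute)

lemma weighted_estimate_diff:
  "weighted_estimate \<beta>' xh - weighted_estimate \<beta> xh = (\<Sum>j\<in>UNIV. (\<beta> - \<beta>') $ j *\<^sub>R (xh None - xh (Some j)))"
  unfolding weighted_estimate_alt by (simp add: algebra_simps sum_subtractf sum.distrib)

text \<open>One pair of constants serves all \<epsilon>, because the scaled linear part does not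
  contain \<epsilon>; returning to the original time only speeds up the decay. The norm of the gain
  vector in front of the noise is absorbed into \<open>C\<close>.\<close>

lemma observer_error_bound:
  assumes "hurwitz_coeffs CARD('n::{finite,linorder}) \<kappa>"
  obtains C a where "C \<ge> 1" "a > 0"
    "\<And>T (e :: real \<Rightarrow> real^'n::{finite,linorder}) \<phi> \<nu> \<epsilon> kf nb t. 0 < \<epsilon> \<Longrightarrow> \<epsilon> \<le> 1 \<Longrightarrow>
      rate_on T e (\<lambda>t. chain_A *v e t + \<phi> t *\<^sub>R axis (coord CARD('n)) 1
        - (e t $ coord 1 + \<nu> t) *\<^sub>R gain_vec \<kappa> \<epsilon>) \<Longrightarrow>
      (\<And>t. t \<in> {0..T} \<Longrightarrow> \<bar>\<phi> t\<bar> \<le> kf) \<Longrightarrow> (\<And>t. t \<in> {0..T} \<Longrightarrow> \<bar>\<nu> t\<bar> \<le> nb) \<Longrightarrow> t \<in> {0..T} \<Longrightarrow>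
      norm (gain_scale \<epsilon> (e t)) \<le> C * (exp (- a * t / \<epsilon>) * norm (gain_scale \<epsilon> (e 0)) + \<epsilon> ^ CARD('n) * kf + nb)"
proof -
  obtain C a where C: "C \<ge> 1" and a: "a > 0" and
    iss: "\<And>T (z :: real \<Rightarrow> real^'n::{finite,linorder}) d \<delta> t. rate_on T z (\<lambda>t. chain_op \<kappa> (z t) + d t) \<Longrightarrow>
      (\<And>t. t \<in> {0..T} \<Longrightarrow> norm (d t) \<le> \<delta>) \<Longrightarrow> t \<in> {0..T} \<Longrightarrow>
      norm (z t) \<le> C * (exp (- a * t) * norm (z 0) + \<delta>)"
    by (rule hurwitz_chain_iss[OF assms]) blast
  define k where "k = norm (\<chi> i::'n. \<kappa> (pos i))"
  have k: "k \<ge> 0" by (simp add: k_def)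
  show ?thesis
  proof (rule that[of "C * (1 + k)" a])
    show "C * (1 + k) \<ge> 1" using mult_mono[of 1 C 1 "1 + k"] C k by simp
    fix T and e :: "real \<Rightarrow> (real, 'n) vec" and \<phi> \<nu> :: "real \<Rightarrow> real" and \<epsilon> kf nb t :: real
    assume \<epsilon>: "0 < \<epsilon>" "\<epsilon> \<le> 1" and r: "rate_on T e (\<lambda>t. chain_A *v e t + \<phi> t *\<^sub>R axis (coord CARD('n)) 1
        - (e t $ coord 1 + \<nu> t) *\<^sub>R gain_vec \<kappa> \<epsilon>)"
      and \<phi>: "\<And>t. t \<in> {0..T} \<Longrightarrow> \<bar>\<phi> t\<bar> \<le> kf" and \<nu>: "\<And>t. t \<in> {0..T} \<Longrightarrow> \<bar>\<nu> t\<bar> \<le> nb" and t: "t \<in> {0..T}"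
    have nn: "kf \<ge> 0" "nb \<ge> 0" using \<phi>[OF t] \<nu>[OF t] by linarith+
    have "norm (gain_scale \<epsilon> (e (\<epsilon> * (t / \<epsilon>)))) \<le>
      C * (exp (- a * (t / \<epsilon>)) * norm (gain_scale \<epsilon> (e (\<epsilon> * 0))) + (\<epsilon> ^ CARD('n) * kf + nb * k))"
    proof (rule iss[OF observer_error_rescaled[OF r[unfolded gain_vec_def] \<epsilon>(1)]])
      fix s assume s: "s \<in> {0..T / \<epsilon>}"
      then have sT: "\<epsilon> * s \<in> {0..T}" using \<epsilon> by (auto simp: field_simps)
      have "norm ((\<epsilon> ^ CARD('n) * \<phi> (\<epsilon> * s)) *\<^sub>R axis (coord CARD('n)) (1::real) - \<nu> (\<epsilon> * s) *\<^sub>R (\<chi> i::'n. \<kappa> (pos i)))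
         \<le> \<epsilon> ^ CARD('n) * \<bar>\<phi> (\<epsilon> * s)\<bar> + \<bar>\<nu> (\<epsilon> * s)\<bar> * k"
        using \<epsilon> by (intro norm_triangle_le_diff) (auto simp: k_def abs_mult norm_axis_1)
      also have "\<dots> \<le> \<epsilon> ^ CARD('n) * kf + nb * k"
        using \<phi>[OF sT] \<nu>[OF sT] \<epsilon> k by (intro add_mono mult_left_mono mult_right_mono) auto
      finally show "norm ((\<epsilon> ^ CARD('n) * \<phi> (\<epsilon> * s)) *\<^sub>R axis (coord CARD('n)) (1::real) - \<nu> (\<epsilon> * s) *\<^sub>R (\<chi> i::'n. \<kappa> (pos i)))
         \<le> \<epsilon> ^ CARD('n) * kf + nb * k" .
    qed (use t \<epsilon> in \<open>auto simp: field_simps\<close>)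
    also have "\<dots> \<le> C * ((1 + k) * (exp (- a * (t / \<epsilon>)) * norm (gain_scale \<epsilon> (e 0)) + \<epsilon> ^ CARD('n) * kf + nb))"
      using C k nn \<epsilon> by (intro mult_left_mono) (simp_all add: algebra_simps)
    finally show "norm (gain_scale \<epsilon> (e t)) \<le> C * (1 + k) *
        (exp (- a * t / \<epsilon>) * norm (gain_scale \<epsilon> (e 0)) + \<epsilon> ^ CARD('n) * kf + nb)"
      using \<epsilon> by simp
  qed (rule a)
qed

text \<open>A unit of scaled time is a time \<epsilon> of the plant, and the measured coordinate is
  unscaled, so the output energy merely picks up the factor 1 / \<epsilon>.\<close>

lemma observer_observability:
  obtains C where "C > 0"
    "\<And>T (e :: real \<Rightarrow> real^'n::{finite,linorder}) \<epsilon>. 0 < \<epsilon> \<Longrightarrow> \<epsilon> \<le> T \<Longrightarrow>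
      rate_on T e (\<lambda>t. chain_A *v e t - (e t $ coord 1) *\<^sub>R gain_vec \<kappa> \<epsilon>) \<Longrightarrow>
      (norm (gain_scale \<epsilon> (e 0)))\<^sup>2 \<le> C * (integral {0..\<epsilon>} (\<lambda>t. (e t $ coord 1)\<^sup>2) / \<epsilon>)"
proof -
  have lc: "linear (\<lambda>z :: real^'n::{finite,linorder}. z $ coord 1)" by (rule linearI) auto
  obtain C where C: "C > 0" and ob: "\<And>z :: real \<Rightarrow> real^'n::{finite,linorder}. rate_on 1 z (\<lambda>t. chain_op \<kappa> (z t)) \<Longrightarrow>
      (norm (z 0))\<^sup>2 \<le> C * integral {0..1} (\<lambda>t. (z t $ coord 1)\<^sup>2)"
  proof (rule observability_estimate[where A = "chain_op \<kappa>" and c = "\<lambda>z :: real^'n::{finite,linorder}. z $ coord 1",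
        OF linear_chain_op lc])
    fix z :: "real \<Rightarrow> real^'n::{finite,linorder}"
    assume "rate_on 1 z (\<lambda>t. chain_op \<kappa> (z t))" "\<And>t. t \<in> {0..1} \<Longrightarrow> z t $ coord 1 = 0"
    then show "z 0 = 0" by (rule chain_op_observable)
  qed blast
  show ?thesis
  proof (rule that[OF C])
    fix T and e :: "real \<Rightarrow> real^'n::{finite,linorder}" and \<epsilon> :: real
    assume \<epsilon>: "0 < \<epsilon>" "\<epsilon> \<le> T" and r: "rate_on T e (\<lambda>t. chain_A *v e t - (e t $ coord 1) *\<^sub>R gain_vec \<kappa> \<epsilon>)"
    have "rate_on (T / \<epsilon>) (\<lambda>s. gain_scale \<epsilon> (e (\<epsilon> * s))) (\<lambda>s. chain_op \<kappa> (gain_scale \<epsilon> (e (\<epsilon> * s))))"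
      using observer_error_rescaled[of T e "\<lambda>_. 0" "\<lambda>_. 0" \<kappa> \<epsilon>] r \<epsilon> by (simp add: gain_vec_def)
    then have r1: "rate_on 1 (\<lambda>s. gain_scale \<epsilon> (e (\<epsilon> * s))) (\<lambda>s. chain_op \<kappa> (gain_scale \<epsilon> (e (\<epsilon> * s))))"
      by (rule rate_on_subset) (use \<epsilon> in simp)
    have c: "continuous_on {0..\<epsilon>} (\<lambda>t. (e t $ coord 1)\<^sup>2)"
      by (intro continuous_intros bounded_linear.continuous_on[OF bounded_linear_vec_nth]
          continuous_on_subset[OF rate_on_continuous[OF r]]) (use \<epsilon> in auto)
    have "((\<lambda>t. (e t $ coord 1)\<^sup>2) has_integral integral {0..\<epsilon>} (\<lambda>t. (e t $ coord 1)\<^sup>2)) {0..\<epsilon>}"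
      by (intro integrable_integral integrable_continuous_real c)
    from has_integral_stretch_real[OF this, of \<epsilon>] \<epsilon>
    have "((\<lambda>s. (e (\<epsilon> * s) $ coord 1)\<^sup>2) has_integral (integral {0..\<epsilon>} (\<lambda>t. (e t $ coord 1)\<^sup>2) / \<epsilon>)) ((\<lambda>x. x / \<epsilon>) ` {0..\<epsilon>})"
      by simp
    moreover have "(\<lambda>x. x / \<epsilon>) ` {0..\<epsilon>} = {0..1}"
      using image_divide_atLeastAtMost[of \<epsilon> 0 \<epsilon>] \<epsilon> by simp
    ultimately show "(norm (gain_scale \<epsilon> (e 0)))\<^sup>2 \<le> C * (integral {0..\<epsilon>} (\<lambda>t. (e t $ coord 1)\<^sup>2) / \<epsilon>)"
      using ob[OF r1] by (simp add: has_integral_iff)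
  qed
qed

text \<open>Plant nonlinearity and controller are hidden in the scalar signal \<open>\<phi>\<close>,
  so that the observer estimates can work with a bound on it alone.\<close>

definition adaptive_observer ::
  "(nat \<Rightarrow> real) \<Rightarrow> real \<Rightarrow> real^'m \<Rightarrow> real \<Rightarrow> (real \<Rightarrow> real) \<Rightarrow> real \<Rightarrow> (real \<Rightarrow> real^'n::{finite,linorder}) \<Rightarrow> (real \<Rightarrow> real) \<Rightarrow>
   (real \<Rightarrow> 'm option \<Rightarrow> real^'n::{finite,linorder}) \<Rightarrow> (real \<Rightarrow> real^'m) \<Rightarrow> (real \<Rightarrow> real^'m^'m) \<Rightarrow> bool" where
  "adaptive_observer \<kappa> \<gamma> \<beta>0 \<epsilon> \<nu> T x \<phi> xh \<beta> P \<longleftrightarrow>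
     rate_on T x (\<lambda>t. chain_A *v x t + \<phi> t *\<^sub>R axis (coord CARD('n)) 1) \<and>
     (\<forall>i. rate_on T (\<lambda>t. xh t i) (\<lambda>t. chain_A *v xh t i + (x t $ coord 1 + \<nu> t - xh t i $ coord 1) *\<^sub>R gain_vec \<kappa> \<epsilon>)) \<and>
     rate_on T \<beta> (\<lambda>t. - ((x t $ coord 1 + \<nu> t - xh t None $ coord 1 + innov (xh t) \<bullet> \<beta> t) *\<^sub>R (P t *v innov (xh t)))) \<and>
     rate_on T P (\<lambda>t. - (P t ** outer (innov (xh t)) ** P t)) \<and>
     \<beta> 0 = \<beta>0 \<and> P 0 = \<gamma> *\<^sub>R mat 1"

text \<open>Constant weights of sum one count the output injection exactly once, so the combination
  obeys the equation of a single observer. It is used with the initial weights and, with indicator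
  weights, for single estimates.\<close>

lemma combined_error_rate:
  fixes x :: "real \<Rightarrow> real^'n::{finite,linorder}" and xh :: "real \<Rightarrow> 'm::finite option \<Rightarrow> real^'n::{finite,linorder}"
  assumes rx: "rate_on T x (\<lambda>t. chain_A *v x t + \<phi> t *\<^sub>R axis (coord CARD('n)) 1)"
    and rxh: "\<And>i. rate_on T (\<lambda>t. xh t i) (\<lambda>t. chain_A *v xh t i + (x t $ coord 1 + \<nu> t - xh t i $ coord 1) *\<^sub>R gain_vec \<kappa> \<epsilon>)"
    and c: "sum c UNIV = 1"
  shows "rate_on T (\<lambda>t. x t - (\<Sum>i\<in>UNIV. c i *\<^sub>R xh t i))
     (\<lambda>t. chain_A *v (x t - (\<Sum>i\<in>UNIV. c i *\<^sub>R xh t i)) + \<phi> t *\<^sub>R axis (coord CARD('n)) 1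
        - ((x t - (\<Sum>i\<in>UNIV. c i *\<^sub>R xh t i)) $ coord 1 + \<nu> t) *\<^sub>R gain_vec \<kappa> \<epsilon>)"
proof -
  define G where "G z = chain_A *v z - (z $ coord 1) *\<^sub>R gain_vec \<kappa> \<epsilon>" for z :: "(real, 'n) vec"
  have G: "linear G" unfolding G_def
    by (rule linearI) (simp_all add: matrix_vector_right_distrib matrix_vector_mult_scaleR algebra_simps)
  have r1: "rate_on T (\<lambda>t. x t - (\<Sum>i\<in>UNIV. c i *\<^sub>R xh t i)) (\<lambda>t. (chain_A *v x t + \<phi> t *\<^sub>R axis (coord CARD('n)) 1) -
      (\<Sum>i\<in>UNIV. c i *\<^sub>R (chain_A *v xh t i + (x t $ coord 1 + \<nu> t - xh t i $ coord 1) *\<^sub>R gain_vec \<kappa> \<epsilon>)))"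
    by (intro rate_on_diff rx rate_on_sum rate_on_scaleR rxh) auto
  have eqS: "(\<Sum>i\<in>UNIV. c i *\<^sub>R (chain_A *v xh t i + (x t $ coord 1 + \<nu> t - xh t i $ coord 1) *\<^sub>R gain_vec \<kappa> \<epsilon>))
      = G (\<Sum>i\<in>UNIV. c i *\<^sub>R xh t i) + (x t $ coord 1 + \<nu> t) *\<^sub>R gain_vec \<kappa> \<epsilon>" for t
  proof -
    have "(\<Sum>i\<in>UNIV. c i *\<^sub>R (chain_A *v xh t i + (x t $ coord 1 + \<nu> t - xh t i $ coord 1) *\<^sub>R gain_vec \<kappa> \<epsilon>))
      = (\<Sum>i\<in>UNIV. c i *\<^sub>R G (xh t i) + c i *\<^sub>R ((x t $ coord 1 + \<nu> t) *\<^sub>R gain_vec \<kappa> \<epsilon>))"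
      by (rule sum.cong) (simp_all add: G_def algebra_simps)
    also have "\<dots> = G (\<Sum>i\<in>UNIV. c i *\<^sub>R xh t i) + (\<Sum>i\<in>UNIV. c i) *\<^sub>R ((x t $ coord 1 + \<nu> t) *\<^sub>R gain_vec \<kappa> \<epsilon>)"
      by (simp only: sum.distrib linear_sum[OF G] linear_cmul[OF G] scaleR_sum_left)
    finally show ?thesis by (simp add: c)
  qed
  from r1[unfolded eqS] show ?thesis
    by (simp add: G_def matrix_vector_mult_diff_distrib algebra_simps)
qed

lemma norm_matrix_le_of_mult:
  fixes A :: "real^'m^'m"
  assumes "\<And>u. norm (A *v u) \<le> c * norm u"
  shows "norm A \<le> real CARD('m) * (real CARD('m) * c)"
proof -
  have comp: "\<bar>A $ i $ j\<bar> \<le> c" for i j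
  proof -
    have "A $ i $ j = (A *v axis j 1) $ i" by (simp add: matrix_vector_mul_component inner_axis)
    then have "\<bar>A $ i $ j\<bar> \<le> norm (A *v axis j 1)" by (metis component_le_norm_cart)
    also have "\<dots> \<le> c" using assms[of "axis j 1"] by (simp add: norm_axis_1)
    finally show ?thesis .
  qed
  have row: "norm (A $ i) \<le> real CARD('m) * c" for i
    using norm_le_l1_cart[of "A $ i"] sum_bounded_above[of UNIV "\<lambda>j. \<bar>A $ i $ j\<bar>" c] comp by fastforce
  have "norm A \<le> (\<Sum>i\<in>UNIV. norm (A $ i))" by (simp add: norm_vec_def L2_set_le_sum)
  also have "\<dots> \<le> real CARD('m) * (real CARD('m) * c)"
    using sum_bounded_above[of UNIV "\<lambda>i. norm (A $ i)" "real CARD('m) * c"] row by simp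
  finally show ?thesis .
qed

text \<open>The spread of the individual estimates is not controlled, only the initial error of the
  combination with the initial weights is. The weight correction \<open>\<beta> - \<beta>0\<close> changes that error by
  a homogeneous observer trajectory whose output over \<open>[0, t]\<close> is small in mean square by least
  squares; observability over \<open>[0, \<epsilon>]\<close> turns this into a bound independent of the spread.\<close>

lemma adaptive_observer_bounds:
  assumes hur: "hurwitz_coeffs CARD('n::{finite,linorder}) \<kappa>"
  obtains C a where "C \<ge> 1" "a > 0"
    "\<And>\<gamma> (\<beta>0 :: real^'m) \<epsilon> \<nu> T (x :: real \<Rightarrow> real^'n::{finite,linorder}) \<phi> xh \<beta> P kf nb t.
      adaptive_observer \<kappa> \<gamma> \<beta>0 \<epsilon> \<nu> T x \<phi> xh \<beta> P \<Longrightarrow> 0 < \<epsilon> \<Longrightarrow> \<epsilon> \<le> 1 \<Longrightarrow> \<gamma> > 0 \<Longrightarrow>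
      \<nu> absolutely_integrable_on {0..T} \<Longrightarrow>
      (\<And>t. t \<in> {0..T} \<Longrightarrow> \<bar>\<phi> t\<bar> \<le> kf) \<Longrightarrow> (\<And>t. t \<in> {0..T} \<Longrightarrow> \<bar>\<nu> t\<bar> \<le> nb) \<Longrightarrow> t \<in> {0..T} \<Longrightarrow>
      (\<epsilon> \<le> t \<longrightarrow> norm (x t - weighted_estimate (\<beta> t) (xh t)) \<le> C / \<epsilon> ^ (CARD('n) - 1) *
         (exp (- a * t / \<epsilon>) * norm (x 0 - weighted_estimate \<beta>0 (xh 0)) + \<epsilon> ^ CARD('n) * kf + nb)) \<and>
      (\<forall>i. norm (x t - xh t i) \<le> C / \<epsilon> ^ (CARD('n) - 1) * (norm (x 0 - xh 0 i) + \<epsilon> ^ CARD('n) * kf + nb)) \<and>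
      norm (\<beta> t) \<le> norm \<beta>0 + \<gamma> * (C * (norm (x 0 - weighted_estimate \<beta>0 (xh 0)) + \<epsilon> ^ CARD('n) * kf + nb)
         * (\<Sum>j\<in>UNIV. norm (xh 0 None - xh 0 (Some j)))) \<and>
      norm (P t) \<le> real CARD('m) * (real CARD('m) * \<gamma>)"
proof -
  obtain C a where C: "C \<ge> 1" and a: "a > 0" and
    err: "\<And>T (e :: real \<Rightarrow> real^'n::{finite,linorder}) \<phi> \<nu> \<epsilon> kf nb t. 0 < \<epsilon> \<Longrightarrow> \<epsilon> \<le> 1 \<Longrightarrow>
      rate_on T e (\<lambda>t. chain_A *v e t + \<phi> t *\<^sub>R axis (coord CARD('n)) 1
        - (e t $ coord 1 + \<nu> t) *\<^sub>R gain_vec \<kappa> \<epsilon>) \<Longrightarrow>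
      (\<And>t. t \<in> {0..T} \<Longrightarrow> \<bar>\<phi> t\<bar> \<le> kf) \<Longrightarrow> (\<And>t. t \<in> {0..T} \<Longrightarrow> \<bar>\<nu> t\<bar> \<le> nb) \<Longrightarrow> t \<in> {0..T} \<Longrightarrow>
      norm (gain_scale \<epsilon> (e t)) \<le> C * (exp (- a * t / \<epsilon>) * norm (gain_scale \<epsilon> (e 0)) + \<epsilon> ^ CARD('n) * kf + nb)"
    by (rule observer_error_bound[OF hur]) blast
  obtain Co where Co: "Co > 0" and
    obs: "\<And>T (e :: real \<Rightarrow> real^'n::{finite,linorder}) \<epsilon>. 0 < \<epsilon> \<Longrightarrow> \<epsilon> \<le> T \<Longrightarrow>
      rate_on T e (\<lambda>t. chain_A *v e t - (e t $ coord 1) *\<^sub>R gain_vec \<kappa> \<epsilon>) \<Longrightarrow>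
      (norm (gain_scale \<epsilon> (e 0)))\<^sup>2 \<le> Co * (integral {0..\<epsilon>} (\<lambda>t. (e t $ coord 1)\<^sup>2) / \<epsilon>)"
    by (rule observer_observability[of \<kappa>]) blast
  \<comment> \<open>\<open>C1\<close> adds to the constant for \<open>e0\<close> that of the
    correction: decay \<open>C\<close>, observability \<open>sqrt Co\<close>, the factor from
    \<open>expq\<close>, and \<open>2 * C\<close> from the bound \<open>\<omega>\<close>.
    \<open>C2\<close> collects the factors in the bound for \<open>r\<close>, with 1 / a from
    integrating the decaying regressor.\<close>
  define C1 where "C1 = C + C * sqrt Co * (1 + 2 / a) * (2 * C)"
  define C2 where "C2 = 2 * C * C / a"
  define CC where "CC = C1 + C2"
  have C0: "C \<ge> 0" using C by simp
  have C1: "C1 \<ge> C" using C0 Co a by (simp add: C1_def)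
  have C2: "C2 \<ge> 0" using C0 a by (simp add: C2_def)
  show ?thesis
  proof (rule that[of CC "a / 2"])
    show "CC \<ge> 1" "a / 2 > 0" using C C1 C2 a by (auto simp: CC_def)
    fix \<gamma> and \<beta>0 :: "real^'m" and \<epsilon> \<nu> T and x :: "real \<Rightarrow> (real,'n) vec" and \<phi> xh \<beta> P kf nb t
    assume ao: "adaptive_observer \<kappa> \<gamma> \<beta>0 \<epsilon> \<nu> T x \<phi> xh \<beta> P" and \<epsilon>: "0 < \<epsilon>" "\<epsilon> \<le> 1" and \<gamma>: "\<gamma> > 0"
      and \<nu>i: "\<nu> absolutely_integrable_on {0..T}"
      and \<phi>: "\<And>t. t \<in> {0..T} \<Longrightarrow> \<bar>\<phi> t\<bar> \<le> kf" and \<nu>: "\<And>t. t \<in> {0..T} \<Longrightarrow> \<bar>\<nu> t\<bar> \<le> nb" and t: "t \<in> {0..T}"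
    note rx = ao[unfolded adaptive_observer_def, THEN conjunct1]
    have rxh: "\<And>i. rate_on T (\<lambda>t. xh t i) (\<lambda>t. chain_A *v xh t i + (x t $ coord 1 + \<nu> t - xh t i $ coord 1) *\<^sub>R gain_vec \<kappa> \<epsilon>)"
      and r\<beta>: "rate_on T \<beta> (\<lambda>t. - ((x t $ coord 1 + \<nu> t - xh t None $ coord 1 + innov (xh t) \<bullet> \<beta> t) *\<^sub>R (P t *v innov (xh t))))"
      and rP: "rate_on T P (\<lambda>t. - (P t ** outer (innov (xh t)) ** P t))"
      and \<beta>0: "\<beta> 0 = \<beta>0" and P0: "P 0 = \<gamma> *\<^sub>R mat 1"
      using ao unfolding adaptive_observer_def by blast+
    have nn: "kf \<ge> 0" "nb \<ge> 0" using \<phi>[OF t] \<nu>[OF t] by linarith+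
    define \<delta>d where "\<delta>d = \<epsilon> ^ CARD('n) * kf + nb"
    have \<delta>d: "\<delta>d \<ge> 0" "\<delta>d \<ge> nb" using nn \<epsilon> by (auto simp: \<delta>d_def)
    have ex1: "exp (- a * s / \<epsilon>) \<le> 1" if "s \<ge> 0" for s using a that \<epsilon> by simp
    define e0 where "e0 t = x t - weighted_estimate \<beta>0 (xh t)" for t
    have re0: "rate_on T e0 (\<lambda>t. chain_A *v e0 t + \<phi> t *\<^sub>R axis (coord CARD('n)) 1 - (e0 t $ coord 1 + \<nu> t) *\<^sub>R gain_vec \<kappa> \<epsilon>)"
      unfolding e0_def weighted_estimate_def
      by (rule combined_error_rate[OF rx rxh]) (simp add: sum_option weight_def)
    define \<rho> where "\<rho> = norm (e0 0)"
    have \<rho>: "\<rho> \<ge> 0" by (simp add: \<rho>_def)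
    have e0b: "norm (gain_scale \<epsilon> (e0 s)) \<le> C * (exp (- a * s / \<epsilon>) * \<rho> + \<delta>d)" if s: "s \<in> {0..T}" for s
    proof -
      have "norm (gain_scale \<epsilon> (e0 s)) \<le> C * (exp (- a * s / \<epsilon>) * norm (gain_scale \<epsilon> (e0 0)) + \<epsilon> ^ CARD('n) * kf + nb)"
        by (rule err[OF \<epsilon> re0 \<phi> \<nu> s])
      also have "\<dots> \<le> C * (exp (- a * s / \<epsilon>) * \<rho> + \<delta>d)"
        using C0 norm_gain_scale_le[OF \<epsilon>, of "e0 0"] by (simp add: \<rho>_def \<delta>d_def algebra_simps mult_left_mono)
      finally show ?thesis .
    qed
    \<comment> \<open>Two equal shares: the output of \<open>e0\<close> and the noise are each at
      most C (\<rho> + \<delta>d).\<close>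
    define \<omega> where "\<omega> = 2 * C * (\<rho> + \<delta>d)"
    have \<omega>: "\<omega> \<ge> 0" using C0 \<rho> \<delta>d by (simp add: \<omega>_def)
    define w where "w s = e0 s $ coord 1 + \<nu> s" for s
    have w: "\<bar>w s\<bar> \<le> \<omega>" if s: "s \<in> {0..T}" for s
    proof -
      have "\<bar>e0 s $ coord 1\<bar> \<le> norm (gain_scale \<epsilon> (e0 s))"
        using component_le_norm_cart[of "gain_scale \<epsilon> (e0 s)" "coord 1"] by (simp only: gain_scale_coord_1)
      also have "\<dots> \<le> C * (exp (- a * s / \<epsilon>) * \<rho> + \<delta>d)" by (rule e0b[OF s])
      also have "\<dots> \<le> C * (1 * \<rho> + \<delta>d)"
        using ex1[of s] s C0 \<rho> by (intro mult_left_mono add_right_mono mult_right_mono) auto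
      finally have "\<bar>e0 s $ coord 1\<bar> \<le> C * (\<rho> + \<delta>d)" by simp
      moreover have "nb \<le> C * (\<rho> + \<delta>d)"
        using mult_mono[of 1 C nb "\<rho> + \<delta>d"] C \<rho> \<delta>d nn by simp
      ultimately show ?thesis using \<nu>[OF s] by (simp add: w_def \<omega>_def)
    qed
    define E where "E j s = xh s None - xh s (Some j)" for j s
    define m where "m s = innov (xh s)" for s
    have rE: "rate_on T (E j) (\<lambda>s. chain_A *v E j s - (E j s $ coord 1) *\<^sub>R gain_vec \<kappa> \<epsilon>)" for j
      using rate_on_diff[OF rxh[of None] rxh[of "Some j"]] unfolding E_def
      by (simp add: matrix_vector_mult_diff_distrib algebra_simps)
    define \<psi> where "\<psi> b s = (\<Sum>j\<in>UNIV. b $ j *\<^sub>R E j s)" for b :: "real^'m" and s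
    have r\<psi>: "rate_on T (\<psi> b) (\<lambda>s. chain_A *v \<psi> b s - (\<psi> b s $ coord 1) *\<^sub>R gain_vec \<kappa> \<epsilon>)" for b
    proof -
      define G where "G z = chain_A *v z - (z $ coord 1) *\<^sub>R gain_vec \<kappa> \<epsilon>" for z :: "(real, 'n) vec"
      have G: "linear G" unfolding G_def
        by (rule linearI) (simp_all add: matrix_vector_right_distrib matrix_vector_mult_scaleR algebra_simps)
      have "rate_on T (\<psi> b) (\<lambda>s. \<Sum>j\<in>UNIV. b $ j *\<^sub>R G (E j s))"
        unfolding \<psi>_def by (intro rate_on_sum rate_on_scaleR) (use rE in \<open>auto simp: G_def\<close>)
      then have "rate_on T (\<psi> b) (\<lambda>s. G (\<psi> b s))"
        by (simp add: \<psi>_def linear_sum[OF G] linear_cmul[OF G])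
      then show ?thesis by (simp add: G_def)
    qed
    have \<psi>m: "\<psi> b s $ coord 1 = m s \<bullet> b" for b s by (simp only: inner_innov m_def \<psi>_def E_def)
    have hom: "norm (gain_scale \<epsilon> (e s)) \<le> C * (exp (- a * s / \<epsilon>) * norm (gain_scale \<epsilon> (e 0)))"
      if "rate_on T e (\<lambda>s. chain_A *v e s - (e s $ coord 1) *\<^sub>R gain_vec \<kappa> \<epsilon>)" "s \<in> {0..T}" for e :: "real \<Rightarrow> (real,'n) vec" and s
      using err[OF \<epsilon>, of T e "\<lambda>_. 0" "\<lambda>_. 0" 0 0 s] that by simp
    have cm: "continuous_on {0..T} m"
      unfolding m_def innov_def
      by (intro continuous_intros bounded_linear.continuous_on[OF bounded_linear_vec_nth])
        (use rate_on_continuous[OF rxh] in auto)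
    have ce0: "continuous_on {0..T} e0" by (rule rate_on_continuous[OF re0])
    define \<delta> where "\<delta> s = \<beta> s - \<beta>0" for s
    \<comment> \<open>\<open>w\<close> is the output residual with the weights frozen at
      \<open>\<beta>0\<close>. Rewritten for the deviation of the weights, the law has the shape
      treated in \<open>recursive_least_squares\<close>.\<close>
    have r\<delta>: "rate_on T \<delta> (\<lambda>s. - ((w s + m s \<bullet> \<delta> s) *\<^sub>R (P s *v m s)))"
    proof -
      have "x s $ coord 1 + \<nu> s - xh s None $ coord 1 + m s \<bullet> \<beta> s = w s + m s \<bullet> \<delta> s" for s
      proof -
        have "m s \<bullet> \<beta>0 = (\<Sum>j\<in>UNIV. \<beta>0 $ j *\<^sub>R (xh s None - xh s (Some j))) $ coord 1"
          by (simp only: inner_innov m_def)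
        then show ?thesis
          by (simp add: w_def e0_def weighted_estimate_alt \<delta>_def inner_diff_right)
      qed
      with rate_on_diff[OF r\<beta> rate_on_const[of T \<beta>0]] show ?thesis by (simp add: \<delta>_def[abs_def] m_def)
    qed
    define r where "r s = 0 + integral {0..s} (\<lambda>s. w s *\<^sub>R m s)" for s
    have rr: "rate_on T r (\<lambda>s. w s *\<^sub>R m s)"
      unfolding r_def
    proof (rule rate_on_antiderivative)
      have "bounded (m ` {0..T})" by (intro compact_imp_bounded compact_continuous_image cm) auto
      then obtain B where B: "\<And>s. s \<in> {0..T} \<Longrightarrow> norm (m s) \<le> B" unfolding bounded_iff by blast
      show "bounded ((\<lambda>s. w s *\<^sub>R m s) ` {0..T})"
        by (rule boundedI[of _ "\<omega> * B"]) (use w B \<omega> in \<open>auto intro!: mult_mono\<close>)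
      have "(\<lambda>s. e0 s $ coord 1 *\<^sub>R m s) integrable_on {0..T}"
        by (intro integrable_continuous_real continuous_intros cm bounded_linear.continuous_on[OF bounded_linear_vec_nth] ce0)
      moreover have "(\<lambda>s. \<nu> s *\<^sub>R m s) absolutely_integrable_on {0..T}"
        by (rule absolutely_integrable_bilinear_continuous[OF bounded_bilinear_scaleR \<nu>i cm])
      ultimately have "(\<lambda>s. e0 s $ coord 1 *\<^sub>R m s + \<nu> s *\<^sub>R m s) integrable_on {0..T}"
        by (intro integrable_add) (auto simp: absolutely_integrable_on_def)
      then show "(\<lambda>s. w s *\<^sub>R m s) integrable_on {0..T}" by (simp add: w_def algebra_simps)
    qed
    have rls1: "norm (P t *v u) \<le> \<gamma> * norm u"
      and rls2: "norm (\<delta> t) \<le> \<gamma> * norm (r t)"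
      and rls3: "integral {0..t} (\<lambda>s. (m s \<bullet> \<delta> t)\<^sup>2) \<le> t * \<omega>\<^sup>2" for u
      using recursive_least_squares[OF \<gamma> cm _ P0 r\<delta> _ rr _ w t] rP \<beta>0 by (auto simp: m_def \<delta>_def r_def)
    have lin: "gain_scale \<epsilon> (u + v) = gain_scale \<epsilon> u + gain_scale \<epsilon> v" for u v :: "(real,'n) vec"
      by (rule linear_add[OF linear_gain_scale])
    have A: "norm (x t - weighted_estimate (\<beta> t) (xh t)) \<le> CC / \<epsilon> ^ (CARD('n) - 1) *
         (exp (- (a / 2) * t / \<epsilon>) * \<rho> + \<epsilon> ^ CARD('n) * kf + nb)" if t\<epsilon>: "\<epsilon> \<le> t"
    proof -
      \<comment> \<open>The correction at time t is the value at t of the homogeneous trajectory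
        with the constant weights \<open>\<delta> t\<close>. Its entire past can therefore be used:
        least squares bounds its output over [0, t], and since \<epsilon> \<le> t, observability
        over the first \<epsilon> bounds its initial value.\<close>
      have split: "x t - weighted_estimate (\<beta> t) (xh t) = e0 t + \<psi> (\<delta> t) t"
        using weighted_estimate_diff[of \<beta>0 "xh t" "\<beta> t"] by (simp add: e0_def \<psi>_def E_def \<delta>_def algebra_simps)
      define q where "q = t / \<epsilon>"
      have q: "q \<ge> 1" using t\<epsilon> \<epsilon> by (simp add: q_def)
      have ci: "continuous_on {0..t} (\<lambda>s. (m s \<bullet> \<delta> t)\<^sup>2)"
        by (intro continuous_intros continuous_on_subset[OF cm]) (use t in auto)
      have "(norm (gain_scale \<epsilon> (\<psi> (\<delta> t) 0)))\<^sup>2 \<le> Co * (integral {0..\<epsilon>} (\<lambda>s. (m s \<bullet> \<delta> t)\<^sup>2) / \<epsilon>)"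
        using obs[OF \<epsilon>(1) _ r\<psi>[of "\<delta> t"]] t\<epsilon> t by (simp add: \<psi>m[unfolded One_nat_def])
      also have "\<dots> \<le> Co * (integral {0..t} (\<lambda>s. (m s \<bullet> \<delta> t)\<^sup>2) / \<epsilon>)"
      proof (intro mult_left_mono divide_right_mono integral_subset_le)
        show "(\<lambda>s. (m s \<bullet> \<delta> t)\<^sup>2) integrable_on {0..t}" by (rule integrable_continuous_real[OF ci])
        show "(\<lambda>s. (m s \<bullet> \<delta> t)\<^sup>2) integrable_on {0..\<epsilon>}"
          by (rule integrable_continuous_real, rule continuous_on_subset[OF ci]) (use t\<epsilon> in auto)
      qed (use \<epsilon> t\<epsilon> Co in auto)
      also have "\<dots> \<le> Co * (t * \<omega>\<^sup>2 / \<epsilon>)"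
        using rls3 Co \<epsilon> by (intro mult_left_mono divide_right_mono) auto
      also have "\<dots> = Co * (q * \<omega>\<^sup>2)" by (simp add: q_def)
      also have "\<dots> \<le> Co * ((1 + q)\<^sup>2 * \<omega>\<^sup>2)"
        using Co q by (intro mult_left_mono mult_right_mono) (auto simp: power2_eq_square algebra_simps)
      also have "\<dots> = (sqrt Co * ((1 + q) * \<omega>))\<^sup>2" using Co by (simp add: power_mult_distrib)
      finally have \<psi>0: "norm (gain_scale \<epsilon> (\<psi> (\<delta> t) 0)) \<le> sqrt Co * ((1 + q) * \<omega>)"
        by (rule power2_le_imp_le) (use Co q \<omega> in auto)
      \<comment> \<open>The least squares bound grows with the elapsed scaled time q; half of the
        decay rate is spent on absorbing this growth.\<close>
      have expq: "exp (- a * q) * (1 + q) \<le> (1 + 2 / a) * exp (- (a / 2) * q)"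
      proof -
        have "1 + q \<le> (1 + 2 / a) * (1 + (a / 2) * q)" using a q by (simp add: field_simps)
        also have "\<dots> \<le> (1 + 2 / a) * exp ((a / 2) * q)"
          using a by (intro mult_left_mono exp_ge_add_one_self) auto
        finally have "exp (- a * q) * (1 + q) \<le> exp (- a * q) * ((1 + 2 / a) * exp ((a / 2) * q))"
          by (intro mult_left_mono) auto
        also have "\<dots> = (1 + 2 / a) * (exp (- a * q) * exp ((a / 2) * q))" by simp
        also have "exp (- a * q) * exp ((a / 2) * q) = exp (- (a / 2) * q)"
          unfolding exp_add[symmetric] by (simp add: field_simps)
        finally show ?thesis .
      qed
      have "norm (gain_scale \<epsilon> (\<psi> (\<delta> t) t)) \<le> C * (exp (- a * t / \<epsilon>) * norm (gain_scale \<epsilon> (\<psi> (\<delta> t) 0)))"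
        by (rule hom[OF r\<psi> t])
      also have "\<dots> \<le> C * (exp (- a * t / \<epsilon>) * (sqrt Co * ((1 + q) * \<omega>)))"
        using \<psi>0 C0 by (intro mult_left_mono) auto
      also have "\<dots> = C * sqrt Co * \<omega> * (exp (- a * q) * (1 + q))" by (simp add: q_def)
      also have "\<dots> \<le> C * sqrt Co * \<omega> * ((1 + 2 / a) * exp (- (a / 2) * q))"
        using C0 Co \<omega> by (intro mult_left_mono expq) auto
      also have "\<dots> = C * sqrt Co * (1 + 2 / a) * (2 * C) * (exp (- (a / 2) * q) * \<rho> + exp (- (a / 2) * q) * \<delta>d)"
        by (simp add: \<omega>_def algebra_simps)
      also have "\<dots> \<le> C * sqrt Co * (1 + 2 / a) * (2 * C) * (exp (- (a / 2) * q) * \<rho> + \<delta>d)"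
        using C0 Co a q \<delta>d by (intro mult_left_mono add_left_mono mult_left_le_one_le) auto
      finally have \<psi>t: "norm (gain_scale \<epsilon> (\<psi> (\<delta> t) t)) \<le> C * sqrt Co * (1 + 2 / a) * (2 * C) * (exp (- (a / 2) * q) * \<rho> + \<delta>d)" .
      have "norm (gain_scale \<epsilon> (e0 t)) \<le> C * (exp (- a * q) * \<rho> + \<delta>d)" using e0b[OF t] by (simp add: q_def)
      also have "\<dots> \<le> C * (exp (- (a / 2) * q) * \<rho> + \<delta>d)"
        using C0 \<rho> a q by (intro mult_left_mono add_right_mono mult_right_mono) auto
      finally have "norm (gain_scale \<epsilon> (x t - weighted_estimate (\<beta> t) (xh t))) \<le> C1 * (exp (- (a / 2) * q) * \<rho> + \<delta>d)"
        using \<psi>t norm_triangle_ineq[of "gain_scale \<epsilon> (e0 t)" "gain_scale \<epsilon> (\<psi> (\<delta> t) t)"]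
        unfolding split lin C1_def by (simp add: distrib_right)
      also have "\<dots> \<le> CC * (exp (- (a / 2) * q) * \<rho> + \<delta>d)"
        using C2 \<rho> \<delta>d by (intro mult_right_mono) (auto simp: CC_def)
      finally have "norm (gain_scale \<epsilon> (x t - weighted_estimate (\<beta> t) (xh t))) / \<epsilon> ^ (CARD('n) - 1) \<le>
          CC * (exp (- (a / 2) * q) * \<rho> + \<delta>d) / \<epsilon> ^ (CARD('n) - 1)"
        using \<epsilon> by (intro divide_right_mono) auto
      with norm_le_gain_scale[OF \<epsilon>] show ?thesis
        by (rule order_trans[THEN order_trans]) (simp add: q_def \<delta>d_def add.assoc)
    qed
    have B: "norm (x t - xh t i) \<le> CC / \<epsilon> ^ (CARD('n) - 1) * (norm (x 0 - xh 0 i) + \<epsilon> ^ CARD('n) * kf + nb)" for i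
    proof -
      define e where "e s = x s - xh s i" for s
      \<comment> \<open>A single estimate is the combination with an indicator weight.\<close>
      have sel: "(\<Sum>k\<in>UNIV. (if k = i then 1 else 0) *\<^sub>R xh s k) = xh s i" for s
        by (simp add: if_distrib[of "\<lambda>c. c *\<^sub>R _"] cong: if_cong)
      have re: "rate_on T e (\<lambda>t. chain_A *v e t + \<phi> t *\<^sub>R axis (coord CARD('n)) 1 - (e t $ coord 1 + \<nu> t) *\<^sub>R gain_vec \<kappa> \<epsilon>)"
        using combined_error_rate[where xh = xh and c = "\<lambda>k. if k = i then 1 else 0", OF rx rxh]
        unfolding sel e_def[abs_def] by simp
      have "norm (gain_scale \<epsilon> (e t)) \<le> C * (exp (- a * t / \<epsilon>) * norm (gain_scale \<epsilon> (e 0)) + \<epsilon> ^ CARD('n) * kf + nb)"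
        by (rule err[OF \<epsilon> re \<phi> \<nu> t])
      also have "\<dots> \<le> CC * (1 * norm (e 0) + \<epsilon> ^ CARD('n) * kf + nb)"
        using C0 C1 C2 ex1[of t] t norm_gain_scale_le[OF \<epsilon>, of "e 0"] nn \<epsilon>
        by (intro mult_mono add_mono) (auto simp: CC_def)
      finally have "norm (gain_scale \<epsilon> (e t)) / \<epsilon> ^ (CARD('n) - 1) \<le> CC * (1 * norm (e 0) + \<epsilon> ^ CARD('n) * kf + nb) / \<epsilon> ^ (CARD('n) - 1)"
        using \<epsilon> by (intro divide_right_mono) auto
      with norm_le_gain_scale[OF \<epsilon>, of "e t"] show ?thesis by (simp add: e_def)
    qed
    define S where "S = (\<Sum>j\<in>UNIV. norm (E j 0))"
    have S: "S \<ge> 0" unfolding S_def by (simp add: sum_nonneg)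
    \<comment> \<open>Differences of estimates feel neither plant input nor noise, so the regressor
      decays at the rate \<open>a / \<epsilon>\<close>. This keeps \<open>r\<close>, and with it the
      weights, bounded for all times.\<close>
    have mb: "norm (m s) \<le> C * S * exp (- a / \<epsilon> * s)" if s: "s \<in> {0..T}" for s
    proof -
      have "norm (m s) \<le> (\<Sum>j\<in>UNIV. \<bar>m s $ j\<bar>)" by (rule norm_le_l1_cart)
      also have "\<dots> \<le> (\<Sum>j\<in>UNIV. C * (exp (- a * s / \<epsilon>) * norm (E j 0)))"
      proof (rule sum_mono)
        fix j
        have "m s $ j = gain_scale \<epsilon> (E j s) $ coord 1" by (simp add: m_def innov_def E_def)
        then have "\<bar>m s $ j\<bar> \<le> norm (gain_scale \<epsilon> (E j s))" by (metis component_le_norm_cart)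
        also have "\<dots> \<le> C * (exp (- a * s / \<epsilon>) * norm (gain_scale \<epsilon> (E j 0)))" by (rule hom[OF rE s])
        also have "\<dots> \<le> C * (exp (- a * s / \<epsilon>) * norm (E j 0))"
          using C0 norm_gain_scale_le[OF \<epsilon>] by (intro mult_left_mono) auto
        finally show "\<bar>m s $ j\<bar> \<le> C * (exp (- a * s / \<epsilon>) * norm (E j 0))" .
      qed
      also have "\<dots> = C * S * exp (- a / \<epsilon> * s)" by (simp add: S_def sum_distrib_left sum_distrib_right mult_ac)
      finally show ?thesis .
    qed
    \<comment> \<open>The exponential integrates to at most \<epsilon> / a, and \<epsilon> \<le> 1
      makes the bound uniform.\<close>
    have rb: "norm (r t) \<le> \<omega> * (C * S) / a"
    proof -
      define c where "c = - a / \<epsilon>"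
      have c: "c < 0" "1 / (- c) \<le> 1 / a" using a \<epsilon> by (auto simp: c_def divide_right_mono)
      have I: "((\<lambda>s. \<omega> * (C * S) * exp (c * s)) has_integral \<omega> * (C * S) * ((exp (c * t) - 1) / c)) {0..t}"
        by (intro has_integral_mult_right integral_exp_mult) (use c t in auto)
      have Ir: "((\<lambda>s. w s *\<^sub>R m s) has_integral r t - r 0) {0..t}" using rate_on_interval[OF rr, of 0 t] t by auto
      have "norm (integral {0..t} (\<lambda>s. w s *\<^sub>R m s)) \<le> integral {0..t} (\<lambda>s. \<omega> * (C * S) * exp (c * s))"
      proof (rule integral_norm_bound_integral)
        fix s assume "s \<in> {0..t}"
        then have s: "s \<in> {0..T}" using t by auto
        have "norm (w s *\<^sub>R m s) = \<bar>w s\<bar> * norm (m s)" by simp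
        also have "\<dots> \<le> \<omega> * (C * S * exp (c * s))"
          using w[OF s] mb[OF s] \<omega> by (intro mult_mono) (auto simp: c_def)
        finally show "norm (w s *\<^sub>R m s) \<le> \<omega> * (C * S) * exp (c * s)" by (simp add: mult_ac)
      qed (use I Ir in auto)
      then have "norm (r t) \<le> \<omega> * (C * S) * ((exp (c * t) - 1) / c)"
        using integral_unique[OF I] by (simp add: r_def)
      also have "(exp (c * t) - 1) / c \<le> 1 / a"
      proof -
        have "(exp (c * t) - 1) / c = (1 - exp (c * t)) / (- c)" using c by (simp add: field_simps)
        also have "\<dots> \<le> 1 / (- c)" using c by (intro divide_right_mono) auto
        finally show ?thesis using c by linarith
      qed
      finally show ?thesis using \<omega> C0 S by (auto simp: mult_left_mono)
    qed
    have Bd: "norm (\<beta> t) \<le> norm \<beta>0 + \<gamma> * (CC * (\<rho> + \<epsilon> ^ CARD('n) * kf + nb) * S)"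
    proof -
      have "\<omega> * (C * S) / a = C2 * (\<rho> + \<delta>d) * S" by (simp add: \<omega>_def C2_def)
      also have "\<dots> \<le> CC * (\<rho> + \<delta>d) * S"
        using \<rho> \<delta>d S C0 C1 by (intro mult_right_mono) (auto simp: CC_def)
      finally have "norm (r t) \<le> CC * (\<rho> + \<delta>d) * S" using rb by linarith
      then have "\<gamma> * norm (r t) \<le> \<gamma> * (CC * (\<rho> + \<delta>d) * S)" using \<gamma> by (intro mult_left_mono) auto
      then have "norm (\<delta> t) \<le> \<gamma> * (CC * (\<rho> + \<delta>d) * S)" using rls2 by linarith
      moreover have "norm (\<beta> t) \<le> norm \<beta>0 + norm (\<delta> t)" unfolding \<delta>_def by (rule norm_triangle_sub)
      ultimately show ?thesis by (simp add: \<delta>d_def add.assoc)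
    qed
    show "(\<epsilon> \<le> t \<longrightarrow> norm (x t - weighted_estimate (\<beta> t) (xh t)) \<le> CC / \<epsilon> ^ (CARD('n) - 1) *
         (exp (- (a / 2) * t / \<epsilon>) * norm (x 0 - weighted_estimate \<beta>0 (xh 0)) + \<epsilon> ^ CARD('n) * kf + nb)) \<and>
      (\<forall>i. norm (x t - xh t i) \<le> CC / \<epsilon> ^ (CARD('n) - 1) * (norm (x 0 - xh 0 i) + \<epsilon> ^ CARD('n) * kf + nb)) \<and>
      norm (\<beta> t) \<le> norm \<beta>0 + \<gamma> * (CC * (norm (x 0 - weighted_estimate \<beta>0 (xh 0)) + \<epsilon> ^ CARD('n) * kf + nb)
         * (\<Sum>j\<in>UNIV. norm (xh 0 None - xh 0 (Some j)))) \<and>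
      norm (P t) \<le> real CARD('m) * (real CARD('m) * \<gamma>)"
      using A B Bd norm_matrix_le_of_mult[OF rls1] by (simp add: \<rho>_def e0_def S_def E_def)
  qed
qed

section \<open>The closed loop\<close>

lemma chain_B_mult: "(chain_B :: real^1^'n::{finite,linorder}) *v vec s = s *\<^sub>R axis (coord CARD('n)) 1"
proof -
  have "pos i = CARD('n) \<longleftrightarrow> i = coord CARD('n)" for i :: 'n by (rule pos_eq_iff) (simp add: Suc_leI)
  then show ?thesis
    by (simp add: vec_eq_iff matrix_vector_mult_def chain_B_def axis_def)
qed

lemma gain_H_mult: "(gain_H \<kappa> \<epsilon> :: real^1^'n::{finite,linorder}) *v v = (v $ 1) *\<^sub>R gain_vec \<kappa> \<epsilon>"
  by (simp add: vec_eq_iff matrix_vector_mult_def gain_H_def gain_vec_def)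

lemma chain_C_diff_matrix_nth: "((chain_C :: real^'n::{finite,linorder}^1) ** diff_matrix xh) $ k $ j = innov xh $ j"
proof -
  have "(chain_C ** diff_matrix xh) $ k $ j = (chain_C *v (xh None - xh (Some j))) $ k"
    by (simp add: matrix_matrix_mult_def matrix_vector_mult_def diff_matrix_def)
  then show ?thesis unfolding chain_C_mult by (simp add: innov_def)
qed

lemma chain_C_diff_matrix_mult: "((chain_C :: real^'n::{finite,linorder}^1) ** diff_matrix xh) *v \<beta> = vec (innov xh \<bullet> \<beta>)"
  by (simp add: vec_eq_iff matrix_vector_mult_def chain_C_diff_matrix_nth inner_vec_def)

lemma transpose_diff_matrix_nth:
  "(transpose (diff_matrix xh) ** transpose (chain_C :: real^'n::{finite,linorder}^1)) $ j $ k = innov xh $ j"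
  unfolding matrix_transpose_mul[symmetric] by (simp add: transpose_def chain_C_diff_matrix_nth)

lemma weight_law_simp:
  "(P ** transpose (diff_matrix xh) ** transpose (chain_C :: real^'n::{finite,linorder}^1)) *v vec s = s *\<^sub>R (P *v innov xh)"
proof -
  have "(transpose (diff_matrix xh) ** transpose (chain_C :: real^'n::{finite,linorder}^1)) *v vec s = s *\<^sub>R innov xh"
    by (simp add: vec_eq_iff matrix_vector_mult_def transpose_diff_matrix_nth mult.commute)
  then show ?thesis
    by (simp add: matrix_mul_assoc[symmetric] matrix_vector_mul_assoc[symmetric] matrix_vector_mult_scaleR)
qed

lemma covariance_law_simp:
  "P ** transpose (diff_matrix xh) ** transpose (chain_C :: real^'n::{finite,linorder}^1) ** chain_C ** diff_matrix xh ** P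
   = P ** outer (innov xh) ** P"
proof -
  have "(transpose (diff_matrix xh) ** transpose (chain_C :: real^'n::{finite,linorder}^1)) ** (chain_C ** diff_matrix xh) = outer (innov xh)"
    unfolding vec_eq_iff by (simp add: matrix_matrix_mult_def[of "_ ** _" "_ ** _"] transpose_diff_matrix_nth chain_C_diff_matrix_nth outer_def)
  then show ?thesis by (simp add: matrix_mul_assoc[symmetric])
qed

lemma output_feedback_solution_iff:
  fixes f :: "real ^ 'n::{finite,linorder} \<Rightarrow> real \<Rightarrow> real"
  shows "output_feedback_solution f g h X \<Theta> \<kappa> \<gamma> \<beta>0 \<epsilon> \<nu> x \<theta> xh \<beta> P \<longleftrightarrow>
    (\<forall>t\<ge>0. x t \<in> X \<and> \<theta> t \<in> \<Theta>) \<and>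
    has_rate x (\<lambda>t. chain_A *v x t + f (x t) (g (weighted_estimate (\<beta> t) (xh t)) (\<theta> t)) *\<^sub>R axis (coord CARD('n)) 1) \<and>
    has_rate \<theta> (\<lambda>t. h (weighted_estimate (\<beta> t) (xh t)) (\<theta> t)) \<and>
    (\<forall>i. has_rate (\<lambda>t. xh t i) (\<lambda>t. chain_A *v xh t i + (x t $ coord 1 + \<nu> t - xh t i $ coord 1) *\<^sub>R gain_vec \<kappa> \<epsilon>)) \<and>
    has_rate \<beta> (\<lambda>t. - ((x t $ coord 1 + \<nu> t - xh t None $ coord 1 + innov (xh t) \<bullet> \<beta> t) *\<^sub>R (P t *v innov (xh t)))) \<and>
    \<beta> 0 = \<beta>0 \<and>
    has_rate P (\<lambda>t. - (P t ** outer (innov (xh t)) ** P t)) \<and> P 0 = \<gamma> *\<^sub>R mat 1"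
proof -
  have v: "vec a + vec b = (vec (a + b) :: real^1)" "vec a - vec b = (vec (a - b) :: real^1)" for a b
    by (simp_all add: vec_eq_iff)
  show ?thesis
    unfolding output_feedback_solution_def Let_def chain_B_mult chain_C_mult chain_C_diff_matrix_mult v
      weight_law_simp covariance_law_simp gain_H_mult vec_component ..
qed

section \<open>Lipschitz calculus on compact sets\<close>

definition lipschitzian_on :: "'a::metric_space set \<Rightarrow> ('a \<Rightarrow> 'b::metric_space) \<Rightarrow> bool" where
  "lipschitzian_on Z u \<longleftrightarrow> (\<exists>L. L-lipschitz_on Z u)"

lemma lipschitzian_on_continuous: "lipschitzian_on Z u \<Longrightarrow> continuous_on Z u"
  unfolding lipschitzian_on_def using lipschitz_on_continuous_on by blast

lemma lipschitzian_on_const: "lipschitzian_on Z (\<lambda>_. c)"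
  and lipschitzian_on_id: "lipschitzian_on Z (\<lambda>z. z)"
  unfolding lipschitzian_on_def using lipschitz_on_constant lipschitz_on_id by blast+

lemma lipschitzian_on_Pair: "lipschitzian_on Z u \<Longrightarrow> lipschitzian_on Z v \<Longrightarrow> lipschitzian_on Z (\<lambda>z. (u z, v z))"
  unfolding lipschitzian_on_def using lipschitz_on_Pair by blast

lemma lipschitzian_on_add:
  fixes u v :: "'a::metric_space \<Rightarrow> 'b::real_normed_vector"
  shows "lipschitzian_on Z u \<Longrightarrow> lipschitzian_on Z v \<Longrightarrow> lipschitzian_on Z (\<lambda>z. u z + v z)"
    and "lipschitzian_on Z u \<Longrightarrow> lipschitzian_on Z v \<Longrightarrow> lipschitzian_on Z (\<lambda>z. u z - v z)"
    and "lipschitzian_on Z u \<Longrightarrow> lipschitzian_on Z (\<lambda>z. - u z)"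
  unfolding lipschitzian_on_def using lipschitz_on_add lipschitz_on_diff lipschitz_on_minus by blast+

lemma lipschitzian_on_compose:
  "lipschitzian_on Z u \<Longrightarrow> lipschitzian_on (u ` Z) F \<Longrightarrow> lipschitzian_on Z (\<lambda>z. F (u z))"
  unfolding lipschitzian_on_def using lipschitz_on_compose2 by blast

lemma lipschitzian_on_linear:
  assumes "lipschitzian_on Z u" "bounded_linear F" shows "lipschitzian_on Z (\<lambda>z. F (u z))"
proof (rule lipschitzian_on_compose[OF assms(1)])
  obtain L where "L-lipschitz_on (u ` Z) F" by (rule bounded_linear.lipschitz_boundE[OF assms(2)])
  then show "lipschitzian_on (u ` Z) F" unfolding lipschitzian_on_def by blast
qed

lemma lipschitzian_on_sum:
  fixes u :: "'i \<Rightarrow> 'a::metric_space \<Rightarrow> 'b::real_normed_vector"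
  assumes "finite I" "\<And>i. i \<in> I \<Longrightarrow> lipschitzian_on Z (u i)"
  shows "lipschitzian_on Z (\<lambda>z. \<Sum>i\<in>I. u i z)"
  using assms by (induction I rule: finite_induct) (auto intro: lipschitzian_on_const lipschitzian_on_add)

lemma lipschitzian_on_vec_lambda:
  fixes u :: "'i::finite \<Rightarrow> 'a::metric_space \<Rightarrow> 'b::euclidean_space"
  assumes "\<And>i. lipschitzian_on Z (u i)" shows "lipschitzian_on Z (\<lambda>z. \<chi> i. u i z)"
proof -
  have bl: "bounded_linear (\<lambda>y::'b. axis i y)" for i :: 'i
    by (rule linear_conv_bounded_linear[THEN iffD1]) (rule linearI, auto simp: axis_def vec_eq_iff)
  have "lipschitzian_on Z (\<lambda>z. \<Sum>i\<in>UNIV. axis i (u i z))"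
    by (intro lipschitzian_on_sum lipschitzian_on_linear[OF assms bl]) auto
  moreover have "(\<Sum>i\<in>UNIV. axis i (u i z)) = (\<chi> i. u i z)" for z
    by (simp add: vec_eq_iff axis_def)
  ultimately show ?thesis by simp
qed

lemma lipschitzian_on_bilinear:
  fixes u :: "'a::metric_space \<Rightarrow> 'b::real_normed_vector" and v :: "'a \<Rightarrow> 'c::real_normed_vector"
  assumes p: "bounded_bilinear p" and Z: "compact Z" and u: "lipschitzian_on Z u" and v: "lipschitzian_on Z v"
  shows "lipschitzian_on Z (\<lambda>z. p (u z) (v z))"
proof -
  interpret bounded_bilinear p by fact
  obtain K where K: "K > 0" "\<And>a b. norm (p a b) \<le> norm a * norm b * K" using pos_bounded by blast
  obtain L M where L: "L-lipschitz_on Z u" and M: "M-lipschitz_on Z v" using u v unfolding lipschitzian_on_def by blast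
  have L0: "L \<ge> 0" and M0: "M \<ge> 0" using L M lipschitz_on_nonneg by blast+
  have "bounded (u ` Z)" "bounded (v ` Z)"
    using Z u v lipschitzian_on_continuous by (auto intro: compact_imp_bounded compact_continuous_image)
  then obtain B B' where B: "B > 0" "\<And>z. z \<in> Z \<Longrightarrow> norm (u z) \<le> B" and B': "B' > 0" "\<And>z. z \<in> Z \<Longrightarrow> norm (v z) \<le> B'"
    unfolding bounded_pos by auto
  have "(L * B' * K + B * M * K)-lipschitz_on Z (\<lambda>z. p (u z) (v z))"
  proof (rule lipschitz_onI)
    fix x y assume xy: "x \<in> Z" "y \<in> Z"
    have "p (u x) (v x) - p (u y) (v y) = p (u x - u y) (v x) + p (u y) (v x - v y)" by (simp add: diff_left diff_right)
    then have "norm (p (u x) (v x) - p (u y) (v y)) \<le> norm (u x - u y) * norm (v x) * K + norm (u y) * norm (v x - v y) * K"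
      using K(2)[of "u x - u y" "v x"] K(2)[of "u y" "v x - v y"]
        norm_triangle_ineq[of "p (u x - u y) (v x)" "p (u y) (v x - v y)"] by simp
    also have "\<dots> \<le> (L * dist x y) * B' * K + B * (M * dist x y) * K"
      using xy lipschitz_onD[OF L xy] lipschitz_onD[OF M xy] B B' K(1) L0 M0
      by (intro add_mono mult_right_mono mult_mono) (auto simp: dist_norm less_imp_le)
    finally show "dist (p (u x) (v x)) (p (u y) (v y)) \<le> (L * B' * K + B * M * K) * dist x y"
      by (simp add: dist_norm algebra_simps)
  qed (use L0 M0 K B B' in auto)
  then show ?thesis unfolding lipschitzian_on_def by blast
qed

lemma locally_lipschitz_on_compact:
  assumes F: "locally_lipschitz_on D F" and K: "compact K" "K \<subseteq> D"
  shows "lipschitzian_on K F"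
proof -
  have "local_lipschitz {0::real} K (\<lambda>_. F)"
    by (rule local_lipschitz_subset[OF F[unfolded locally_lipschitz_on_def]]) (use K in auto)
  then obtain L where "\<And>t. t \<in> {0::real} \<Longrightarrow> L-lipschitz_on K F"
    by (rule local_lipschitz_compact_implies_lipschitz[OF _ K(1)]) auto
  then show ?thesis unfolding lipschitzian_on_def by blast
qed

lemma locally_lipschitz_on_continuous: "locally_lipschitz_on D F \<Longrightarrow> continuous_on D F"
  unfolding locally_lipschitz_on_def by (rule local_lipschitz_continuous_on[where t = 0]) auto

lemma lipschitzian_on_compose_local:
  assumes "locally_lipschitz_on D F" "lipschitzian_on Z u" "compact Z" "u ` Z \<subseteq> D"
  shows "lipschitzian_on Z (\<lambda>z. F (u z))"
  by (rule lipschitzian_on_compose[OF assms(2)], rule locally_lipschitz_on_compact[OF assms(1) _ assms(4)])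
    (rule compact_continuous_image[OF lipschitzian_on_continuous[OF assms(2)] assms(3)])

lemma rate_on_Pair:
  assumes "rate_on T x w" "rate_on T y v"
  shows "rate_on T (\<lambda>t. (x t, y t)) (\<lambda>t. (w t, v t))"
proof -
  have "rate_on T (\<lambda>t. (x t, 0) + (0, y t)) (\<lambda>t. (w t, 0) + (0, v t))"
    by (intro rate_on_add rate_on_linear[OF assms(1)] rate_on_linear[OF assms(2)] bounded_linear_Pair
        bounded_linear_ident bounded_linear_zero)
  then show ?thesis by simp
qed

lemma has_rate_continuous:
  assumes "has_rate z w" shows "continuous_on {0..T} z"
proof (cases "T \<ge> 0")
  case True
  have i: "(w has_integral (z t - z 0)) {0..t}" if "t \<ge> 0" for t using assms that by (simp add: has_rate_def)
  have "continuous_on {0..T} (\<lambda>t. z 0 + integral {0..t} w)"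
    using i[OF True] by (intro continuous_intros indefinite_integral_continuous_1) blast
  then show ?thesis
    by (rule continuous_on_eq) (use integral_unique[OF i] in auto)
qed simp

lemma has_rate_imp_rate_on: "has_rate z w \<Longrightarrow> bounded (w ` {0..T}) \<Longrightarrow> rate_on T z w"
  unfolding has_rate_def rate_on_def by auto

lemma rate_on_imp_has_rate: "(\<And>T. rate_on T z w) \<Longrightarrow> has_rate z w"
  unfolding has_rate_def rate_on_def by (metis atLeastAtMost_iff order_refl)

lemma bounded_noise_rate:
  fixes c d :: "real \<Rightarrow> 'a::euclidean_space"
  assumes "continuous_on {0..T} c" "continuous_on {0..T} d" "\<And>t. t \<in> {0..T} \<Longrightarrow> \<bar>\<nu> t\<bar> \<le> nb"
  shows "bounded ((\<lambda>t. c t + \<nu> t *\<^sub>R d t) ` {0..T})"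
proof (rule bounded_plus_comp)
  show "bounded (c ` {0..T})" by (intro compact_imp_bounded compact_continuous_image assms) auto
  have "bounded (d ` {0..T})" by (intro compact_imp_bounded compact_continuous_image assms) auto
  then obtain B where B: "B > 0" "\<And>t. t \<in> {0..T} \<Longrightarrow> norm (d t) \<le> B" unfolding bounded_pos by auto
  show "bounded ((\<lambda>t. \<nu> t *\<^sub>R d t) ` {0..T})"
  proof (rule boundedI[of _ "nb * B"], safe)
    fix t assume "t \<in> {0..T}"
    then show "norm (\<nu> t *\<^sub>R d t) \<le> nb * B"
      using assms(3)[of t] B by (auto intro!: mult_mono intro: order_trans[OF abs_ge_zero])
  qed
qed

text \<open>Substituting y = c / \<epsilon> reduces the claim to y^k / exp y tending to 0;
  \<open>max Y 1\<close> keeps the resulting threshold for \<epsilon> positive.\<close>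

lemma exp_beats_power:
  fixes c R \<mu> :: real
  assumes c: "c > 0" and \<mu>: "\<mu> > 0"
  obtains d where "d > 0" "\<And>\<epsilon>. 0 < \<epsilon> \<Longrightarrow> \<epsilon> \<le> d \<Longrightarrow> R / \<epsilon> ^ k * exp (- c / \<epsilon>) < \<mu>"
proof -
  have "((\<lambda>y. \<bar>R\<bar> / c ^ k * (y ^ k / exp y)) \<longlongrightarrow> \<bar>R\<bar> / c ^ k * 0) at_top"
    by (intro tendsto_intros tendsto_power_div_exp_0)
  then have "eventually (\<lambda>y. \<bar>R\<bar> / c ^ k * (y ^ k / exp y) < \<mu>) at_top"
    by (rule order_tendstoD) (use \<mu> in simp)
  then obtain Y where Y: "\<And>y. y \<ge> Y \<Longrightarrow> \<bar>R\<bar> / c ^ k * (y ^ k / exp y) < \<mu>"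
    unfolding eventually_at_top_linorder by blast
  show ?thesis
  proof (rule that[of "c / max Y 1"])
    show "c / max Y 1 > 0" using c by simp
    fix \<epsilon> :: real assume \<epsilon>: "0 < \<epsilon>" "\<epsilon> \<le> c / max Y 1"
    then have "\<epsilon> * max Y 1 \<le> c" by (simp add: field_simps)
    moreover have "\<epsilon> * Y \<le> \<epsilon> * max Y 1" using \<epsilon> by (intro mult_left_mono) auto
    ultimately have "\<epsilon> * Y \<le> c" by linarith
    then have "Y \<le> c / \<epsilon>" using \<epsilon> by (simp add: field_simps)
    then have "\<bar>R\<bar> / c ^ k * ((c / \<epsilon>) ^ k / exp (c / \<epsilon>)) < \<mu>" by (rule Y)
    moreover have "\<bar>R\<bar> / c ^ k * ((c / \<epsilon>) ^ k / exp (c / \<epsilon>)) = \<bar>R\<bar> / \<epsilon> ^ k * exp (- c / \<epsilon>)"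
      using c \<epsilon> by (simp add: power_divide exp_minus field_simps)
    moreover have "R / \<epsilon> ^ k * exp (- c / \<epsilon>) \<le> \<bar>R\<bar> / \<epsilon> ^ k * exp (- c / \<epsilon>)"
      using \<epsilon> by (intro mult_right_mono divide_right_mono) auto
    ultimately show "R / \<epsilon> ^ k * exp (- c / \<epsilon>) < \<mu>" by linarith
  qed
qed

section \<open>A priori confinement and existence for the closed loop\<close>

definition closed_loop ::
  "(real ^ 'n::{finite,linorder} \<Rightarrow> real \<Rightarrow> real) \<Rightarrow> (real ^ 'n::{finite,linorder} \<Rightarrow> 'p::euclidean_space \<Rightarrow> real) \<Rightarrow>
   (real ^ 'n::{finite,linorder} \<Rightarrow> 'p \<Rightarrow> 'p) \<Rightarrow> (nat \<Rightarrow> real) \<Rightarrow> real \<Rightarrow> real ^ 'm \<Rightarrow> real \<Rightarrow> (real \<Rightarrow> real) \<Rightarrow> real \<Rightarrow>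
   (real \<Rightarrow> real ^ 'n::{finite,linorder}) \<Rightarrow> (real \<Rightarrow> 'p) \<Rightarrow> (real \<Rightarrow> 'm option \<Rightarrow> real ^ 'n::{finite,linorder}) \<Rightarrow>
   (real \<Rightarrow> real ^ 'm) \<Rightarrow> (real \<Rightarrow> real ^ 'm ^ 'm) \<Rightarrow> bool" where
  "closed_loop f g h \<kappa> \<gamma> \<beta>0 \<epsilon> \<nu> T x \<theta> xh \<beta> P \<longleftrightarrow>
     adaptive_observer \<kappa> \<gamma> \<beta>0 \<epsilon> \<nu> T x (\<lambda>t. f (x t) (g (weighted_estimate (\<beta> t) (xh t)) (\<theta> t))) xh \<beta> P \<and>
     rate_on T \<theta> (\<lambda>t. h (weighted_estimate (\<beta> t) (xh t)) (\<theta> t))"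

text \<open>An a priori statement shaped for \<open>stays_in_interior\<close>: it concludes at the
  final time of an arbitrary horizon. Only the pair of plant and controller state is presupposed to
  lie in \<open>K\<close>; the bounds on the observer variables are conclusions.\<close>

definition trapped ::
  "(real ^ 'n::{finite,linorder} \<Rightarrow> real \<Rightarrow> real) \<Rightarrow> (real ^ 'n::{finite,linorder} \<Rightarrow> 'p::euclidean_space \<Rightarrow> real) \<Rightarrow>
   (real ^ 'n::{finite,linorder} \<Rightarrow> 'p \<Rightarrow> 'p) \<Rightarrow> (nat \<Rightarrow> real) \<Rightarrow> real \<Rightarrow> real ^ 'm \<Rightarrow> real \<Rightarrow> (real \<Rightarrow> real) \<Rightarrow>
   real ^ 'n::{finite,linorder} \<Rightarrow> 'p \<Rightarrow> ('m option \<Rightarrow> real ^ 'n::{finite,linorder}) \<Rightarrow>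
   ((real ^ 'n::{finite,linorder}) \<times> 'p) set \<Rightarrow> real \<Rightarrow> bool" where
  "trapped f g h \<kappa> \<gamma> \<beta>0 \<epsilon> \<nu> x0 \<theta>0 xh0 K R \<longleftrightarrow>
    (\<forall>T x \<theta> xh \<beta> P. T \<ge> 0 \<longrightarrow> closed_loop f g h \<kappa> \<gamma> \<beta>0 \<epsilon> \<nu> T x \<theta> xh \<beta> P \<longrightarrow>
        x 0 = x0 \<longrightarrow> \<theta> 0 = \<theta>0 \<longrightarrow> xh 0 = xh0 \<longrightarrow> (\<forall>t\<in>{0..T}. (x t, \<theta> t) \<in> K) \<longrightarrow>
        (x T, \<theta> T) \<in> interior K \<and> (\<forall>i. norm (xh T i) \<le> R) \<and> norm (\<beta> T) \<le> R \<and> norm (P T) \<le> R)"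

lemma trappedD:
  assumes "trapped f g h \<kappa> \<gamma> \<beta>0 \<epsilon> \<nu> x0 \<theta>0 xh0 K R"
    and "T \<ge> 0" "closed_loop f g h \<kappa> \<gamma> \<beta>0 \<epsilon> \<nu> T x \<theta> xh \<beta> P" "x 0 = x0" "\<theta> 0 = \<theta>0" "xh 0 = xh0"
    and "\<forall>t\<in>{0..T}. (x t, \<theta> t) \<in> K"
  shows "(x T, \<theta> T) \<in> interior K \<and> (\<forall>i. norm (xh T i) \<le> R) \<and> norm (\<beta> T) \<le> R \<and> norm (P T) \<le> R"
  by (rule assms(1)[unfolded trapped_def, rule_format, OF assms(2-6)]) (use assms(7) in blast)

lemma lipschitzian_on_compose_pair:
  assumes "locally_lipschitz_on (A \<times> B) (\<lambda>(x, y). G x y)" "lipschitzian_on Z u" "lipschitzian_on Z v" "compact Z"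
    "\<And>z. z \<in> Z \<Longrightarrow> u z \<in> A \<and> v z \<in> B"
  shows "lipschitzian_on Z (\<lambda>z. G (u z) (v z))"
  using lipschitzian_on_compose_local[OF assms(1) lipschitzian_on_Pair[OF assms(2,3)] assms(4)] assms(5) by auto

lemma continuous_on_compose_pair:
  assumes "locally_lipschitz_on (A \<times> B) (\<lambda>(x, y). G x y)" "continuous_on S u" "continuous_on S v"
    "\<And>s. s \<in> S \<Longrightarrow> u s \<in> A \<and> v s \<in> B"
  shows "continuous_on S (\<lambda>s. G (u s) (v s))"
  using continuous_on_compose2[OF locally_lipschitz_on_continuous[OF assms(1)] continuous_on_Pair[OF assms(2,3)]] assms(4)
  by auto

lemma bounded_linear_matrix_vector: "bounded_linear (\<lambda>x. (A :: real^'b::finite^'a::finite) *v x)"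
  using bounded_bilinear.bounded_linear_right[OF bounded_bilinear_matrix_vector_mult] .

lemma lipschitzian_state_feedback_field:
  fixes f :: "real ^ 'n::{finite,linorder} \<Rightarrow> real \<Rightarrow> real"
  assumes f: "locally_lipschitz_on (X \<times> UNIV) (\<lambda>(x, u). f x u)"
    and g: "locally_lipschitz_on (UNIV \<times> \<Theta>) (\<lambda>(x, \<theta>). g x \<theta>)"
    and h: "locally_lipschitz_on (UNIV \<times> \<Theta>) (\<lambda>(x, \<theta>). h x \<theta>)"
    and K: "compact K" "K \<subseteq> X \<times> \<Theta>"
  shows "lipschitzian_on K (state_feedback_field f g h)"
proof -
  have *: "state_feedback_field f g h = (\<lambda>z. (chain_A *v fst z + f (fst z) (g (fst z) (snd z)) *\<^sub>R axis (coord CARD('n)) 1, h (fst z) (snd z)))"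
    by (auto simp: state_feedback_field_def chain_B_mult fun_eq_iff)
  have l: "lipschitzian_on K fst" "lipschitzian_on K snd"
    using lipschitzian_on_linear[OF lipschitzian_on_id bounded_linear_fst]
      lipschitzian_on_linear[OF lipschitzian_on_id bounded_linear_snd] by auto
  have in_KX: "fst z \<in> X" "snd z \<in> \<Theta>" if "z \<in> K" for z using K that by auto
  show ?thesis unfolding *
    by (intro lipschitzian_on_Pair lipschitzian_on_add lipschitzian_on_linear[OF l(1) bounded_linear_matrix_vector]
        lipschitzian_on_bilinear[OF bounded_bilinear_scaleR K(1)] lipschitzian_on_const
        lipschitzian_on_compose_pair[OF f _ _ K(1)] lipschitzian_on_compose_pair[OF g _ _ K(1)]
        lipschitzian_on_compose_pair[OF h _ _ K(1)] l) (use in_KX in auto)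
qed

text \<open>\<open>total_stability\<close> says how accurate the estimate must be from
  \<open>t0\<close> on, \<open>adaptive_observer_bounds\<close> delivers that accuracy, and the
  proof balances the constants.\<close>

lemma closed_loop_invariance:
  fixes f :: "real ^ 'n::{finite,linorder} \<Rightarrow> real \<Rightarrow> real"
    and g :: "real ^ 'n::{finite,linorder} \<Rightarrow> 'p::euclidean_space \<Rightarrow> real"
    and h :: "real ^ 'n::{finite,linorder} \<Rightarrow> 'p \<Rightarrow> 'p"
    and \<beta>0 :: "real ^ 'm"
  assumes X: "open X" and \<Theta>: "open \<Theta>"
    and f: "locally_lipschitz_on (X \<times> UNIV) (\<lambda>(x, u). f x u)"
    and g: "locally_lipschitz_on (UNIV \<times> \<Theta>) (\<lambda>(x, \<theta>). g x \<theta>)"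
    and h: "locally_lipschitz_on (UNIV \<times> \<Theta>) (\<lambda>(x, \<theta>). h x \<theta>)"
    and gb: "globally_bounded_in_state \<Theta> g" and hb: "globally_bounded_in_state \<Theta> h"
    and Sig: "compact Sig" "Sig \<noteq> {}" "Sig \<subseteq> X \<times> \<Theta>"
    and uas: "uniformly_asymptotically_stable (state_feedback_field f g h) (X \<times> \<Theta>) Sig"
    and S1: "compact S1" "S1 \<subseteq> region_of_attraction (state_feedback_field f g h) (X \<times> \<Theta>) Sig"
    and S2: "compact S2"
    and hur: "hurwitz_coeffs CARD('n) \<kappa>" and \<gamma>: "\<gamma> > 0"
  obtains K \<nu>s \<epsilon>1 \<epsilon>2 where "compact K" "K \<subseteq> X \<times> \<Theta>" "S1 \<subseteq> K" "0 < \<nu>s" "0 < \<epsilon>1" "\<epsilon>1 < \<epsilon>2" "\<epsilon>2 \<le> 1"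
    "\<And>\<nu> \<epsilon> x0 \<theta>0 xh0. \<nu> \<in> borel_measurable (lebesgue_on {0..}) \<Longrightarrow> (\<And>t. t \<ge> 0 \<Longrightarrow> \<bar>\<nu> t\<bar> \<le> \<nu>s) \<Longrightarrow> \<epsilon> \<in> {\<epsilon>1..\<epsilon>2} \<Longrightarrow>
      (x0, \<theta>0) \<in> S1 \<Longrightarrow> weighted_estimate \<beta>0 xh0 \<in> S2 \<Longrightarrow>
      \<exists>R. trapped f g h \<kappa> \<gamma> \<beta>0 \<epsilon> \<nu> x0 \<theta>0 xh0 K R"
proof -
  define F where "F = state_feedback_field f g h"
  define b where "b = (axis (coord CARD('n)) 1 :: (real, 'n) vec)"
  \<comment> \<open>The closed-loop field with an arbitrary vector in the place of the estimate; the
    estimate equal to the true state gives back \<open>F\<close>.\<close>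
  define \<Phi> where "\<Phi> x' z = (chain_A *v fst z + f (fst z) (g x' (snd z)) *\<^sub>R b, h x' (snd z))" for x' :: "(real, 'n) vec" and z
  have F\<Phi>: "F z = \<Phi> (fst z) z" for z
    by (simp add: F_def \<Phi>_def state_feedback_field_def chain_B_mult b_def split_beta)
  obtain K where K: "compact K" "K \<subseteq> X \<times> \<Theta>" "S1 \<subseteq> K" and
    inv: "\<And>M. M \<ge> 0 \<Longrightarrow> \<exists>t0>0. \<exists>\<mu>>0. \<forall>T z v. T \<ge> 0 \<longrightarrow> rate_on T z v \<longrightarrow> z 0 \<in> S1 \<longrightarrow>
      (\<forall>t\<in>{0..T}. norm (v t) \<le> M) \<longrightarrow> (\<forall>t\<in>{0..T}. t0 \<le> t \<longrightarrow> norm (v t - F (z t)) \<le> \<mu>) \<longrightarrow>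
      z T \<in> interior K"
    by (rule total_stability[OF open_Times[OF X \<Theta>], of F Sig S1])
      (use Sig uas S1 lipschitzian_state_feedback_field[OF f g h] in \<open>auto simp: F_def lipschitzian_on_def\<close>)
  have KX: "fst z \<in> X" "snd z \<in> \<Theta>" if "z \<in> K" for z using K that by auto
  have cfst: "compact (fst ` K)" and csnd: "compact (snd ` K)"
    using K(1) by (auto intro!: compact_continuous_image continuous_intros)
  have "snd ` K \<subseteq> \<Theta>" using KX by auto
  with gb hb csnd have "bounded {g x \<theta> |x \<theta>. \<theta> \<in> snd ` K}" "bounded {h x \<theta> |x \<theta>. \<theta> \<in> snd ` K}"
    unfolding globally_bounded_in_state_def by blast+
  then obtain Ug Uh where Ug: "Ug > 0" "\<forall>y\<in>{g x \<theta> |x \<theta>. \<theta> \<in> snd ` K}. norm y \<le> Ug"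
    and Uh: "Uh > 0" "\<forall>y\<in>{h x \<theta> |x \<theta>. \<theta> \<in> snd ` K}. norm y \<le> Uh" unfolding bounded_pos by blast
  have gU: "\<bar>g x' (snd z)\<bar> \<le> Ug" and hU: "norm (h x' (snd z)) \<le> Uh" if "z \<in> K" for x' z
  proof -
    have "g x' (snd z) \<in> {g x \<theta> |x \<theta>. \<theta> \<in> snd ` K}" "h x' (snd z) \<in> {h x \<theta> |x \<theta>. \<theta> \<in> snd ` K}"
      using that by blast+
    from bspec[OF Ug(2) this(1)] bspec[OF Uh(2) this(2)]
    show "\<bar>g x' (snd z)\<bar> \<le> Ug" "norm (h x' (snd z)) \<le> Uh" by simp_all
  qed
  have "continuous_on (fst ` K \<times> cball 0 Ug) (\<lambda>p. f (fst p) (snd p))"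
    by (intro continuous_on_compose_pair[OF f] continuous_intros) (use KX in auto)
  then have "bounded ((\<lambda>p. f (fst p) (snd p)) ` (fst ` K \<times> cball 0 Ug))"
    by (intro compact_imp_bounded compact_continuous_image compact_Times cfst) auto
  then obtain kf where kf: "kf > 0" "\<And>p. p \<in> fst ` K \<times> cball 0 Ug \<Longrightarrow> \<bar>f (fst p) (snd p)\<bar> \<le> kf"
    unfolding bounded_pos real_norm_def by blast
  have fk: "\<bar>f (fst z) (g x' (snd z))\<bar> \<le> kf" if "z \<in> K" for x' z
    using kf(2)[of "(fst z, g x' (snd z))"] gU[OF that] that by auto
  have "bounded ((\<lambda>z. chain_A *v fst z) ` K)"
    by (intro compact_imp_bounded compact_continuous_image K(1) bounded_linear.continuous_on[OF bounded_linear_matrix_vector] continuous_intros)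
  then obtain BA where BA: "BA > 0" "\<And>z. z \<in> K \<Longrightarrow> norm (chain_A *v fst z) \<le> BA" unfolding bounded_pos by auto
  obtain Bx where Bx: "Bx > 0" "\<And>z. z \<in> K \<Longrightarrow> norm (fst z) \<le> Bx"
    using compact_imp_bounded[OF cfst] unfolding bounded_pos by auto
  define M where "M = BA + kf + Uh"
  have \<Phi>M: "norm (\<Phi> x' z) \<le> M" if z: "z \<in> K" for x' z
  proof -
    have "norm (\<Phi> x' z) \<le> norm (chain_A *v fst z + f (fst z) (g x' (snd z)) *\<^sub>R b) + norm (h x' (snd z))"
      unfolding \<Phi>_def by (rule norm_Pair_le)
    also have "norm (chain_A *v fst z + f (fst z) (g x' (snd z)) *\<^sub>R b) \<le> norm (chain_A *v fst z) + \<bar>f (fst z) (g x' (snd z))\<bar>"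
      using norm_triangle_ineq[of "chain_A *v fst z" "f (fst z) (g x' (snd z)) *\<^sub>R b"] by (simp add: b_def)
    finally show ?thesis using BA(2)[OF z] fk[OF z, of x'] hU[OF z, of x'] by (simp add: M_def)
  qed
  obtain t0 \<mu> where t0: "t0 > 0" and \<mu>: "\<mu> > 0" and
    stay: "\<And>T z v. T \<ge> 0 \<Longrightarrow> rate_on T z v \<Longrightarrow> z 0 \<in> S1 \<Longrightarrow>
      (\<forall>t\<in>{0..T}. norm (v t) \<le> M) \<Longrightarrow> (\<forall>t\<in>{0..T}. t0 \<le> t \<longrightarrow> norm (v t - F (z t)) \<le> \<mu>) \<Longrightarrow> z T \<in> interior K"
    using inv[of M] BA(1) kf(1) Uh(1) unfolding M_def by fastforce
  \<comment> \<open>The unit neighbourhood of the plant states in \<open>K\<close>. It contains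
    every estimate with error below \<open>\<mu>2 \<le> 1\<close> and is compact, so the field is
    uniformly continuous there.\<close>
  define Kx where "Kx = {x + y |x y. x \<in> fst ` K \<and> y \<in> cball (0 :: (real, 'n) vec) 1}"
  have cKx: "compact Kx" unfolding Kx_def by (rule compact_sums[OF cfst compact_cball])
  have "continuous_on (Kx \<times> K) (\<lambda>p. \<Phi> (fst p) (snd p))"
    unfolding \<Phi>_def
    by (intro continuous_on_Pair continuous_on_add continuous_on_scaleR continuous_on_const
        bounded_linear.continuous_on[OF bounded_linear_matrix_vector]
        continuous_on_compose_pair[OF f] continuous_on_compose_pair[OF g] continuous_on_compose_pair[OF h]
        continuous_on_fst continuous_on_snd continuous_on_id) (use KX in auto)
  then have "uniformly_continuous_on (Kx \<times> K) (\<lambda>p. \<Phi> (fst p) (snd p))"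
    by (rule compact_uniformly_continuous) (intro compact_Times cKx K(1))
  then obtain \<eta> where \<eta>: "\<eta> > 0" "\<And>p p'. p \<in> Kx \<times> K \<Longrightarrow> p' \<in> Kx \<times> K \<Longrightarrow> dist p' p < \<eta> \<Longrightarrow>
      dist (\<Phi> (fst p') (snd p')) (\<Phi> (fst p) (snd p)) < \<mu>"
    using \<mu> unfolding uniformly_continuous_on_def by metis
  define \<mu>2 where "\<mu>2 = min \<eta> 1"
  have \<mu>2: "\<mu>2 > 0" "\<mu>2 \<le> \<eta>" "\<mu>2 \<le> 1" using \<eta> by (auto simp: \<mu>2_def)
  have \<Phi>F: "norm (\<Phi> x' z - F z) \<le> \<mu>" if z: "z \<in> K" and x': "norm (fst z - x') < \<mu>2" for x' z
  proof -
    have "fst z + 0 \<in> Kx" unfolding Kx_def using z by (intro CollectI exI[of _ "fst z"] exI[of _ 0]) auto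
    moreover have "fst z + (x' - fst z) \<in> Kx"
      unfolding Kx_def using z x' \<mu>2 by (intro CollectI exI[of _ "fst z"] exI[of _ "x' - fst z"]) (auto simp: norm_minus_commute)
    ultimately have "dist (\<Phi> (fst (x', z)) (snd (x', z))) (\<Phi> (fst (fst z, z)) (snd (fst z, z))) < \<mu>"
      by (intro \<eta>) (use z x' \<mu>2 in \<open>auto simp: dist_Pair_Pair dist_norm norm_minus_commute\<close>)
    then show ?thesis by (simp add: F\<Phi> dist_norm)
  qed
  obtain C a where C: "C \<ge> 1" and a: "a > 0" and
    ao: "\<And>\<gamma> (\<beta>0 :: real^'m) \<epsilon> \<nu> T (x :: real \<Rightarrow> real^'n::{finite,linorder}) \<phi> xh \<beta> P kf nb t.
      adaptive_observer \<kappa> \<gamma> \<beta>0 \<epsilon> \<nu> T x \<phi> xh \<beta> P \<Longrightarrow> 0 < \<epsilon> \<Longrightarrow> \<epsilon> \<le> 1 \<Longrightarrow> \<gamma> > 0 \<Longrightarrow>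
      \<nu> absolutely_integrable_on {0..T} \<Longrightarrow>
      (\<And>t. t \<in> {0..T} \<Longrightarrow> \<bar>\<phi> t\<bar> \<le> kf) \<Longrightarrow> (\<And>t. t \<in> {0..T} \<Longrightarrow> \<bar>\<nu> t\<bar> \<le> nb) \<Longrightarrow> t \<in> {0..T} \<Longrightarrow>
      (\<epsilon> \<le> t \<longrightarrow> norm (x t - weighted_estimate (\<beta> t) (xh t)) \<le> C / \<epsilon> ^ (CARD('n) - 1) *
         (exp (- a * t / \<epsilon>) * norm (x 0 - weighted_estimate \<beta>0 (xh 0)) + \<epsilon> ^ CARD('n) * kf + nb)) \<and>
      (\<forall>i. norm (x t - xh t i) \<le> C / \<epsilon> ^ (CARD('n) - 1) * (norm (x 0 - xh 0 i) + \<epsilon> ^ CARD('n) * kf + nb)) \<and>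
      norm (\<beta> t) \<le> norm \<beta>0 + \<gamma> * (C * (norm (x 0 - weighted_estimate \<beta>0 (xh 0)) + \<epsilon> ^ CARD('n) * kf + nb)
         * (\<Sum>j\<in>UNIV. norm (xh 0 None - xh 0 (Some j)))) \<and>
      norm (P t) \<le> real CARD('m) * (real CARD('m) * \<gamma>)"
    by (rule adaptive_observer_bounds[OF hur]) blast
  obtain B1 where B1: "B1 > 0" "\<And>z. z \<in> S1 \<Longrightarrow> norm z \<le> B1" using compact_imp_bounded[OF S1(1)] unfolding bounded_pos by auto
  obtain B2 where B2: "B2 > 0" "\<And>z. z \<in> S2 \<Longrightarrow> norm z \<le> B2" using compact_imp_bounded[OF S2] unfolding bounded_pos by auto
  define R0 where "R0 = B1 + B2"
  have R0: "norm (x0 - y) \<le> R0" if "(x0, \<theta>0) \<in> S1" "y \<in> S2" for x0 \<theta>0 y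
    using B1(2)[OF that(1)] B2(2)[OF that(2)] norm_fst_le[of x0 \<theta>0] norm_triangle_ineq4[of x0 y] by (simp add: R0_def)
  obtain d where d: "d > 0" "\<And>\<epsilon>. 0 < \<epsilon> \<Longrightarrow> \<epsilon> \<le> d \<Longrightarrow> C * R0 / \<epsilon> ^ (CARD('n) - 1) * exp (- (a * t0) / \<epsilon>) < \<mu>2 / 3"
    by (rule exp_beats_power[of "a * t0" "\<mu>2 / 3"]) (use a t0 \<mu>2 in auto)
  \<comment> \<open>The bound \<open>t0\<close> makes the observer estimate, valid after time
    \<epsilon>, available at \<open>t0\<close>. The bound \<open>d\<close> keeps the transient, and
    the last term the nonlinearity, below \<open>\<mu>2 / 3\<close> each; the nonlinearity enters as
    C kf \<epsilon> because \<epsilon>^n is divided by \<epsilon>^(n-1).\<close>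
  define \<epsilon>2 where "\<epsilon>2 = min (min 1 t0) (min d (\<mu>2 / (3 * (C * kf + 1))))"
  define \<epsilon>1 where "\<epsilon>1 = \<epsilon>2 / 2"
  \<comment> \<open>The noise amplification 1 / \<epsilon>^(n-1) is worst at
    \<open>\<epsilon>1\<close>; this level makes its contribution at most the remaining
    \<open>\<mu>2 / 3\<close>.\<close>
  define \<nu>s where "\<nu>s = \<mu>2 * \<epsilon>1 ^ (CARD('n) - 1) / (3 * C)"
  have Ckf: "C * kf + 1 > 0" using C kf by (intro add_nonneg_pos mult_nonneg_nonneg) auto
  have \<epsilon>2: "\<epsilon>2 > 0" "\<epsilon>2 \<le> 1" "\<epsilon>2 \<le> t0" "\<epsilon>2 \<le> d" "\<epsilon>2 \<le> \<mu>2 / (3 * (C * kf + 1))"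
    using t0 d \<mu>2 Ckf by (auto simp: \<epsilon>2_def)
  have \<epsilon>1: "\<epsilon>1 > 0" "\<epsilon>1 < \<epsilon>2" using \<epsilon>2 by (auto simp: \<epsilon>1_def)
  have \<nu>s: "\<nu>s > 0" using \<mu>2 \<epsilon>1 C by (simp add: \<nu>s_def)
  show ?thesis
  proof (rule that[OF K \<nu>s \<epsilon>1 \<epsilon>2(2)])
    fix \<nu> :: "real \<Rightarrow> real" and \<epsilon> x0 \<theta>0 and xh0 :: "'m option \<Rightarrow> (real, 'n) vec"
    assume \<nu>: "\<nu> \<in> borel_measurable (lebesgue_on {0..})" "\<And>t. t \<ge> 0 \<Longrightarrow> \<bar>\<nu> t\<bar> \<le> \<nu>s"
      and \<epsilon>: "\<epsilon> \<in> {\<epsilon>1..\<epsilon>2}" and x0: "(x0, \<theta>0) \<in> S1" and xh0: "weighted_estimate \<beta>0 xh0 \<in> S2"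
    have e: "0 < \<epsilon>" "\<epsilon> \<le> 1" "\<epsilon> \<le> t0" "\<epsilon> \<le> d" using \<epsilon> \<epsilon>1 \<epsilon>2 by auto
    define en where "en = \<epsilon> ^ (CARD('n) - 1)"
    have en: "en > 0" using e by (simp add: en_def)
    have enn: "\<epsilon> ^ CARD('n) = en * \<epsilon>" unfolding en_def by (metis One_nat_def Suc_leI Suc_pred power_Suc2 zero_less_card_finite)
    \<comment> \<open>The individual initial estimates enter \<open>Rh\<close> and
      \<open>Rb\<close>, hence the final bound, but none of the constants fixed before.\<close>
    define Rh where "Rh i = C / en * (norm (x0 - xh0 i) + \<epsilon> ^ CARD('n) * kf + \<nu>s)" for i
    define Rb where "Rb = norm \<beta>0 + \<gamma> * (C * (norm (x0 - weighted_estimate \<beta>0 xh0) + \<epsilon> ^ CARD('n) * kf + \<nu>s)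
         * (\<Sum>j\<in>UNIV. norm (xh0 None - xh0 (Some j))))"
    define Rp where "Rp = real CARD('m) * (real CARD('m) * \<gamma>)"
    have nn: "Rh i \<ge> 0" "Rb \<ge> 0" "Rp \<ge> 0" for i
      using C en e kf \<nu>s \<gamma> by (auto simp: Rh_def Rb_def Rp_def intro!: add_nonneg_nonneg mult_nonneg_nonneg sum_nonneg)
    show "\<exists>R. trapped f g h \<kappa> \<gamma> \<beta>0 \<epsilon> \<nu> x0 \<theta>0 xh0 K R"
      unfolding trapped_def
    proof (intro exI[of _ "Bx + sum Rh UNIV + Rb + Rp"] allI impI)
      fix T and x :: "real \<Rightarrow> (real, 'n) vec" and \<theta> :: "real \<Rightarrow> 'p" and xh and \<beta> :: "real \<Rightarrow> real^'m" and P
      assume T: "T \<ge> 0" and cl: "closed_loop f g h \<kappa> \<gamma> \<beta>0 \<epsilon> \<nu> T x \<theta> xh \<beta> P"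
        and i0: "x 0 = x0" "\<theta> 0 = \<theta>0" "xh 0 = xh0" and inK: "\<forall>t\<in>{0..T}. (x t, \<theta> t) \<in> K"
      define xo where "xo t = weighted_estimate (\<beta> t) (xh t)" for t
      have ad: "adaptive_observer \<kappa> \<gamma> \<beta>0 \<epsilon> \<nu> T x (\<lambda>t. f (x t) (g (xo t) (\<theta> t))) xh \<beta> P"
        and r\<theta>: "rate_on T \<theta> (\<lambda>t. h (xo t) (\<theta> t))" using cl by (auto simp: closed_loop_def xo_def)
      have bounds: "(\<epsilon> \<le> t \<longrightarrow> norm (x t - xo t) \<le> C / en * (exp (- a * t / \<epsilon>) * norm (x0 - weighted_estimate \<beta>0 xh0) + \<epsilon> ^ CARD('n) * kf + \<nu>s)) \<and>
        (\<forall>i. norm (x t - xh t i) \<le> Rh i) \<and> norm (\<beta> t) \<le> Rb \<and> norm (P t) \<le> Rp" if t: "t \<in> {0..T}" for t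
        using ao[OF ad e(1,2) \<gamma> noise_absolutely_integrable[OF \<nu>] _ _ t, of kf \<nu>s] fk[of "(x _, \<theta> _)"] inK \<nu>(2)
        unfolding i0 xo_def en_def Rh_def Rb_def Rp_def by auto
      have rz: "rate_on T (\<lambda>t. (x t, \<theta> t)) (\<lambda>t. \<Phi> (xo t) (x t, \<theta> t))"
        using rate_on_Pair[OF ad[unfolded adaptive_observer_def, THEN conjunct1] r\<theta>] by (simp add: \<Phi>_def b_def)
      have "(x T, \<theta> T) \<in> interior K"
      proof (rule stay[OF T rz])
        show "(x 0, \<theta> 0) \<in> S1" using i0 x0 by simp
        show "\<forall>t\<in>{0..T}. norm (\<Phi> (xo t) (x t, \<theta> t)) \<le> M" using \<Phi>M inK by blast
        show "\<forall>t\<in>{0..T}. t0 \<le> t \<longrightarrow> norm (\<Phi> (xo t) (x t, \<theta> t) - F (x t, \<theta> t)) \<le> \<mu>"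
        proof (intro ballI impI \<Phi>F)
          fix t assume t: "t \<in> {0..T}" "t0 \<le> t"
          show "(x t, \<theta> t) \<in> K" using inK t by blast
          have "norm (x t - xo t) \<le> C / en * (exp (- a * t / \<epsilon>) * norm (x0 - weighted_estimate \<beta>0 xh0) + \<epsilon> ^ CARD('n) * kf + \<nu>s)"
            using bounds[OF t(1)] t e by auto
          also have "\<dots> \<le> C / en * (exp (- (a * t0) / \<epsilon>) * R0 + \<epsilon> ^ CARD('n) * kf + \<nu>s)"
          proof (intro mult_left_mono add_right_mono mult_mono R0[OF x0 xh0])
            have "a * t0 \<le> a * t" using a t by (intro mult_left_mono) auto
            then show "exp (- a * t / \<epsilon>) \<le> exp (- (a * t0) / \<epsilon>)" using e by (simp add: divide_right_mono)
          qed (use C en in auto)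
          also have "\<dots> = C * R0 / en * exp (- (a * t0) / \<epsilon>) + C * kf * \<epsilon> + C / en * \<nu>s"
            unfolding enn using en by (simp add: field_simps)
          also have "\<dots> < \<mu>2 / 3 + \<mu>2 / 3 + \<mu>2 / 3"
          proof (intro add_less_le_mono)
            show "C * R0 / en * exp (- (a * t0) / \<epsilon>) < \<mu>2 / 3" unfolding en_def by (rule d(2)[OF e(1,4)])
            have "C * kf * \<epsilon> \<le> (C * kf + 1) * \<epsilon>" using e by (simp add: algebra_simps)
            also have "\<dots> \<le> (C * kf + 1) * (\<mu>2 / (3 * (C * kf + 1)))"
              using \<epsilon> \<epsilon>2 Ckf by (intro mult_left_mono) auto
            also have "\<dots> = \<mu>2 / 3"
            proof -
              have "q * (\<mu>2 / (3 * q)) = \<mu>2 / 3" if "q > 0" for q :: real using that by simp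
              then show ?thesis using Ckf by blast
            qed
            finally show "C * kf * \<epsilon> \<le> \<mu>2 / 3" .
            have "\<epsilon>1 ^ (CARD('n) - 1) \<le> en" unfolding en_def using \<epsilon> \<epsilon>1 by (intro power_mono) auto
            then have "\<mu>2 * \<epsilon>1 ^ (CARD('n) - 1) \<le> \<mu>2 * en" using \<mu>2 by (intro mult_left_mono) auto
            then show "C / en * \<nu>s \<le> \<mu>2 / 3" unfolding \<nu>s_def using C en by (simp add: field_simps)
          qed
          finally show "norm (fst (x t, \<theta> t) - xo t) < \<mu>2" by simp
        qed
      qed
      moreover have "norm (xh T i) \<le> Bx + sum Rh UNIV + Rb + Rp" for i
      proof -
        have "norm (xh T i) \<le> norm (x T) + norm (x T - xh T i)" by (metis norm_minus_commute norm_triangle_sub)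
        moreover have "norm (x T) \<le> Bx" using Bx(2)[of "(x T, \<theta> T)"] inK T by auto
        moreover have "norm (x T - xh T i) \<le> Rh i" using bounds[of T] T by auto
        moreover have "Rh i \<le> sum Rh UNIV" by (rule member_le_sum) (use nn in auto)
        ultimately show ?thesis using nn by (smt (verit))
      qed
      moreover have "norm (\<beta> T) \<le> Bx + sum Rh UNIV + Rb + Rp" "norm (P T) \<le> Bx + sum Rh UNIV + Rb + Rp"
        using bounds[of T] T nn Bx sum_nonneg[of UNIV Rh] by auto
      ultimately show "(x T, \<theta> T) \<in> interior K \<and> (\<forall>i. norm (xh T i) \<le> Bx + sum Rh UNIV + Rb + Rp) \<and>
          norm (\<beta> T) \<le> Bx + sum Rh UNIV + Rb + Rp \<and> norm (P T) \<le> Bx + sum Rh UNIV + Rb + Rp" by blast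
    qed
  qed
qed

lemma norm_vec_le_sum: "norm (v :: 'b::real_normed_vector^'i) \<le> (\<Sum>i\<in>UNIV. norm (v $ i))"
  by (simp add: norm_vec_def L2_set_le_sum)

text \<open>All unknowns are joined into one state of a Euclidean space whose equation is affine in
  the noise, so that \<open>noise_driven_solution_in_compact\<close> applies with
  \<open>trapped\<close> as the a priori estimate.\<close>

lemma closed_loop_exists:
  fixes f :: "real ^ 'n::{finite,linorder} \<Rightarrow> real \<Rightarrow> real"
    and g :: "real ^ 'n::{finite,linorder} \<Rightarrow> 'p::euclidean_space \<Rightarrow> real"
    and h :: "real ^ 'n::{finite,linorder} \<Rightarrow> 'p \<Rightarrow> 'p"
    and \<beta>0 :: "real ^ 'm" and xh0 :: "'m option \<Rightarrow> real ^ 'n::{finite,linorder}"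
  assumes f: "locally_lipschitz_on (X \<times> UNIV) (\<lambda>(x, u). f x u)"
    and g: "locally_lipschitz_on (UNIV \<times> \<Theta>) (\<lambda>(x, \<theta>). g x \<theta>)"
    and h: "locally_lipschitz_on (UNIV \<times> \<Theta>) (\<lambda>(x, \<theta>). h x \<theta>)"
    and K: "compact K" "K \<subseteq> X \<times> \<Theta>" and x0: "(x0, \<theta>0) \<in> K"
    and \<nu>: "\<nu> \<in> borel_measurable (lebesgue_on {0..})" "\<And>t. t \<ge> 0 \<Longrightarrow> \<bar>\<nu> t\<bar> \<le> \<nu>s"
    and inv: "trapped f g h \<kappa> \<gamma> \<beta>0 \<epsilon> \<nu> x0 \<theta>0 xh0 K R"
  obtains x \<theta> xh \<beta> P where "x 0 = x0" "\<theta> 0 = \<theta>0" "xh 0 = xh0"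
    "\<forall>T. closed_loop f g h \<kappa> \<gamma> \<beta>0 \<epsilon> \<nu> T x \<theta> xh \<beta> P" "\<forall>t\<ge>0. (x t, \<theta> t) \<in> K"
proof -
  define b where "b = (axis (coord CARD('n)) 1 :: (real, 'n) vec)"
  define H where "H = (gain_vec \<kappa> \<epsilon> :: (real, 'n) vec)"
  \<comment> \<open>The estimates are stored as a vector over the observer indices instead of a
    function, which makes the joint state space Euclidean.\<close>
  define px where "px s = fst (fst s)" for s :: "((real,'n) vec \<times> 'p) \<times> ((real,'n) vec, 'm option) vec \<times> (real,'m) vec \<times> ((real,'m) vec,'m) vec"
  define pt where "pt s = snd (fst s)" for s :: "((real,'n) vec \<times> 'p) \<times> ((real,'n) vec, 'm option) vec \<times> (real,'m) vec \<times> ((real,'m) vec,'m) vec"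
  define py where "py s = fst (snd s)" for s :: "((real,'n) vec \<times> 'p) \<times> ((real,'n) vec, 'm option) vec \<times> (real,'m) vec \<times> ((real,'m) vec,'m) vec"
  define pb where "pb s = fst (snd (snd s))" for s :: "((real,'n) vec \<times> 'p) \<times> ((real,'n) vec, 'm option) vec \<times> (real,'m) vec \<times> ((real,'m) vec,'m) vec"
  define pp where "pp s = snd (snd (snd s))" for s :: "((real,'n) vec \<times> 'p) \<times> ((real,'n) vec, 'm option) vec \<times> (real,'m) vec \<times> ((real,'m) vec,'m) vec"
  note pd = px_def pt_def py_def pb_def pp_def
  have bl: "bounded_linear px" "bounded_linear pt" "bounded_linear py" "bounded_linear pb" "bounded_linear pp"
    unfolding pd by (intro bounded_linear_intros)+
  define xo where "xo s = weighted_estimate (pb s) (\<lambda>i. py s $ i)" for s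
  define m where "m s = innov (\<lambda>i. py s $ i)" for s
  \<comment> \<open>The noise-free part of the equations; \<open>G1\<close> collects the coefficient
    of the noise, which occurs in the estimates and in the weights.\<close>
  define G0 where "G0 s = ((chain_A *v px s + f (px s) (g (xo s) (pt s)) *\<^sub>R b, h (xo s) (pt s)),
      (\<chi> i. chain_A *v (py s $ i) + (px s $ coord 1 - py s $ i $ coord 1) *\<^sub>R H),
      - ((px s $ coord 1 - py s $ None $ coord 1 + m s \<bullet> pb s) *\<^sub>R (pp s *v m s)),
      - (pp s ** outer (m s) ** pp s))" for s
  define G1 where "G1 s = ((0 :: (real,'n) vec, 0 :: 'p), (\<chi> i::'m option. H), - (pp s *v m s), 0 :: real^'m^'m)" for s
  \<comment> \<open>The multiples of \<open>R\<close> come from \<open>trapped\<close>, the norms of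
    the initial data place \<open>s0\<close> in \<open>Z\<close>, and the summand 1 puts the bounded
    values strictly inside. The cardinality turns a bound on each estimate into one on their
    vector.\<close>
  define Z where "Z = K \<times> cball (0 :: ((real,'n) vec, 'm option) vec) (real CARD('m option) * R + norm (\<chi> i. xh0 i) + 1) \<times>
      cball (0 :: real^'m) (R + norm \<beta>0 + 1) \<times> cball (0 :: real^'m^'m) (R + norm (\<gamma> *\<^sub>R mat 1 :: real^'m^'m) + 1)"
  define s0 where "s0 = ((x0, \<theta>0), (\<chi> i. xh0 i), \<beta>0, \<gamma> *\<^sub>R mat 1 :: real^'m^'m)"
  have cZ: "compact Z" unfolding Z_def by (intro compact_Times K(1) compact_cball)
  have clp: "closed_loop f g h \<kappa> \<gamma> \<beta>0 \<epsilon> \<nu> T (\<lambda>t. px (z t)) (\<lambda>t. pt (z t)) (\<lambda>t i. py (z t) $ i) (\<lambda>t. pb (z t)) (\<lambda>t. pp (z t))"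
    if r: "rate_on T z (\<lambda>t. G0 (z t) + \<nu> t *\<^sub>R G1 (z t))" and z0: "z 0 = s0" for T z
  proof -
    have eq: "px (G0 s + n *\<^sub>R G1 s) = chain_A *v px s + f (px s) (g (xo s) (pt s)) *\<^sub>R b"
      "pt (G0 s + n *\<^sub>R G1 s) = h (xo s) (pt s)"
      "py (G0 s + n *\<^sub>R G1 s) $ i = chain_A *v (py s $ i) + (px s $ coord 1 + n - py s $ i $ coord 1) *\<^sub>R H"
      "pb (G0 s + n *\<^sub>R G1 s) = - ((px s $ coord 1 + n - py s $ None $ coord 1 + m s \<bullet> pb s) *\<^sub>R (pp s *v m s))"
      "pp (G0 s + n *\<^sub>R G1 s) = - (pp s ** outer (m s) ** pp s)" for s n i
      by (simp_all add: G0_def G1_def pd algebra_simps)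
    show ?thesis
      unfolding closed_loop_def adaptive_observer_def
      using rate_on_linear[OF r bl(1)] rate_on_linear[OF r bl(2)] rate_on_linear[OF r bl(4)] rate_on_linear[OF r bl(5)]
        rate_on_linear[OF r bounded_linear_compose[OF bounded_linear_vec_nth bl(3)]]
      unfolding eq xo_def m_def b_def H_def by (simp add: z0 s0_def pd)
  qed
  have lx: "lipschitzian_on Z px" and lt: "lipschitzian_on Z pt" and ly: "lipschitzian_on Z py"
    and lb: "lipschitzian_on Z pb" and lp: "lipschitzian_on Z pp"
    using lipschitzian_on_linear[OF lipschitzian_on_id bl(1)] lipschitzian_on_linear[OF lipschitzian_on_id bl(2)]
      lipschitzian_on_linear[OF lipschitzian_on_id bl(3)] lipschitzian_on_linear[OF lipschitzian_on_id bl(4)]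
      lipschitzian_on_linear[OF lipschitzian_on_id bl(5)] by auto
  note lnth = lipschitzian_on_linear[OF _ bounded_linear_vec_nth]
  note lscale = lipschitzian_on_bilinear[OF bounded_bilinear_scaleR cZ]
  have lyi: "lipschitzian_on Z (\<lambda>s. py s $ i)" for i by (rule lnth[OF ly])
  have lxo: "lipschitzian_on Z xo"
    unfolding xo_def weighted_estimate_alt
    by (intro lipschitzian_on_add lyi lipschitzian_on_sum lscale lnth[OF lb] finite)
  have lm: "lipschitzian_on Z m"
    unfolding m_def innov_def
    by (intro lipschitzian_on_vec_lambda lnth lipschitzian_on_add lyi)
  have lpm: "lipschitzian_on Z (\<lambda>s. pp s *v m s)"
    by (rule lipschitzian_on_bilinear[OF bounded_bilinear_matrix_vector_mult cZ lp lm])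
  have lout: "lipschitzian_on Z (\<lambda>s. outer (m s))"
    unfolding outer_def
    by (intro lipschitzian_on_vec_lambda lipschitzian_on_bilinear[OF bounded_bilinear_mult cZ] lnth[OF lm])
  have lpop: "lipschitzian_on Z (\<lambda>s. pp s ** outer (m s) ** pp s)"
    by (intro lipschitzian_on_bilinear[OF bounded_bilinear_matrix_mult cZ] lp lout)
  have lmb: "lipschitzian_on Z (\<lambda>s. m s \<bullet> pb s)"
    by (intro lipschitzian_on_bilinear[OF bounded_bilinear_inner cZ] lm lb)
  have inZ: "px s \<in> X" "pt s \<in> \<Theta>" if "s \<in> Z" for s using that K(2) by (auto simp: Z_def pd)
  have lg: "lipschitzian_on Z (\<lambda>s. g (xo s) (pt s))"
    by (rule lipschitzian_on_compose_pair[OF g lxo lt cZ]) (use inZ in auto)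
  have lf: "lipschitzian_on Z (\<lambda>s. f (px s) (g (xo s) (pt s)))"
    by (rule lipschitzian_on_compose_pair[OF f lx lg cZ]) (use inZ in auto)
  have lh: "lipschitzian_on Z (\<lambda>s. h (xo s) (pt s))"
    by (rule lipschitzian_on_compose_pair[OF h lxo lt cZ]) (use inZ in auto)
  have lG0: "lipschitzian_on Z G0"
    unfolding G0_def
    by (intro lipschitzian_on_Pair lipschitzian_on_add lipschitzian_on_vec_lambda lscale lf lh lpop lpm lmb
        lipschitzian_on_const lnth[OF lyi] lnth[OF lx] lipschitzian_on_linear[OF lx bounded_linear_matrix_vector]
        lipschitzian_on_linear[OF lyi bounded_linear_matrix_vector])
  have lG1: "lipschitzian_on Z G1"
    unfolding G1_def by (intro lipschitzian_on_Pair lipschitzian_on_add lpm lipschitzian_on_const)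
  obtain L0 L1 where L: "L0-lipschitz_on Z G0" "L1-lipschitz_on Z G1"
    using lG0 lG1 unfolding lipschitzian_on_def by blast
  have pxt: "(px s, pt s) = fst s" for s by (simp add: pd)
  have apriori: "z T \<in> interior Z" if T: "T \<ge> 0" and z0: "z 0 = s0"
    and r: "rate_on T z (\<lambda>t. G0 (z t) + \<nu> t *\<^sub>R G1 (z t))" and zZ: "\<And>t. t \<in> {0..T} \<Longrightarrow> z t \<in> Z" for T z
  proof -
    have b: "(px (z T), pt (z T)) \<in> interior K \<and> (\<forall>i. norm (py (z T) $ i) \<le> R) \<and> norm (pb (z T)) \<le> R \<and> norm (pp (z T)) \<le> R"
    proof (rule trappedD[OF inv T clp[OF r z0]])
      show "\<forall>t\<in>{0..T}. (px (z t), pt (z t)) \<in> K" unfolding pxt using zZ by (force simp: Z_def)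
    qed (simp_all add: z0 s0_def pd)
    have "norm (py (z T)) \<le> real CARD('m option) * R"
      using norm_vec_le_sum[of "py (z T)"] sum_bounded_above[of UNIV "\<lambda>i. norm (py (z T) $ i)" R] b by simp
    moreover have "norm (\<chi> i. xh0 i) \<ge> 0" "norm \<beta>0 \<ge> 0" "norm (\<gamma> *\<^sub>R mat 1 :: real^'m^'m) \<ge> 0" by (rule norm_ge_zero)+
    ultimately have "norm (py (z T)) < real CARD('m option) * R + norm (\<chi> i. xh0 i) + 1"
      "norm (pb (z T)) < R + norm \<beta>0 + 1" "norm (pp (z T)) < R + norm (\<gamma> *\<^sub>R mat 1 :: real^'m^'m) + 1"
      using b by linarith+
    then have "(fst (z T), py (z T), pb (z T), pp (z T)) \<in> interior Z"
      using b unfolding Z_def pxt by (simp add: interior_Times)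
    then show ?thesis by (simp add: pd)
  qed
  \<comment> \<open>A horizon of length zero already satisfies the premises of
    \<open>trapped\<close>, and a bound on a norm is nonnegative.\<close>
  have R0: "R \<ge> 0"
  proof -
    have "norm (pb s0) \<le> R"
    proof (rule trappedD[OF inv, of 0 "\<lambda>t. px s0" "\<lambda>t. pt s0" "\<lambda>t i. py s0 $ i" "\<lambda>t. pb s0" "\<lambda>t. pp s0", THEN conjunct2, THEN conjunct2, THEN conjunct1])
      have "rate_on 0 (\<lambda>t. s0) (\<lambda>t. G0 s0 + \<nu> t *\<^sub>R G1 s0)"
        using has_integral_refl(2)[of _ "0::real"] by (simp add: rate_on_def)
      then show "closed_loop f g h \<kappa> \<gamma> \<beta>0 \<epsilon> \<nu> 0 (\<lambda>t. px s0) (\<lambda>t. pt s0) (\<lambda>t i. py s0 $ i) (\<lambda>t. pb s0) (\<lambda>t. pp s0)"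
        using clp[of 0 "\<lambda>t. s0"] by simp
    qed (use x0 in \<open>auto simp: s0_def pd\<close>)
    then show ?thesis using norm_ge_zero order_trans by blast
  qed
  have s0Z: "s0 \<in> Z" using x0 R0 by (simp add: s0_def Z_def)
  obtain z where z: "z 0 = s0" "\<And>t. t \<ge> 0 \<Longrightarrow> z t \<in> Z" "\<And>T. rate_on T z (\<lambda>t. G0 (z t) + \<nu> t *\<^sub>R G1 (z t))"
  proof (rule noise_driven_solution_in_compact[where ?G0.0 = G0 and ?G1.0 = G1 and Z = Z and ?z0.0 = s0 and \<nu> = \<nu>,
        OF cZ s0Z L \<nu>])
    show "z T \<in> interior Z" if "T \<ge> 0" "z 0 = s0" "rate_on T z (\<lambda>t. G0 (z t) + \<nu> t *\<^sub>R G1 (z t))"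
      "\<And>t. t \<in> {0..T} \<Longrightarrow> z t \<in> Z" for T z
      using apriori[OF that(1-3)] that(4) by blast
  next
    fix z assume "z 0 = s0" "\<And>t. t \<ge> 0 \<Longrightarrow> z t \<in> Z" "\<And>T. rate_on T z (\<lambda>t. G0 (z t) + \<nu> t *\<^sub>R G1 (z t))"
    then show thesis by (rule that)
  qed
  show ?thesis
    by (rule that[of "\<lambda>t. px (z t)" "\<lambda>t. pt (z t)" "\<lambda>t i. py (z t) $ i" "\<lambda>t. pb (z t)" "\<lambda>t. pp (z t)"])
      (use z(1) clp[OF z(3) z(1)] z(2) in \<open>auto simp: s0_def pd Z_def mem_Times_iff\<close>)
qed

text \<open>A Caratheodory solution provides integrals only; the bounded rates required by
  \<open>rate_on\<close> are recovered from the continuity of the trajectories on compact intervals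
  and the bound on the noise.\<close>

lemma output_feedback_solution_closed_loop:
  fixes f :: "real ^ 'n::{finite,linorder} \<Rightarrow> real \<Rightarrow> real"
    and g :: "real ^ 'n::{finite,linorder} \<Rightarrow> 'p::euclidean_space \<Rightarrow> real"
    and h :: "real ^ 'n::{finite,linorder} \<Rightarrow> 'p \<Rightarrow> 'p"
  assumes f: "locally_lipschitz_on (X \<times> UNIV) (\<lambda>(x, u). f x u)"
    and g: "locally_lipschitz_on (UNIV \<times> \<Theta>) (\<lambda>(x, \<theta>). g x \<theta>)"
    and h: "locally_lipschitz_on (UNIV \<times> \<Theta>) (\<lambda>(x, \<theta>). h x \<theta>)"
    and \<nu>: "\<And>t. t \<ge> 0 \<Longrightarrow> \<bar>\<nu> t\<bar> \<le> \<nu>s"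
    and sol: "output_feedback_solution f g h X \<Theta> \<kappa> \<gamma> \<beta>0 \<epsilon> \<nu> x \<theta> xh \<beta> P"
  shows "closed_loop f g h \<kappa> \<gamma> \<beta>0 \<epsilon> \<nu> T x \<theta> xh \<beta> P"
proof -
  define xo where "xo t = weighted_estimate (\<beta> t) (xh t)" for t
  define m where "m t = innov (xh t)" for t
  note s = sol[unfolded output_feedback_solution_iff, folded xo_def m_def]
  have D: "x t \<in> X" "\<theta> t \<in> \<Theta>" if "t \<in> {0..T}" for t using s that by auto
  have rx: "has_rate x (\<lambda>t. chain_A *v x t + f (x t) (g (xo t) (\<theta> t)) *\<^sub>R axis (coord CARD('n)) 1)"
    and r\<theta>: "has_rate \<theta> (\<lambda>t. h (xo t) (\<theta> t))"
    and rxh: "has_rate (\<lambda>t. xh t i) (\<lambda>t. chain_A *v xh t i + (x t $ coord 1 + \<nu> t - xh t i $ coord 1) *\<^sub>R gain_vec \<kappa> \<epsilon>)"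
    and r\<beta>: "has_rate \<beta> (\<lambda>t. - ((x t $ coord 1 + \<nu> t - xh t None $ coord 1 + m t \<bullet> \<beta> t) *\<^sub>R (P t *v m t)))"
    and rP: "has_rate P (\<lambda>t. - (P t ** outer (m t) ** P t))" for i
    using s by blast+
  note cx = has_rate_continuous[OF rx, of T] and c\<theta> = has_rate_continuous[OF r\<theta>, of T]
    and cxh = has_rate_continuous[OF rxh, of T] and c\<beta> = has_rate_continuous[OF r\<beta>, of T]
    and cP = has_rate_continuous[OF rP, of T]
  note cnth = bounded_linear.continuous_on[OF bounded_linear_vec_nth]
  note cA = bounded_linear.continuous_on[OF bounded_linear_matrix_vector]
  have cxo: "continuous_on {0..T} xo"
    unfolding xo_def weighted_estimate_alt by (intro continuous_intros cxh cnth[OF c\<beta>])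
  have cm: "continuous_on {0..T} m"
    unfolding m_def innov_def by (intro continuous_intros cnth cxh)
  have cPm: "continuous_on {0..T} (\<lambda>t. P t *v m t)"
    by (rule bounded_bilinear.continuous_on[OF bounded_bilinear_matrix_vector_mult cP cm])
  have bc: "bounded (w ` {0..T})" if "continuous_on {0..T} w" for w :: "real \<Rightarrow> 'z::euclidean_space"
    using that by (intro compact_imp_bounded compact_continuous_image) auto
  have \<nu>': "\<bar>\<nu> t\<bar> \<le> \<nu>s" if "t \<in> {0..T}" for t using \<nu> that by auto
  have cg: "continuous_on {0..T} (\<lambda>t. g (xo t) (\<theta> t))"
    by (rule continuous_on_compose_pair[OF g cxo c\<theta>]) (use D in auto)
  have "rate_on T x (\<lambda>t. chain_A *v x t + f (x t) (g (xo t) (\<theta> t)) *\<^sub>R axis (coord CARD('n)) 1)"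
    by (rule has_rate_imp_rate_on[OF rx], rule bc)
      (intro continuous_intros cA[OF cx] continuous_on_compose_pair[OF f cx cg], use D in auto)
  moreover have "rate_on T \<theta> (\<lambda>t. h (xo t) (\<theta> t))"
    by (rule has_rate_imp_rate_on[OF r\<theta>], rule bc)
      (rule continuous_on_compose_pair[OF h cxo c\<theta>], use D in auto)
  moreover have "rate_on T (\<lambda>t. xh t i) (\<lambda>t. chain_A *v xh t i + (x t $ coord 1 + \<nu> t - xh t i $ coord 1) *\<^sub>R gain_vec \<kappa> \<epsilon>)" for i
  proof (rule has_rate_imp_rate_on[OF rxh])
    have "bounded ((\<lambda>t. (chain_A *v xh t i + (x t $ coord 1 - xh t i $ coord 1) *\<^sub>R gain_vec \<kappa> \<epsilon>) + \<nu> t *\<^sub>R gain_vec \<kappa> \<epsilon>) ` {0..T})"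
      by (intro bounded_noise_rate[where nb = \<nu>s] continuous_intros cA[OF cxh] cnth cx cxh \<nu>')
    then show "bounded ((\<lambda>t. chain_A *v xh t i + (x t $ coord 1 + \<nu> t - xh t i $ coord 1) *\<^sub>R gain_vec \<kappa> \<epsilon>) ` {0..T})"
      by (simp add: algebra_simps)
  qed
  moreover have "rate_on T \<beta> (\<lambda>t. - ((x t $ coord 1 + \<nu> t - xh t None $ coord 1 + m t \<bullet> \<beta> t) *\<^sub>R (P t *v m t)))"
  proof (rule has_rate_imp_rate_on[OF r\<beta>])
    have "bounded ((\<lambda>t. - ((x t $ coord 1 - xh t None $ coord 1 + m t \<bullet> \<beta> t) *\<^sub>R (P t *v m t)) + \<nu> t *\<^sub>R (- (P t *v m t))) ` {0..T})"
      by (intro bounded_noise_rate[where nb = \<nu>s] continuous_intros cnth cx cxh cm c\<beta> cPm \<nu>')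
    then show "bounded ((\<lambda>t. - ((x t $ coord 1 + \<nu> t - xh t None $ coord 1 + m t \<bullet> \<beta> t) *\<^sub>R (P t *v m t))) ` {0..T})"
      by (simp add: algebra_simps)
  qed
  moreover have "rate_on T P (\<lambda>t. - (P t ** outer (m t) ** P t))"
    by (rule has_rate_imp_rate_on[OF rP], rule bc)
      (intro continuous_on_minus bounded_bilinear.continuous_on[OF bounded_bilinear_matrix_mult] cP continuous_on_outer cm)
  ultimately show ?thesis
    unfolding closed_loop_def adaptive_observer_def using s by (simp add: xo_def m_def)
qed

lemma closed_loop_output_feedback_solution:
  fixes f :: "real ^ 'n::{finite,linorder} \<Rightarrow> real \<Rightarrow> real"
  assumes "\<And>T. closed_loop f g h \<kappa> \<gamma> \<beta>0 \<epsilon> \<nu> T x \<theta> xh \<beta> P" "\<And>t. t \<ge> 0 \<Longrightarrow> (x t, \<theta> t) \<in> X \<times> \<Theta>"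
  shows "output_feedback_solution f g h X \<Theta> \<kappa> \<gamma> \<beta>0 \<epsilon> \<nu> x \<theta> xh \<beta> P"
  using assms unfolding output_feedback_solution_iff closed_loop_def adaptive_observer_def
  by (auto intro!: rate_on_imp_has_rate)

theorem theorem1:
  fixes f :: "real ^ 'n::{finite,linorder} \<Rightarrow> real \<Rightarrow> real"
    and g :: "real ^ 'n::{finite,linorder} \<Rightarrow> 'p::euclidean_space \<Rightarrow> real"
    and h :: "real ^ 'n::{finite,linorder} \<Rightarrow> 'p \<Rightarrow> 'p"
    and X S2 :: "(real ^ 'n::{finite,linorder}) set" and \<Theta> :: "'p set"
    and Sig S S1 :: "((real ^ 'n::{finite,linorder}) \<times> 'p) set"
    and \<kappa> :: "nat \<Rightarrow> real" and \<gamma> :: real and \<beta>\<^sub>0 :: "real ^ 'm"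
  defines "F \<equiv> state_feedback_field f g h"
  assumes "open X" and "open \<Theta>"
    and "locally_lipschitz_on (X \<times> UNIV) (\<lambda>(x, u). f x u)"
    and "locally_lipschitz_on (UNIV \<times> \<Theta>) (\<lambda>(x, \<theta>). g x \<theta>)"
    and "locally_lipschitz_on (UNIV \<times> \<Theta>) (\<lambda>(x, \<theta>). h x \<theta>)"
    and "globally_bounded_in_state \<Theta> g" and "globally_bounded_in_state \<Theta> h"
    and "compact Sig" and "Sig \<noteq> {}" and "Sig \<subseteq> X \<times> \<Theta>"
    and "positively_invariant F (X \<times> \<Theta>) Sig"
    and "\<forall>(x, \<theta>)\<in>Sig. f x (g x \<theta>) = 0"
    and "uniformly_asymptotically_stable F (X \<times> \<Theta>) Sig"
    and "open S" and "connected S" and "S \<subseteq> region_of_attraction F (X \<times> \<Theta>) Sig"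
    and "hurwitz_coeffs CARD('n) \<kappa>"
    and "CARD('m option) \<ge> CARD('n) + 1"
    and "\<gamma> > 0"
    and "compact S1" and "S1 \<subseteq> S" and "compact S2"
  shows "\<exists>\<nu>s \<epsilon>1 \<epsilon>2. 0 < \<nu>s \<and> 0 < \<epsilon>1 \<and> \<epsilon>1 < \<epsilon>2 \<and> \<epsilon>2 \<le> 1 \<and>
    (\<forall>\<nu> \<epsilon>. \<nu> \<in> borel_measurable (lebesgue_on {0..}) \<and> (\<forall>t\<ge>0. \<bar>\<nu> t\<bar> \<le> \<nu>s) \<and> \<epsilon> \<in> {\<epsilon>1..\<epsilon>2} \<longrightarrow>
      (\<forall>x0 \<theta>0 xh0. (x0, \<theta>0) \<in> S1 \<and> weighted_estimate \<beta>\<^sub>0 xh0 \<in> S2 \<longrightarrow>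
        (\<exists>x \<theta> xh \<beta> P. output_feedback_solution f g h X \<Theta> \<kappa> \<gamma> \<beta>\<^sub>0 \<epsilon> \<nu> x \<theta> xh \<beta> P \<and>
            x 0 = x0 \<and> \<theta> 0 = \<theta>0 \<and> xh 0 = xh0) \<and>
        (\<forall>x \<theta> xh \<beta> P. output_feedback_solution f g h X \<Theta> \<kappa> \<gamma> \<beta>\<^sub>0 \<epsilon> \<nu> x \<theta> xh \<beta> P \<and>
            x 0 = x0 \<and> \<theta> 0 = \<theta>0 \<and> xh 0 = xh0 \<longrightarrow>
          bounded ((\<lambda>t. (x t, weighted_estimate (\<beta> t) (xh t))) ` {0..}) \<and>
          bounded (\<beta> ` {0..}) \<and>
          (\<forall>i. bounded ((\<lambda>t. xh t i) ` {0..})))))"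
proof -
  have "S1 \<subseteq> region_of_attraction (state_feedback_field f g h) (X \<times> \<Theta>) Sig"
    using assms(17,22) unfolding F_def by blast
  then obtain K \<nu>s \<epsilon>1 \<epsilon>2 where K: "compact K" "K \<subseteq> X \<times> \<Theta>" "S1 \<subseteq> K" and \<epsilon>12: "0 < \<nu>s" "0 < \<epsilon>1" "\<epsilon>1 < \<epsilon>2" "\<epsilon>2 \<le> 1" and
    inv: "\<And>\<nu> \<epsilon> x0 \<theta>0 xh0. \<nu> \<in> borel_measurable (lebesgue_on {0..}) \<Longrightarrow> (\<And>t. t \<ge> 0 \<Longrightarrow> \<bar>\<nu> t\<bar> \<le> \<nu>s) \<Longrightarrow> \<epsilon> \<in> {\<epsilon>1..\<epsilon>2} \<Longrightarrow>
      (x0, \<theta>0) \<in> S1 \<Longrightarrow> weighted_estimate \<beta>\<^sub>0 xh0 \<in> S2 \<Longrightarrow>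
      \<exists>R. trapped f g h \<kappa> \<gamma> \<beta>\<^sub>0 \<epsilon> \<nu> x0 \<theta>0 xh0 K R"
  proof (rule closed_loop_invariance[OF assms(2-11) assms(14)[unfolded F_def] assms(21) _ assms(23) assms(18,20), where ?\<beta>0.0 = \<beta>\<^sub>0], goal_cases)
    case (1 K \<nu>s \<epsilon>1 \<epsilon>2)
    show ?case by (rule that[OF 1(2-8)], rule 1(9))
  qed
  show ?thesis
  proof (rule exI[of _ \<nu>s], rule exI[of _ \<epsilon>1], rule exI[of _ \<epsilon>2], intro conjI \<epsilon>12, intro allI impI, elim conjE)
    fix \<nu> :: "real \<Rightarrow> real" and \<epsilon> :: real and x0 :: "(real, 'n) vec" and \<theta>0 and xh0 :: "'m option \<Rightarrow> (real, 'n) vec"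
    assume \<nu>: "\<nu> \<in> borel_measurable (lebesgue_on {0..})" "\<forall>t\<ge>0. \<bar>\<nu> t\<bar> \<le> \<nu>s" and \<epsilon>: "\<epsilon> \<in> {\<epsilon>1..\<epsilon>2}"
      and x0: "(x0, \<theta>0) \<in> S1" and xh0: "weighted_estimate \<beta>\<^sub>0 xh0 \<in> S2"
    have \<nu>b: "\<And>t. t \<ge> 0 \<Longrightarrow> \<bar>\<nu> t\<bar> \<le> \<nu>s" using \<nu>(2) by blast
    obtain R where R: "trapped f g h \<kappa> \<gamma> \<beta>\<^sub>0 \<epsilon> \<nu> x0 \<theta>0 xh0 K R"
      using inv[OF \<nu>(1) \<nu>b \<epsilon> x0 xh0] by blast
    have x0K: "(x0, \<theta>0) \<in> K" using x0 K(3) by blast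
    show "(\<exists>x \<theta> xh \<beta> P. output_feedback_solution f g h X \<Theta> \<kappa> \<gamma> \<beta>\<^sub>0 \<epsilon> \<nu> x \<theta> xh \<beta> P \<and>
            x 0 = x0 \<and> \<theta> 0 = \<theta>0 \<and> xh 0 = xh0) \<and>
        (\<forall>x \<theta> xh \<beta> P. output_feedback_solution f g h X \<Theta> \<kappa> \<gamma> \<beta>\<^sub>0 \<epsilon> \<nu> x \<theta> xh \<beta> P \<and>
            x 0 = x0 \<and> \<theta> 0 = \<theta>0 \<and> xh 0 = xh0 \<longrightarrow>
          bounded ((\<lambda>t. (x t, weighted_estimate (\<beta> t) (xh t))) ` {0..}) \<and>
          bounded (\<beta> ` {0..}) \<and>
          (\<forall>i. bounded ((\<lambda>t. xh t i) ` {0..})))"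
    proof (rule conjI)
      obtain x \<theta> xh \<beta> P where sol: "x 0 = x0" "\<theta> 0 = \<theta>0" "xh 0 = xh0"
        "\<forall>T. closed_loop f g h \<kappa> \<gamma> \<beta>\<^sub>0 \<epsilon> \<nu> T x \<theta> xh \<beta> P" "\<forall>t\<ge>0. (x t, \<theta> t) \<in> K"
        by (rule closed_loop_exists[OF assms(4-6) K(1,2) x0K \<nu>(1) \<nu>b R])
      have "output_feedback_solution f g h X \<Theta> \<kappa> \<gamma> \<beta>\<^sub>0 \<epsilon> \<nu> x \<theta> xh \<beta> P"
        by (rule closed_loop_output_feedback_solution) (use sol(4,5) K(2) in blast)+
      with sol(1-3) show "\<exists>x \<theta> xh \<beta> P. output_feedback_solution f g h X \<Theta> \<kappa> \<gamma> \<beta>\<^sub>0 \<epsilon> \<nu> x \<theta> xh \<beta> P \<and>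
            x 0 = x0 \<and> \<theta> 0 = \<theta>0 \<and> xh 0 = xh0" by blast
      show "\<forall>x \<theta> xh \<beta> P. output_feedback_solution f g h X \<Theta> \<kappa> \<gamma> \<beta>\<^sub>0 \<epsilon> \<nu> x \<theta> xh \<beta> P \<and>
            x 0 = x0 \<and> \<theta> 0 = \<theta>0 \<and> xh 0 = xh0 \<longrightarrow>
          bounded ((\<lambda>t. (x t, weighted_estimate (\<beta> t) (xh t))) ` {0..}) \<and>
          bounded (\<beta> ` {0..}) \<and>
          (\<forall>i. bounded ((\<lambda>t. xh t i) ` {0..}))"
      proof (intro allI impI, elim conjE)
        fix x :: "real \<Rightarrow> (real, 'n) vec" and \<theta> :: "real \<Rightarrow> 'p" and xh and \<beta> :: "real \<Rightarrow> (real, 'm) vec" and P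
        assume sol: "output_feedback_solution f g h X \<Theta> \<kappa> \<gamma> \<beta>\<^sub>0 \<epsilon> \<nu> x \<theta> xh \<beta> P"
          and i0: "x 0 = x0" "\<theta> 0 = \<theta>0" "xh 0 = xh0"
        have cl: "closed_loop f g h \<kappa> \<gamma> \<beta>\<^sub>0 \<epsilon> \<nu> T x \<theta> xh \<beta> P" for T
          by (rule output_feedback_solution_closed_loop[OF assms(4-6) \<nu>b sol])
        \<comment> \<open>Boundedness is claimed for every solution, so confinement is derived here
          for an arbitrary one instead of the one constructed above.\<close>
        have inK: "(x t, \<theta> t) \<in> K" if t: "t \<ge> 0" for t
        proof -
          have "rate_on t x (\<lambda>t. chain_A *v x t + f (x t) (g (weighted_estimate (\<beta> t) (xh t)) (\<theta> t)) *\<^sub>R axis (coord CARD('n)) 1)"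
            "rate_on t \<theta> (\<lambda>t. h (weighted_estimate (\<beta> t) (xh t)) (\<theta> t))"
            using cl[of t] unfolding closed_loop_def adaptive_observer_def by blast+
          then have "continuous_on {0..t} (\<lambda>t. (x t, \<theta> t))"
            by (intro continuous_on_Pair rate_on_continuous)
          then have "(x t, \<theta> t) \<in> interior K"
          proof (rule stays_in_interior[OF _ compact_imp_closed[OF K(1)]])
            fix \<tau> assume "\<tau> \<in> {0..t}" "\<And>s. s \<in> {0..\<tau>} \<Longrightarrow> (x s, \<theta> s) \<in> K"
            then show "(x \<tau>, \<theta> \<tau>) \<in> interior K" using trappedD[OF R _ cl i0, of \<tau>] by auto
          qed (use x0K i0 t in auto)
          then show ?thesis using interior_subset by blast
        qed
        have bd: "norm (xh t i) \<le> R" "norm (\<beta> t) \<le> R" if "t \<ge> 0" for t i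
          using trappedD[OF R that cl i0] inK by auto
        obtain Bx where Bx: "\<And>z. z \<in> K \<Longrightarrow> norm z \<le> Bx"
          using compact_imp_bounded[OF K(1)] unfolding bounded_iff by blast
        have "bounded ((\<lambda>t. (x t, weighted_estimate (\<beta> t) (xh t))) ` {0..})"
        proof (rule boundedI[of _ "Bx + (R + (\<Sum>j\<in>(UNIV :: 'm set). R * (R + R)))"])
          fix y assume "y \<in> (\<lambda>t. (x t, weighted_estimate (\<beta> t) (xh t))) ` {0..}"
          then obtain t where y: "y = (x t, weighted_estimate (\<beta> t) (xh t))" and t: "t \<ge> 0" by auto
          have "norm (x t, weighted_estimate (\<beta> t) (xh t)) \<le> norm (x t) + norm (weighted_estimate (\<beta> t) (xh t))"
            by (rule norm_Pair_le)
          also have "\<dots> \<le> Bx + (R + (\<Sum>j\<in>(UNIV :: 'm set). R * (R + R)))"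
          proof (intro add_mono)
            show "norm (x t) \<le> Bx" using Bx[OF inK[OF t]] norm_fst_le[of "x t" "\<theta> t"] by linarith
            have "norm (weighted_estimate (\<beta> t) (xh t)) \<le> norm (xh t None) + norm (\<Sum>j\<in>UNIV. \<beta> t $ j *\<^sub>R (xh t None - xh t (Some j)))"
              unfolding weighted_estimate_alt by (rule norm_triangle_ineq4)
            also have "\<dots> \<le> R + (\<Sum>j\<in>(UNIV :: 'm set). R * (R + R))"
            proof (intro add_mono bd(1)[OF t] sum_norm_le)
              fix j
              have "\<bar>\<beta> t $ j\<bar> \<le> R" using component_le_norm_cart[of "\<beta> t" j] bd(2)[OF t] by linarith
              moreover have "norm (xh t None - xh t (Some j)) \<le> R + R"
                using norm_triangle_ineq4[of "xh t None" "xh t (Some j)"] bd(1)[OF t, of None] bd(1)[OF t, of "Some j"] by linarith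
              ultimately show "norm (\<beta> t $ j *\<^sub>R (xh t None - xh t (Some j))) \<le> R * (R + R)"
                unfolding norm_scaleR real_norm_def by (intro mult_mono) (auto intro: order_trans[OF abs_ge_zero])
            qed
            finally show "norm (weighted_estimate (\<beta> t) (xh t)) \<le> R + (\<Sum>j\<in>(UNIV :: 'm set). R * (R + R))" .
          qed
          finally show "norm y \<le> Bx + (R + (\<Sum>j\<in>(UNIV :: 'm set). R * (R + R)))" unfolding y .
        qed
        moreover have "bounded (\<beta> ` {0..})" by (rule boundedI[of _ R]) (use bd(2) in auto)
        moreover have "bounded ((\<lambda>t. xh t i) ` {0..})" for i by (rule boundedI[of _ R]) (use bd(1) in auto)
        ultimately show "bounded ((\<lambda>t. (x t, weighted_estimate (\<beta> t) (xh t))) ` {0..}) \<and>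
          bounded (\<beta> ` {0..}) \<and> (\<forall>i. bounded ((\<lambda>t. xh t i) ` {0..}))" by blast
      qed
    qed
  qed
qed

end
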